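(* Let $(X_k)_{k\geq -1}$ be a nonprimitive INAR(2) process with autoregressive parameter $(\alpha,\beta)=(0,1)$ (hence it is unstable) and innovations $(\varepsilon_k)_{k\in\mathbb{N}}$. Suppose that $X_0=X_{-1}=0$, $\mathrm{E}(\varepsilon_1^2)<\infty$ and $\mu_\varepsilon>0$. For each $n\in\mathbb{N}$ let $(\widehat\alpha_n,\widehat\beta_n)$ be a CLS estimator of the autoregressive parameter based on a sample of size $n$, and put $\mathbf{X}_n=(X_1,\ldots,X_n)$. Then $$\begin{bmatrix}n\,\widehat\alpha_n(\mathbf{X}_n)\\ n\,(\widehat\beta_n(\mathbf{X}_n)-1)\end{bmatrix}\ \longrightarrow\ \frac{\int_0^1\mathcal{W}_t\,\mathrm{d}\mathcal{W}_t}{\int_0^1(\mathcal{W}_t)^2\,\mathrm{d}t}\begin{bmatrix}-1\\1\end{bmatrix}\qquad\text{in distribution as } n\to\infty,$$ where $(\mathcal{W}_t)_{t\in\mathbb{R}_+}$ is a standard Wiener process (and $\int_0^1\mathcal{W}_t\,\mathrm{d}\mathcal{W}_t$ is an Itô integral).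
   Context: All random variables are defined on a fixed probability space $(\Omega,\mathcal{A},\mathrm{P})$. $\mathbb{N}$ denotes the positive integers, $\mathbb{R}$ the real numbers and $\mathbb{R}_+$ the non-negative reals. INAR(2) process: let $(\varepsilon_k)_{k\in\mathbb{N}}$ (the innovations) be i.i.d. non-negative integer-valued random variables and $(\alpha,\beta)\in[0,1]^2$ (the autoregressive parameter). An INAR(2) process with autoregressive parameter $(\alpha,\beta)$ and innovations $(\varepsilon_k)_{k\in\mathbb{N}}$ is a process $(X_k)_{k\ge -1}$ with $$X_k=\sum_{j=1}^{X_{k-1}}\xi_{k,j}+\sum_{j=1}^{X_{k-2}}\eta_{k,j}+\varepsilon_k,\qquad k\in\mathbb{N},$$ where for all $k\in\mathbb{N}$, $(\xi_{k,j})_{j\in\mathbb{N}}$ and $(\eta_{k,j})_{j\in\mathbb{N}}$ are sequences of i.i.d. Bernoulli random variables with mean $\alpha$ and $\beta$, respectively, such that these sequences are mutually independent and independent of $(\varepsilon_k)_{k\in\mathbb{N}}$, and $X_0,X_{-1}$ are non-negative integer-valued random variables independent of all the sequences $(\xi_{k,j})_{j\in\mathbb{N}}$, $(\eta_{k,j})_{j\in\mathbb{N}}$, $k\in\mathbb{N}$, and $(\varepsilon_k)_{k\in\mathbb{N}}$. The mean of $\varepsilon_1$ is denoted by $\mu_\varepsilon$. The process is called primitive if $\alpha>0$ and $\beta>0$, and nonprimitive if $\alpha=0$ or $\beta=0$. It is called unstable if the spectral radius of the matrix $\begin{bmatrix}\alpha&\beta\\1&0\end{bmatrix}$ equals $1$,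 equivalently if $\alpha+\beta=1$. CLS (conditional least squares) estimator: for $n\in\mathbb{N}$, $\mathbf{x}_n=(x_1,\ldots,x_n)\in\mathbb{R}^n$ (with the convention $x_{-1}:=x_0:=0$) and $\alpha',\beta'\in\mathbb{R}$ put $$Q_n(\mathbf{x}_n;\alpha',\beta'):=\sum_{k=1}^n(x_k-\alpha'x_{k-1}-\beta'x_{k-2}-\mu_\varepsilon)^2 .$$ A CLS estimator of the autoregressive parameter (based on a sample of size $n$) is a measurable function $(\widehat\alpha_n,\widehat\beta_n):\mathbb{R}^n\to\mathbb{R}^2$ such that $Q_n(\mathbf{x}_n;\widehat\alpha_n(\mathbf{x}_n),\widehat\beta_n(\mathbf{x}_n))=\inf_{(\alpha',\beta')\in\mathbb{R}^2}Q_n(\mathbf{x}_n;\alpha',\beta')$ for all $\mathbf{x}_n\in\mathbb{R}^n$.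
   Formalization: The innovations are additionally assumed to have positive variance; if they equal a constant c ≥ 1, the CLS estimator is exactly (0,1) for n ≥ 3, so the scaled vector is 0 and the stated limit fails. *)

theory Defs
  imports "HOL-Probability.Probability"
begin

text \<open>
  All noise sequences are indexed by the positive integers; the values of the functions below at
  index 0 are never used.
\<close>

datatype noise_index = Innov nat | Xi nat nat | Eta nat nat

definition noise_indices :: "noise_index set" where
  "noise_indices =
     {Innov k | k. 1 \<le> k} \<union> {Xi k j | k j. 1 \<le> k \<and> 1 \<le> j} \<union> {Eta k j | k j. 1 \<le> k \<and> 1 \<le> j}"

fun noise ::
  "(nat \<Rightarrow> 'a \<Rightarrow> nat) \<Rightarrow> (nat \<Rightarrow> nat \<Rightarrow> 'a \<Rightarrow> nat) \<Rightarrow> (nat \<Rightarrow> nat \<Rightarrow> 'a \<Rightarrow> nat) \<Rightarrow> noise_index \<Rightarrow> 'a \<Rightarrow> nat"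
where
  "noise \<epsilon> \<xi> \<eta> (Innov k) = \<epsilon> k"
| "noise \<epsilon> \<xi> \<eta> (Xi k j) = \<xi> k j"
| "noise \<epsilon> \<xi> \<eta> (Eta k j) = \<eta> k j"

definition bernoulli_rv :: "'a measure \<Rightarrow> real \<Rightarrow> ('a \<Rightarrow> nat) \<Rightarrow> bool" where
  "bernoulli_rv M p Y \<longleftrightarrow>
     distr M (count_space UNIV) Y = measure_pmf (map_pmf of_bool (bernoulli_pmf p))"

text \<open>
  Independence of \<open>(X\<^sub>0, X\<^sub>-\<^sub>1)\<close> from the noise is stated on the level of the generated
  sigma-algebras, because the two random elements have different types.
\<close>

definition inar2_process ::
  "'a measure \<Rightarrow> real \<Rightarrow> real \<Rightarrow> (nat \<Rightarrow> 'a \<Rightarrow> nat) \<Rightarrow> (int \<Rightarrow> 'a \<Rightarrow> nat) \<Rightarrow> bool"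
where
  "inar2_process M \<alpha> \<beta> \<epsilon> X \<longleftrightarrow>
     prob_space M \<and> \<alpha> \<in> {0..1} \<and> \<beta> \<in> {0..1} \<and>
     (\<forall>k\<ge>-1. X k \<in> measurable M (count_space UNIV)) \<and>
     (\<exists>\<xi> \<eta>.
        prob_space.indep_vars M (\<lambda>_. count_space UNIV) (noise \<epsilon> \<xi> \<eta>) noise_indices \<and>
        (\<forall>k\<ge>1. distr M (count_space UNIV) (\<epsilon> k) = distr M (count_space UNIV) (\<epsilon> 1)) \<and>
        (\<forall>k\<ge>1. \<forall>j\<ge>1. bernoulli_rv M \<alpha> (\<xi> k j) \<and> bernoulli_rv M \<beta> (\<eta> k j)) \<and>
        prob_space.indep_set M
          (sets (vimage_algebra (space M) (\<lambda>\<omega>. (X 0 \<omega>, X (-1) \<omega>)) (count_space UNIV)))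
          (sets (vimage_algebra (space M) (\<lambda>\<omega>. \<lambda>i\<in>noise_indices. noise \<epsilon> \<xi> \<eta> i \<omega>)
                   (\<Pi>\<^sub>M i\<in>noise_indices. count_space UNIV))) \<and>
        (\<forall>k\<ge>1. AE \<omega> in M.
           X (int k) \<omega> =
             (\<Sum>j = 1..X (int k - 1) \<omega>. \<xi> k j \<omega>) + (\<Sum>j = 1..X (int k - 2) \<omega>. \<eta> k j \<omega>) + \<epsilon> k \<omega>))"

text \<open>
  Points of \<open>\<real>\<^sup>n\<close> are functions on \<open>{1..n}\<close> (extensional, i.e. elements of the product measure
  space), so that \<open>n\<close> may vary.
\<close>

abbreviation sample_space :: "nat \<Rightarrow> (nat \<Rightarrow> real) measure" where
  "sample_space n \<equiv> \<Pi>\<^sub>M i\<in>{1..n}. borel"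

definition padded :: "(nat \<Rightarrow> real) \<Rightarrow> int \<Rightarrow> real" where
  "padded x k = (if k \<le> 0 then 0 else x (nat k))"

definition cls_objective :: "real \<Rightarrow> nat \<Rightarrow> (nat \<Rightarrow> real) \<Rightarrow> real \<times> real \<Rightarrow> real" where
  "cls_objective \<mu> n x = (\<lambda>(a, b).
     \<Sum>k = 1..n. (x k - a * padded x (int k - 1) - b * padded x (int k - 2) - \<mu>)\<^sup>2)"

definition cls_estimator :: "real \<Rightarrow> nat \<Rightarrow> ((nat \<Rightarrow> real) \<Rightarrow> real \<times> real) \<Rightarrow> bool" where
  "cls_estimator \<mu> n f \<longleftrightarrow>
     f \<in> measurable (sample_space n) borel \<and>
     (\<forall>x\<in>space (sample_space n). cls_objective \<mu> n x (f x) = (INF p. cls_objective \<mu> n x p))"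

definition converges_in_distribution ::
  "'a measure \<Rightarrow> (nat \<Rightarrow> 'a \<Rightarrow> 'c::metric_space) \<Rightarrow> 'b measure \<Rightarrow> ('b \<Rightarrow> 'c) \<Rightarrow> bool"
where
  "converges_in_distribution M Y N Z \<longleftrightarrow>
     (\<forall>n. Y n \<in> borel_measurable M) \<and> Z \<in> borel_measurable N \<and>
     (\<forall>f :: 'c \<Rightarrow> real. continuous_on UNIV f \<and> bounded (range f) \<longrightarrow>
        (\<lambda>n. \<integral>\<omega>. f (Y n \<omega>) \<partial>M) \<longlonglongrightarrow> (\<integral>\<omega>. f (Z \<omega>) \<partial>N))"

definition wiener_process :: "'b measure \<Rightarrow> (real \<Rightarrow> 'b \<Rightarrow> real) \<Rightarrow> bool" where
  "wiener_process N W \<longleftrightarrow>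
     prob_space N \<and>
     (\<forall>t\<ge>0. W t \<in> borel_measurable N) \<and>
     (AE \<omega> in N. W 0 \<omega> = 0) \<and>
     (\<forall>n. \<forall>t :: nat \<Rightarrow> real. 0 \<le> t 0 \<and> strict_mono_on {..n} t \<longrightarrow>
        prob_space.indep_vars N (\<lambda>_. borel) (\<lambda>i \<omega>. W (t (Suc i)) \<omega> - W (t i) \<omega>) {..<n}) \<and>
     (\<forall>s t. 0 \<le> s \<and> s < t \<longrightarrow>
        distributed N lborel (\<lambda>\<omega>. W t \<omega> - W s \<omega>) (normal_density 0 (sqrt (t - s)))) \<and>
     (\<forall>\<omega>\<in>space N. continuous_on {0..} (\<lambda>t. W t \<omega>))"

definition natural_filtration ::
  "'b measure \<Rightarrow> (real \<Rightarrow> 'b \<Rightarrow> real) \<Rightarrow> real \<Rightarrow> 'b measure"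
where
  "natural_filtration N W t =
     sigma (space N) {W s -` A \<inter> space N | s A. 0 \<le> s \<and> s \<le> t \<and> A \<in> sets borel}"

text \<open>
  The triple \<open>(m, t, e)\<close> encodes the simple process
  \<open>e\<^sub>0 1\<^bsub>(t\<^sub>0, t\<^sub>1]\<^esub> + \<dots> + e\<^bsub>m-1\<^esub> 1\<^bsub>(t\<^bsub>m-1\<^esub>, t\<^sub>m]\<^esub>\<close>.
\<close>

type_synonym 'b simple_process = "nat \<times> (nat \<Rightarrow> real) \<times> (nat \<Rightarrow> 'b \<Rightarrow> real)"

definition simple_process ::
  "'b measure \<Rightarrow> (real \<Rightarrow> 'b measure) \<Rightarrow> real \<Rightarrow> 'b simple_process \<Rightarrow> bool"
where
  "simple_process N F T = (\<lambda>(m, t, e).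
     0 \<le> t 0 \<and> mono_on {..m} t \<and> t m \<le> T \<and>
     (\<forall>i<m. e i \<in> borel_measurable (F (t i)) \<and> integrable N (\<lambda>\<omega>. (e i \<omega>)\<^sup>2)))"

definition simple_value :: "'b simple_process \<Rightarrow> real \<Rightarrow> 'b \<Rightarrow> real" where
  "simple_value = (\<lambda>(m, t, e) s \<omega>. \<Sum>i<m. e i \<omega> * indicator {t i<..t (Suc i)} s)"

definition simple_integral :: "(real \<Rightarrow> 'b \<Rightarrow> real) \<Rightarrow> 'b simple_process \<Rightarrow> 'b \<Rightarrow> real" where
  "simple_integral W = (\<lambda>(m, t, e) \<omega>. \<Sum>i<m. e i \<omega> * (W (t (Suc i)) \<omega> - W (t i) \<omega>))"

definition ito_integrand ::
  "'b measure \<Rightarrow> (real \<Rightarrow> 'b measure) \<Rightarrow> real \<Rightarrow> (real \<Rightarrow> 'b \<Rightarrow> real) \<Rightarrow> bool"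
where
  "ito_integrand N F T H \<longleftrightarrow>
     (\<lambda>(t, \<omega>). H t \<omega>) \<in> borel_measurable (restrict_space lborel {0..T} \<Otimes>\<^sub>M N) \<and>
     (\<forall>t\<in>{0..T}. H t \<in> borel_measurable (F t)) \<and>
     (\<integral>\<^sup>+\<omega>. (\<integral>\<^sup>+t\<in>{0..T}. ennreal ((H t \<omega>)\<^sup>2) \<partial>lborel) \<partial>N) < \<infinity>"

definition has_ito_integral ::
  "'b measure \<Rightarrow> (real \<Rightarrow> 'b \<Rightarrow> real) \<Rightarrow> real \<Rightarrow> (real \<Rightarrow> 'b \<Rightarrow> real) \<Rightarrow> ('b \<Rightarrow> real) \<Rightarrow> bool"
where
  "has_ito_integral N W T H I \<longleftrightarrow>
     ito_integrand N (natural_filtration N W) T H \<and> I \<in> borel_measurable N \<and>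
     (\<exists>\<phi> :: nat \<Rightarrow> 'b simple_process.
        (\<forall>n. simple_process N (natural_filtration N W) T (\<phi> n)) \<and>
        (\<lambda>n. \<integral>\<^sup>+\<omega>. (\<integral>\<^sup>+t\<in>{0..T}. ennreal ((H t \<omega> - simple_value (\<phi> n) t \<omega>)\<^sup>2) \<partial>lborel) \<partial>N)
          \<longlonglongrightarrow> 0 \<and>
        (\<lambda>n. \<integral>\<^sup>+\<omega>. ennreal ((simple_integral W (\<phi> n) \<omega> - I \<omega>)\<^sup>2) \<partial>N) \<longlonglongrightarrow> 0)"

text \<open>The It\^o integral over \<open>[0, T]\<close>; it is determined only up to a null set, hence the choice.\<close>

definition ito_integral ::
  "'b measure \<Rightarrow> (real \<Rightarrow> 'b \<Rightarrow> real) \<Rightarrow> real \<Rightarrow> (real \<Rightarrow> 'b \<Rightarrow> real) \<Rightarrow> 'b \<Rightarrow> real"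
where
  "ito_integral N W T H = (SOME I. has_ito_integral N W T H I)"

end

theory Submission
  imports Defs "HOL-Real_Asymp.Real_Asymp"
begin

text \<open>
  For the parameter \<open>(0, 1)\<close> the process satisfies \<open>X\<^sub>k = X\<^bsub>k-2\<^esub> + \<epsilon>\<^sub>k\<close>, so its values at even and at odd
  times are two independent random walks with drift \<open>\<mu>\<close>. Both grow linearly, while the difference
  \<open>v\<close> of consecutive values is of order \<open>sqrt n\<close> and alternates in sign: up to a bounded term it is
  \<open>\<plusminus>T\<close>, where \<open>T\<close> is the centred random walk with increments \<open>\<plusminus>(\<epsilon>\<^sub>k - \<mu>)\<close>.

  In terms of the regressors \<open>v\<close> and \<open>z\<close> (the process two steps back) the least squares problem becomes
  \<open>\<epsilon>\<^sub>k - \<mu> \<approx> a * v + c * z\<close> with \<open>a = \<alpha>'\<close> and \<open>c = \<alpha>' + \<beta>' - 1\<close> for a candidate \<open>(\<alpha>', \<beta>')\<close>. The alternating sign of \<open>v\<close> makes the two regressors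
  asymptotically orthogonal (\<open>sum_z_v_vanishes\<close>), so \<open>c\<close> is of smaller order than \<open>1 / n\<close>, which explains
  the direction \<open>(-1, 1)\<close>, and \<open>n * a\<close> is asymptotically the quotient of \<open>- \<Sum> T dT / n\<close> and
  \<open>\<Sum> T\<^sup>2 / n\<^sup>2\<close>. Summation by parts and the law of large numbers express the numerator through \<open>T\<^sub>n\<^sup>2\<close>.

  It remains to find the joint limit of \<open>T\<^sub>n\<^sup>2 / n\<close> and \<open>\<Sum> T\<^sup>2 / n\<^sup>2\<close>. Since a quotient is at most \<open>x\<close> if
  and only if a linear combination of numerator and denominator is at most 0
  (\<open>converges_in_law_ratio\<close>), one-dimensional limits of linear combinations suffice. They are proved in
  \<open>walk_functional_limit\<close>: the walk is cut into finitely many blocks, the block sums are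
  asymptotically normal and independent, and the error of replacing the walk by its values at the block
  boundaries is controlled by second moments.

  On the side of the limit, the It\^o integral of \<open>W\<close> against itself has to be identified with
  \<open>(W\<^sub>1\<^sup>2 - 1) / 2\<close>. For a simple process \<open>\<phi>\<close>, the mean square distance of \<open>\<integral> \<phi> dW\<close> from this variable
  equals that of \<open>\<phi>\<close> from \<open>W\<close> (\<open>ito_square_isometry\<close>), which yields both that the integral exists and that
  it is almost surely this variable.
\<close>

section \<open>Second moments and independence of the past\<close>

lemma integrable_mult_square_integrable:
  fixes X Y :: "'a \<Rightarrow> real"
  assumes [measurable]: "X \<in> borel_measurable M" "Y \<in> borel_measurable M"
    and "integrable M (\<lambda>x. (X x)\<^sup>2)" "integrable M (\<lambda>x. (Y x)\<^sup>2)"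
  shows "integrable M (\<lambda>x. X x * Y x)"
proof (rule Bochner_Integration.integrable_bound)
  show "integrable M (\<lambda>x. (X x)\<^sup>2 + (Y x)\<^sup>2)" using assms by simp
  have "\<bar>a * b\<bar> \<le> a\<^sup>2 + b\<^sup>2" for a b :: real
    using zero_le_power2[of "\<bar>a\<bar> - \<bar>b\<bar>"] mult_nonneg_nonneg[OF abs_ge_zero abs_ge_zero, of a b]
    unfolding power2_diff abs_mult power2_abs by linarith
  then show "AE x in M. norm (X x * Y x) \<le> norm ((X x)\<^sup>2 + (Y x)\<^sup>2)"
    by simp
qed simp

lemma integrable_square_add:
  fixes X Y :: "'a \<Rightarrow> real"
  assumes [measurable]: "X \<in> borel_measurable M" "Y \<in> borel_measurable M"
    and "integrable M (\<lambda>x. (X x)\<^sup>2)" "integrable M (\<lambda>x. (Y x)\<^sup>2)"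
  shows "integrable M (\<lambda>x. (X x + Y x)\<^sup>2)"
  using assms integrable_mult_square_integrable[OF assms]
  by (simp add: power2_sum mult.assoc)

text \<open>
  The Cauchy--Schwarz inequality with the two norms replaced by upper bounds; only such bounds are
  available for the random walks below.
\<close>

lemma expectation_abs_mult_le:
  fixes X Y :: "'a \<Rightarrow> real"
  assumes [measurable]: "X \<in> borel_measurable M" "Y \<in> borel_measurable M"
    and X: "integrable M (\<lambda>x. (X x)\<^sup>2)" and Y: "integrable M (\<lambda>x. (Y x)\<^sup>2)"
    and a: "(\<integral>x. (X x)\<^sup>2 \<partial>M) \<le> a\<^sup>2" and b: "(\<integral>x. (Y x)\<^sup>2 \<partial>M) \<le> b\<^sup>2" and pos: "0 \<le> a" "0 \<le> b"
  shows "(\<integral>x. \<bar>X x * Y x\<bar> \<partial>M) \<le> a * b"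
proof (rule field_le_epsilon)
  fix e :: real assume e: "0 < e"
  \<comment> \<open>A weighted arithmetic-geometric mean inequality; the weights are perturbed because \<open>a\<close> or \<open>b\<close> may vanish.\<close>
  have gen: "(\<integral>x. \<bar>X x * Y x\<bar> \<partial>M) \<le> a' * b'" if "a < a'" "b < b'" for a' b'
  proof -
    have p: "0 < a'" "0 < b'" using that pos by auto
    have ineq: "\<bar>s * t\<bar> \<le> (b' / a') / 2 * s\<^sup>2 + (a' / b') / 2 * t\<^sup>2" for s t
    proof -
      have "0 \<le> (b' * \<bar>s\<bar> - a' * \<bar>t\<bar>)\<^sup>2" by simp
      then have "2 * (a' * b') * \<bar>s * t\<bar> \<le> b'\<^sup>2 * s\<^sup>2 + a'\<^sup>2 * t\<^sup>2"
        by (simp add: power2_diff power_mult_distrib abs_mult algebra_simps)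
      then show ?thesis using p by (simp add: field_simps power2_eq_square)
    qed
    have "(\<integral>x. \<bar>X x * Y x\<bar> \<partial>M) \<le> (\<integral>x. (b' / a') / 2 * (X x)\<^sup>2 + (a' / b') / 2 * (Y x)\<^sup>2 \<partial>M)"
      using X Y integrable_mult_square_integrable[OF assms(1-4)]
      by (intro integral_mono ineq) auto
    also have "\<dots> = (b' / a') / 2 * (\<integral>x. (X x)\<^sup>2 \<partial>M) + (a' / b') / 2 * (\<integral>x. (Y x)\<^sup>2 \<partial>M)"
      using X Y by simp
    also have "\<dots> \<le> (b' / a') / 2 * a'\<^sup>2 + (a' / b') / 2 * b'\<^sup>2"
    proof (intro add_mono mult_left_mono)
      have "a\<^sup>2 \<le> a'\<^sup>2" "b\<^sup>2 \<le> b'\<^sup>2" using that pos by (auto intro!: power_mono)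
      then show "(\<integral>x. (X x)\<^sup>2 \<partial>M) \<le> a'\<^sup>2" "(\<integral>x. (Y x)\<^sup>2 \<partial>M) \<le> b'\<^sup>2" using a b by auto
    qed (use p in auto)
    also have "\<dots> = a' * b'" using p by (simp add: field_simps power2_eq_square)
    finally show ?thesis .
  qed
  have "((\<lambda>d. (a + d) * (b + d)) \<longlongrightarrow> (a + 0) * (b + 0)) (at_right 0)"
    by (intro tendsto_intros)
  moreover have "eventually (\<lambda>d. (\<integral>x. \<bar>X x * Y x\<bar> \<partial>M) \<le> (a + d) * (b + d)) (at_right (0::real))"
    using eventually_at_right_less[of 0] by eventually_elim (rule gen; simp)
  ultimately have "(\<integral>x. \<bar>X x * Y x\<bar> \<partial>M) \<le> (a + 0) * (b + 0)"
    by (rule tendsto_lowerbound) simp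
  then show "(\<integral>x. \<bar>X x * Y x\<bar> \<partial>M) \<le> a * b + e" using e by simp
qed

lemma (in prob_space) expectation_abs_le_sqrt_moment:
  fixes X :: "'a \<Rightarrow> real"
  assumes [measurable]: "X \<in> borel_measurable M"
    and X: "integrable M (\<lambda>x. (X x)\<^sup>2)" and a: "expectation (\<lambda>x. (X x)\<^sup>2) \<le> a\<^sup>2" "0 \<le> a"
  shows "expectation (\<lambda>x. \<bar>X x\<bar>) \<le> a"
  using expectation_abs_mult_le[of X M "\<lambda>_. 1" a 1] assms by (simp add: prob_space)

lemma Int_stable_preimages: "Int_stable {f -` A \<inter> S | A. A \<in> sets N}"
proof (rule Int_stableI)
  fix a b assume "a \<in> {f -` A \<inter> S | A. A \<in> sets N}" "b \<in> {f -` A \<inter> S | A. A \<in> sets N}"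
  then obtain A B where "a = f -` A \<inter> S" "A \<in> sets N" "b = f -` B \<inter> S" "B \<in> sets N" by auto
  then have "a \<inter> b = f -` (A \<inter> B) \<inter> S" "A \<inter> B \<in> sets N" by auto
  then show "a \<inter> b \<in> {f -` A \<inter> S | A. A \<in> sets N}" by blast
qed

text \<open>
  Both the Wiener increments and the innovations are independent of a \<open>\<sigma>\<close>-algebra \<open>F\<close> describing
  the past. Independence is stated between \<open>F\<close> and the events \<open>{D \<in> B}\<close>, so that it passes to every
  pair of an \<open>F\<close>-measurable variable and a function of \<open>D\<close>.
\<close>

definition indep_of_past :: "'a measure \<Rightarrow> 'a measure \<Rightarrow> ('a \<Rightarrow> real) \<Rightarrow> bool" where
  "indep_of_past M F D \<longleftrightarrow> subalgebra M F \<and> D \<in> borel_measurable M \<and>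
     prob_space.indep_set M (sets F) {D -` B \<inter> space M | B. B \<in> sets borel}"

lemma (in prob_space) indep_of_past_indep_var:
  fixes Z D g :: "_ \<Rightarrow> real"
  assumes D: "indep_of_past M F D" and Z: "Z \<in> borel_measurable F"
    and [measurable]: "g \<in> borel_measurable borel"
  shows "indep_var borel Z borel (\<lambda>\<omega>. g (D \<omega>))"
proof -
  have sub: "subalgebra M F" and [measurable]: "D \<in> borel_measurable M"
    and ind: "indep_set (sets F) {D -` B \<inter> space M | B. B \<in> sets borel}"
    using D by (auto simp: indep_of_past_def)
  have [measurable]: "Z \<in> borel_measurable M" by (rule measurable_from_subalg[OF sub Z])
  let ?ZZ = "{Z -` A \<inter> space M | A. A \<in> sets borel}"
  let ?GG = "{(\<lambda>\<omega>. g (D \<omega>)) -` A \<inter> space M | A. A \<in> sets borel}"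
  have "indep_set ?ZZ ?GG"
  proof (rule indep_setI)
    show "?ZZ \<subseteq> events" "?GG \<subseteq> events" by auto
    fix a b assume "a \<in> ?ZZ" "b \<in> ?GG"
    then obtain A B where A: "A \<in> sets borel" "a = Z -` A \<inter> space M"
      and B: "B \<in> sets borel" "b = (\<lambda>\<omega>. g (D \<omega>)) -` B \<inter> space M" by auto
    have "a \<in> sets F" using A Z sub by (auto simp: subalgebra_def dest: measurable_sets)
    moreover have "b \<in> {D -` B \<inter> space M | B. B \<in> sets borel}"
    proof (intro CollectI exI conjI)
      show "b = D -` (g -` B \<inter> space borel) \<inter> space M" using B by auto
      show "g -` B \<inter> space borel \<in> sets borel" using B(1) by (rule measurable_sets[OF assms(3)])
    qed
    ultimately show "prob (a \<inter> b) = prob a * prob b" by (rule indep_setD[OF ind])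
  qed
  then have "indep_set (sigma_sets (space M) ?ZZ) (sigma_sets (space M) ?GG)"
    by (rule indep_set_sigma_sets) (rule Int_stable_preimages)+
  then show ?thesis unfolding indep_var_eq by simp
qed

lemma (in prob_space) indep_of_past_mult:
  fixes Z D g :: "_ \<Rightarrow> real"
  assumes D: "indep_of_past M F D" and Z: "Z \<in> borel_measurable F"
    and g: "g \<in> borel_measurable borel" and int: "integrable M Z" "integrable M (\<lambda>\<omega>. g (D \<omega>))"
  shows "integrable M (\<lambda>\<omega>. Z \<omega> * g (D \<omega>))"
    and "expectation (\<lambda>\<omega>. Z \<omega> * g (D \<omega>)) = expectation Z * expectation (\<lambda>\<omega>. g (D \<omega>))"
  using indep_var_integrable[OF indep_of_past_indep_var[OF D Z g] int]
    indep_var_lebesgue_integral[OF indep_of_past_indep_var[OF D Z g] int] by auto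

text \<open>
  Orthogonality of martingale differences: in the square of the sum the mixed terms
  \<open>H i * D i * H j * D j\<close> with \<open>i < j\<close> have mean zero because \<open>D j\<close> is centred and independent of the
  other three factors. For Wiener increments this is the It\^o isometry, for innovations it bounds
  every linear statistic that occurs below.
\<close>

lemma (in prob_space) predictable_transform_second_moment:
  fixes D H :: "nat \<Rightarrow> 'a \<Rightarrow> real" and F :: "nat \<Rightarrow> 'a measure"
  assumes ind: "\<And>i. i < n \<Longrightarrow> indep_of_past M (F i) (D i)"
    and mono: "\<And>i j. i \<le> j \<Longrightarrow> j < n \<Longrightarrow> sets (F i) \<subseteq> sets (F j)"
    and adapted: "\<And>i j. i < j \<Longrightarrow> j < n \<Longrightarrow> D i \<in> borel_measurable (F j)"
    and H: "\<And>i. i < n \<Longrightarrow> H i \<in> borel_measurable (F i)"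
    and H2: "\<And>i. i < n \<Longrightarrow> integrable M (\<lambda>\<omega>. (H i \<omega>)\<^sup>2)"
    and D2: "\<And>i. i < n \<Longrightarrow> integrable M (\<lambda>\<omega>. (D i \<omega>)\<^sup>2)"
    and D_mean: "\<And>i. i < n \<Longrightarrow> expectation (D i) = 0"
    and D_var: "\<And>i. i < n \<Longrightarrow> expectation (\<lambda>\<omega>. (D i \<omega>)\<^sup>2) = d i"
  shows "integrable M (\<lambda>\<omega>. (\<Sum>i<n. H i \<omega> * D i \<omega>)\<^sup>2)" (is ?int)
    and "expectation (\<lambda>\<omega>. (\<Sum>i<n. H i \<omega> * D i \<omega>)\<^sup>2) = (\<Sum>i<n. d i * expectation (\<lambda>\<omega>. (H i \<omega>)\<^sup>2))" (is ?eq)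
proof -
  have sub: "subalgebra M (F i)" if "i < n" for i
    using ind[OF that] by (auto simp: indep_of_past_def)
  have Hj: "H i \<in> borel_measurable (F j)" if "i \<le> j" "j < n" for i j
    using H[of i] mono[OF that] sub[of i] sub[of j] that
    by (intro measurable_from_subalg[of "F j" "F i"]) (auto simp: subalgebra_def)
  have "k \<le> n \<Longrightarrow> integrable M (\<lambda>\<omega>. (\<Sum>i<k. H i \<omega> * D i \<omega>)\<^sup>2) \<and>
     expectation (\<lambda>\<omega>. (\<Sum>i<k. H i \<omega> * D i \<omega>)\<^sup>2) = (\<Sum>i<k. d i * expectation (\<lambda>\<omega>. (H i \<omega>)\<^sup>2))" for k
  proof (induction k)
    case (Suc k)
    then have k: "k < n" by simp
    define S where "S \<omega> = (\<Sum>i<k. H i \<omega> * D i \<omega>)" for \<omega>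
    have SF: "S \<in> borel_measurable (F k)" unfolding S_def
      using k by (intro borel_measurable_sum borel_measurable_times Hj adapted) auto
    have HF: "H k \<in> borel_measurable (F k)" by (rule H[OF k])
    have SM: "S \<in> borel_measurable M" and HM: "H k \<in> borel_measurable M"
      using SF HF measurable_from_subalg[OF sub[OF k]] by auto
    have DM: "D k \<in> borel_measurable M" using ind[OF k] by (simp add: indep_of_past_def)
    have S2: "integrable M (\<lambda>\<omega>. (S \<omega>)\<^sup>2)"
      and IH: "expectation (\<lambda>\<omega>. (S \<omega>)\<^sup>2) = (\<Sum>i<k. d i * expectation (\<lambda>\<omega>. (H i \<omega>)\<^sup>2))"
      using Suc.IH k by (simp_all add: S_def)
    have D1: "integrable M (D k)" by (rule square_integrable_imp_integrable[OF DM D2[OF k]])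
    have HD: "integrable M (\<lambda>\<omega>. (H k \<omega>)\<^sup>2 * (D k \<omega>)\<^sup>2)"
      "expectation (\<lambda>\<omega>. (H k \<omega>)\<^sup>2 * (D k \<omega>)\<^sup>2) = expectation (\<lambda>\<omega>. (H k \<omega>)\<^sup>2) * d k"
      using indep_of_past_mult[OF ind[OF k] borel_measurable_power[OF HF] _ H2[OF k], of "\<lambda>x. x\<^sup>2"]
        D2[OF k] D_var[OF k] by simp_all
    have SH: "integrable M (\<lambda>\<omega>. S \<omega> * H k \<omega>)"
      by (rule integrable_mult_square_integrable[OF SM HM S2 H2[OF k]])
    have SHD: "integrable M (\<lambda>\<omega>. S \<omega> * H k \<omega> * D k \<omega>)" "expectation (\<lambda>\<omega>. S \<omega> * H k \<omega> * D k \<omega>) = 0"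
      using indep_of_past_mult[OF ind[OF k] borel_measurable_times[OF SF HF] _ SH, of "\<lambda>x. x"]
        D1 D_mean[OF k] by simp_all
    have eq: "(\<Sum>i<Suc k. H i \<omega> * D i \<omega>)\<^sup>2 =
        (S \<omega>)\<^sup>2 + (2 * (S \<omega> * H k \<omega> * D k \<omega>) + (H k \<omega>)\<^sup>2 * (D k \<omega>)\<^sup>2)" for \<omega>
      unfolding sum.lessThan_Suc S_def[symmetric] by (simp add: power2_eq_square algebra_simps)
    show ?case
      unfolding eq using S2 HD SHD by (simp add: IH mult.commute)
  qed simp
  then show ?int ?eq by auto
qed

section \<open>Wiener processes and their past\<close>

locale wiener =
  fixes N :: "'b measure" and W :: "real \<Rightarrow> 'b \<Rightarrow> real"
  assumes wiener: "wiener_process N W"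
begin

sublocale prob_space N
  using wiener by (simp add: wiener_process_def)

abbreviation past :: "real \<Rightarrow> 'b measure" where
  "past \<equiv> natural_filtration N W"

lemma measurable_W [measurable (raw)]: "0 \<le> t \<Longrightarrow> W t \<in> borel_measurable N"
  using wiener by (simp add: wiener_process_def)

lemma W_start: "AE \<omega> in N. W 0 \<omega> = 0"
  using wiener by (simp add: wiener_process_def)

lemma W_indep:
  "0 \<le> t 0 \<Longrightarrow> strict_mono_on {..n} t \<Longrightarrow> indep_vars (\<lambda>_. borel) (\<lambda>i \<omega>. W (t (Suc i)) \<omega> - W (t i) \<omega>) {..<n}"
  using wiener by (simp add: wiener_process_def)

lemma W_distributed:
  "0 \<le> s \<Longrightarrow> s < t \<Longrightarrow> distributed N lborel (\<lambda>\<omega>. W t \<omega> - W s \<omega>) (normal_density 0 (sqrt (t - s)))"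
  using wiener by (simp add: wiener_process_def)

lemma continuous_W: "\<omega> \<in> space N \<Longrightarrow> continuous_on {0..} (\<lambda>t. W t \<omega>)"
  using wiener by (simp add: wiener_process_def)

lemma integrable_increment_power:
  assumes "0 \<le> s" "s \<le> t"
  shows "integrable N (\<lambda>\<omega>. (W t \<omega> - W s \<omega>) ^ k)"
proof (cases "s = t")
  case True
  then show ?thesis by simp
next
  case False
  then have st: "s < t" using assms by simp
  show ?thesis
    using distributed_integrable[OF W_distributed[OF assms(1) st], of "\<lambda>x. x ^ k"]
      integrable_normal_moment[of "sqrt (t - s)" 0 k] st by simp
qed

lemma integrable_increment: "0 \<le> s \<Longrightarrow> s \<le> t \<Longrightarrow> integrable N (\<lambda>\<omega>. W t \<omega> - W s \<omega>)"
  using integrable_increment_power[of s t 1] by simp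

lemma
  assumes "0 \<le> s" "s \<le> t"
  shows increment_odd_moment: "expectation (\<lambda>\<omega>. (W t \<omega> - W s \<omega>) ^ (2 * k + 1)) = 0"
    and increment_variance: "expectation (\<lambda>\<omega>. (W t \<omega> - W s \<omega>)\<^sup>2) = t - s"
    and increment_fourth_moment: "expectation (\<lambda>\<omega>. (W t \<omega> - W s \<omega>) ^ 4) = 3 * (t - s)\<^sup>2"
proof -
  have *: "expectation (\<lambda>\<omega>. (W t \<omega> - W s \<omega>) ^ k) = (\<integral>x. normal_density 0 (sqrt (t - s)) x * x ^ k \<partial>lborel)"
    if "s < t" for k
    using distributed_integral[OF W_distributed[OF assms(1) that], of "\<lambda>x. x ^ k"] by simp
  show "expectation (\<lambda>\<omega>. (W t \<omega> - W s \<omega>) ^ (2 * k + 1)) = 0"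
    using *[of "2 * k + 1"] integral_normal_moment_odd[of "sqrt (t - s)" 0 k] assms
    by (cases "s = t") auto
  show "expectation (\<lambda>\<omega>. (W t \<omega> - W s \<omega>)\<^sup>2) = t - s"
    using *[of 2] integral_normal_moment_even[of "sqrt (t - s)" 0 1] assms
    by (cases "s = t") auto
  show "expectation (\<lambda>\<omega>. (W t \<omega> - W s \<omega>) ^ 4) = 3 * (t - s)\<^sup>2"
    using *[of 4] integral_normal_moment_even[of "sqrt (t - s)" 0 2] assms
    by (cases "s = t") (auto simp: fact_numeral power_divide)
qed

lemma increment_mean: "0 \<le> s \<Longrightarrow> s \<le> t \<Longrightarrow> expectation (\<lambda>\<omega>. W t \<omega> - W s \<omega>) = 0"
  using increment_odd_moment[of s t 0] by simp

lemma increment_third_moment: "0 \<le> s \<Longrightarrow> s \<le> t \<Longrightarrow> expectation (\<lambda>\<omega>. (W t \<omega> - W s \<omega>) ^ 3) = 0"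
  using increment_odd_moment[of s t 1] by simp

lemma
  assumes "0 \<le> t"
  shows integrable_W_power: "integrable N (\<lambda>\<omega>. W t \<omega> ^ k)"
    and expectation_W_power: "expectation (\<lambda>\<omega>. W t \<omega> ^ k) = expectation (\<lambda>\<omega>. (W t \<omega> - W 0 \<omega>) ^ k)"
proof -
  have [measurable]: "W t \<in> borel_measurable N" "W 0 \<in> borel_measurable N" using assms by auto
  have *: "AE \<omega> in N. W t \<omega> ^ k = (W t \<omega> - W 0 \<omega>) ^ k" using W_start by eventually_elim simp
  show "integrable N (\<lambda>\<omega>. W t \<omega> ^ k)"
    using integrable_increment_power[of 0 t k] assms
    by (subst integrable_cong_AE[OF _ _ *]) auto
  show "expectation (\<lambda>\<omega>. W t \<omega> ^ k) = expectation (\<lambda>\<omega>. (W t \<omega> - W 0 \<omega>) ^ k)"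
    by (rule integral_cong_AE[OF _ _ *]) auto
qed

lemma W_second_moment: "0 \<le> t \<Longrightarrow> expectation (\<lambda>\<omega>. (W t \<omega>)\<^sup>2) = t"
  using expectation_W_power[of t 2] increment_variance[of 0 t] by simp

lemma W_fourth_moment: "0 \<le> t \<Longrightarrow> expectation (\<lambda>\<omega>. W t \<omega> ^ 4) = 3 * t\<^sup>2"
  using expectation_W_power[of t 4] increment_fourth_moment[of 0 t] by simp

lemma space_past [simp]: "space (past t) = space N"
  by (auto simp: natural_filtration_def space_measure_of_conv)

lemma sets_past:
  "sets (past t) = sigma_sets (space N) {W s -` A \<inter> space N | s A. 0 \<le> s \<and> s \<le> t \<and> A \<in> sets borel}"
  unfolding natural_filtration_def by (rule sets_measure_of) auto

lemma subalgebra_past: "subalgebra N (past t)"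
  unfolding subalgebra_def sets_past
  by (auto intro!: sets.sigma_sets_subset measurable_sets)

lemma sets_past_mono: "s \<le> t \<Longrightarrow> sets (past s) \<subseteq> sets (past t)"
  unfolding sets_past by (rule sigma_sets_mono') force

lemma past_mono: "s \<le> t \<Longrightarrow> f \<in> borel_measurable (past s) \<Longrightarrow> f \<in> borel_measurable (past t)"
  by (rule measurable_from_subalg[of _ "past s"]) (auto simp: subalgebra_def sets_past_mono)

lemma W_past: "0 \<le> s \<Longrightarrow> s \<le> t \<Longrightarrow> W s \<in> borel_measurable (past t)"
  by (rule measurableI) (auto simp: sets_past intro!: sigma_sets.Basic)

lemma past_measurable: "f \<in> borel_measurable (past t) \<Longrightarrow> f \<in> borel_measurable N"
  by (rule measurable_from_subalg[OF subalgebra_past])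

text \<open>
  The values at finitely many times in \<open>[0, s]\<close> are, up to the null set where \<open>W 0 \<noteq> 0\<close>, partial sums
  of increments over a common refinement of these times; the increment over \<open>[s, t]\<close> is the next one
  in that list and hence independent of them.
\<close>

lemma increment_indep_of_finitely_many:
  assumes S: "finite S" "S \<subseteq> {0..s}" and st: "0 \<le> s" "s < t"
    and A: "\<And>u. u \<in> S \<Longrightarrow> A u \<in> sets borel" and B: "B \<in> sets borel"
  defines "a \<equiv> {\<omega>\<in>space N. \<forall>u\<in>S. W u \<omega> \<in> A u}" and "b \<equiv> {\<omega>\<in>space N. W t \<omega> - W s \<omega> \<in> B}"
  shows "prob (a \<inter> b) = prob a * prob b"
proof -
  define L where "L = sorted_list_of_set (S \<union> {0, s})"
  define p where "p = length L - 1"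
  have L: "set L = S \<union> {0, s}"
    unfolding L_def using S by (intro set_sorted_list_of_set) simp
  have L_sorted: "sorted_wrt (<) L"
    unfolding L_def by (rule strict_sorted_list_of_set)
  have len: "length L = Suc p" using L by (cases L) (auto simp: p_def)
  \<comment> \<open>An increasing list of times from 0 over the given times to \<open>s\<close>, followed by \<open>t\<close>.\<close>
  define \<tau> where "\<tau> i = (if i \<le> p then L ! i else t)" for i
  have L_le: "L ! i \<in> {0..s}" if "i \<le> p" for i
    using that len L S st nth_mem[of i L] by auto
  have mono: "strict_mono_on {..Suc p} \<tau>"
  proof (rule strict_mono_onI)
    fix i j assume ij: "i \<in> {..Suc p}" "j \<in> {..Suc p}" "i < j"
    show "\<tau> i < \<tau> j"
    proof (cases "j \<le> p")
      case True
      then have "L ! i < L ! j"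
        using sorted_wrt_nth_less[OF L_sorted, of i j] ij len by simp
      then show ?thesis using True ij by (simp add: \<tau>_def)
    next
      case False
      then show ?thesis using L_le[of i] ij st by (auto simp: \<tau>_def)
    qed
  qed
  have "\<exists>i. i \<le> p \<and> \<tau> i = u" if "u \<in> S \<union> {0, s}" for u
    using that L len by (metis \<tau>_def in_set_conv_nth less_Suc_eq_le)
  then obtain ix where ix: "\<And>u. u \<in> S \<union> {0, s} \<Longrightarrow> ix u \<le> p \<and> \<tau> (ix u) = u" by metis
  have \<tau>0: "\<tau> 0 = 0"
  proof -
    have "\<tau> 0 \<le> \<tau> (ix 0)" using ix[of 0] strict_mono_on_leD[OF mono, of 0 "ix 0"] by simp
    then show ?thesis using ix[of 0] L_le[of 0] by (auto simp: \<tau>_def)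
  qed
  have \<tau>p: "\<tau> p = s"
  proof -
    have "\<tau> (ix s) \<le> \<tau> p" using ix[of s] strict_mono_on_leD[OF mono, of "ix s" p] by simp
    then show ?thesis using ix[of s] L_le[of p] by (auto simp: \<tau>_def)
  qed
  define D where "D i \<omega> = W (\<tau> (Suc i)) \<omega> - W (\<tau> i) \<omega>" for i \<omega>
  have "indep_vars (\<lambda>_. borel) D {..<Suc p}"
    unfolding D_def using \<tau>0 mono by (intro W_indep) auto
  then have ind: "indep_var (PiM {..<p} (\<lambda>_. borel)) (\<lambda>\<omega>. restrict (\<lambda>i. D i \<omega>) {..<p})
      (PiM {p} (\<lambda>_. borel)) (\<lambda>\<omega>. restrict (\<lambda>i. D i \<omega>) {p})"
    by (rule indep_var_restrict) auto
  have \<tau>_nonneg: "0 \<le> \<tau> i" for i using L_le[of i] st by (auto simp: \<tau>_def)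
  have [measurable]: "W (\<tau> i) \<in> borel_measurable N" for i by (rule measurable_W[OF \<tau>_nonneg])
  have [measurable]: "D i \<in> borel_measurable N" for i unfolding D_def by measurable
  have [measurable]: "W s \<in> borel_measurable N" "W t \<in> borel_measurable N" using st by auto
  have Wu: "W u \<in> borel_measurable N" if "u \<in> S" for u using that S by auto
  have tele: "W (\<tau> i) \<omega> - W 0 \<omega> = (\<Sum>j<i. D j \<omega>)" for i \<omega>
    unfolding D_def using sum_lessThan_telescope[of "\<lambda>j. W (\<tau> j) \<omega>" i] \<tau>0 by simp
  let ?X = "{x \<in> space (PiM {..<p} (\<lambda>_. borel)). \<forall>u\<in>S. (\<Sum>j<ix u. x j) \<in> A u}"
  let ?Y = "{x \<in> space (PiM {p} (\<lambda>_. borel)). x p \<in> B}"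
  have X: "?X \<in> sets (PiM {..<p} (\<lambda>_. borel))"
  proof (rule sets.sets_Collect_finite_All)
    fix u assume u: "u \<in> S"
    then have "(\<lambda>x. \<Sum>j<ix u. x j :: real) \<in> borel_measurable (PiM {..<p} (\<lambda>_. borel))"
      using ix[of u] by (intro borel_measurable_sum[where f="\<lambda>j x. x j"] measurable_component_singleton) auto
    from measurable_sets[OF this A[OF u]]
    show "{x \<in> space (PiM {..<p} (\<lambda>_. borel)). (\<Sum>j<ix u. x j) \<in> A u} \<in> sets (PiM {..<p} (\<lambda>_. borel))"
      by (simp add: vimage_def Int_def conj_commute)
  qed (rule S)
  have Y: "?Y \<in> sets (PiM {p} (\<lambda>_. borel))"
    using measurable_sets[OF measurable_component_singleton[of p "{p}" "\<lambda>_. borel :: real measure"] B]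
    by (simp add: vimage_def Int_def conj_commute)
  define a' where "a' = {\<omega>\<in>space N. \<forall>u\<in>S. (\<Sum>j<ix u. D j \<omega>) \<in> A u}"
  have a': "a' = (\<lambda>\<omega>. restrict (\<lambda>i. D i \<omega>) {..<p}) -` ?X \<inter> space N"
  proof -
    have "(\<Sum>j<ix u. restrict (\<lambda>i. D i \<omega>) {..<p} j) = (\<Sum>j<ix u. D j \<omega>)" if "u \<in> S" for u \<omega>
      using ix[of u] that by (intro sum.cong) auto
    then show ?thesis by (auto simp: a'_def space_PiM PiE_iff)
  qed
  have b: "b = (\<lambda>\<omega>. restrict (\<lambda>i. D i \<omega>) {p}) -` ?Y \<inter> space N"
    by (auto simp: b_def space_PiM PiE_iff D_def \<tau>p) (auto simp: \<tau>_def)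
  have am: "a \<in> events"
    unfolding a_def
    using measurable_sets[OF Wu A] by (intro sets.sets_Collect_finite_All S) (auto simp: vimage_def Int_def conj_commute)
  have a'm: "a' \<in> events"
    unfolding a' by (rule measurable_sets[OF indep_var_rv1[OF ind] X])
  have bm: "b \<in> events"
    unfolding b by (rule measurable_sets[OF indep_var_rv2[OF ind] Y])
  have AE: "AE \<omega> in N. \<omega> \<in> a \<longleftrightarrow> \<omega> \<in> a'"
    using W_start
  proof eventually_elim
    case (elim \<omega>)
    have "W u \<omega> = (\<Sum>j<ix u. D j \<omega>)" if "u \<in> S" for u
      using tele[of "ix u" \<omega>] ix[of u] that elim by simp
    then show ?case by (auto simp: a_def a'_def)
  qed
  have "prob (a \<inter> b) = prob (a' \<inter> b)"
    using AE am a'm bm by (intro measure_eq_AE) auto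
  also have "\<dots> = prob a' * prob b"
  proof -
    have "a' \<inter> b = (\<lambda>x. (\<lambda>i\<in>{..<p}. D i x, \<lambda>i\<in>{p}. D i x)) -` (?X \<times> ?Y) \<inter> space N"
      unfolding a' b by auto
    then show ?thesis using indep_varD[OF ind X Y] unfolding a' b by simp
  qed
  also have "prob a' = prob a" using AE am a'm by (intro measure_eq_AE) auto
  finally show ?thesis .
qed

text \<open>
  The events about finitely many times form a generator of the past that is stable under
  intersections, which extends the preceding lemma to the whole \<open>\<sigma>\<close>-algebra.
\<close>

lemma increment_indep_of_past:
  assumes "0 \<le> s" "s \<le> t"
  shows "indep_of_past N (past s) (\<lambda>\<omega>. W t \<omega> - W s \<omega>)"
proof (cases "s = t")
  case True
  have [simp]: "{\<omega> \<in> space N. P} = (if P then space N else {})" for P by auto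
  have "prob (a \<inter> b) = prob a * prob b"
    if "a \<in> events" "b \<in> {(\<lambda>\<omega>. W t \<omega> - W s \<omega>) -` B \<inter> space N | B. B \<in> sets borel}" for a b
    using that True sets.sets_into_space[OF that(1)]
    by (auto simp: vimage_def Int_def prob_space split: if_splits)
       (metis Int_absorb2 Int_def prob_space mult.right_neutral)
  then show ?thesis using subalgebra_past[of s] True
    unfolding indep_of_past_def by (intro conjI indep_setI) (auto simp: subalgebra_def)
next
  case False
  with assms have st: "s < t" by simp
  have [measurable]: "W s \<in> borel_measurable N" "W t \<in> borel_measurable N" using assms by auto
  let ?G = "{W u -` A \<inter> space N | u A. 0 \<le> u \<and> u \<le> s \<and> A \<in> sets borel}"
  let ?E = "{{\<omega>\<in>space N. \<forall>u\<in>S. W u \<omega> \<in> A u} | S A. finite S \<and> S \<subseteq> {0..s} \<and> (\<forall>u\<in>S. A u \<in> sets borel)}"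
  let ?H = "{(\<lambda>\<omega>. W t \<omega> - W s \<omega>) -` B \<inter> space N | B. B \<in> sets borel}"
  have "indep_set ?E ?H"
  proof (rule indep_setI)
    show "?E \<subseteq> events"
    proof clarify
      fix S and A :: "real \<Rightarrow> real set"
      assume S: "finite S" "S \<subseteq> {0..s}" "\<forall>u\<in>S. A u \<in> sets borel"
      have "{\<omega> \<in> space N. W u \<omega> \<in> A u} \<in> events" if "u \<in> S" for u
        using measurable_sets[of "W u" N borel "A u"] S that by (auto simp: vimage_def Int_def conj_commute)
      then show "{\<omega>\<in>space N. \<forall>u\<in>S. W u \<omega> \<in> A u} \<in> events"
        using S by (intro sets.sets_Collect_finite_All) auto
    qed
    show "?H \<subseteq> events" by auto
    fix a b assume "a \<in> ?E" "b \<in> ?H"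
    then obtain S A B where *: "finite S" "S \<subseteq> {0..s}" "\<forall>u\<in>S. A u \<in> sets borel" "B \<in> sets borel"
        "a = {\<omega>\<in>space N. \<forall>u\<in>S. W u \<omega> \<in> A u}" "b = {\<omega>\<in>space N. W t \<omega> - W s \<omega> \<in> B}"
      by (auto simp: vimage_def Int_def conj_commute)
    then show "prob (a \<inter> b) = prob a * prob b"
      using increment_indep_of_finitely_many[of S s t A B] assms st by simp
  qed
  moreover have "Int_stable ?E"
  proof (rule Int_stableI)
    fix a b assume "a \<in> ?E" "b \<in> ?E"
    then obtain S A T B where *: "finite S" "S \<subseteq> {0..s}" "\<forall>u\<in>S. A u \<in> sets borel"
        "a = {\<omega>\<in>space N. \<forall>u\<in>S. W u \<omega> \<in> A u}" "finite T" "T \<subseteq> {0..s}" "\<forall>u\<in>T. B u \<in> sets borel"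
        "b = {\<omega>\<in>space N. \<forall>u\<in>T. W u \<omega> \<in> B u}" by auto
    let ?C = "\<lambda>u. (if u \<in> S then A u else UNIV) \<inter> (if u \<in> T then B u else UNIV)"
    have "a \<inter> b = {\<omega>\<in>space N. \<forall>u\<in>S \<union> T. W u \<omega> \<in> ?C u}"
      using * by auto
    moreover have "\<forall>u\<in>S \<union> T. ?C u \<in> sets borel" using * by auto
    ultimately show "a \<inter> b \<in> ?E" using * by (intro CollectI exI[of _ "S \<union> T"] exI[of _ ?C]) auto
  qed
  ultimately have ind: "indep_set (sigma_sets (space N) ?E) (sigma_sets (space N) ?H)"
    by (rule indep_set_sigma_sets) (rule Int_stable_preimages)
  have "?G \<subseteq> ?E"
  proof clarify
    fix u and A :: "real set" assume "0 \<le> u" "u \<le> s" "A \<in> sets borel"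
    then show "\<exists>S B. W u -` A \<inter> space N = {\<omega>\<in>space N. \<forall>u\<in>S. W u \<omega> \<in> B u} \<and>
        finite S \<and> S \<subseteq> {0..s} \<and> (\<forall>u\<in>S. B u \<in> sets borel)"
      by (intro exI[of _ "{u}"] exI[of _ "\<lambda>_. A"]) auto
  qed
  then have "sets (past s) \<subseteq> sigma_sets (space N) ?E"
    unfolding sets_past by (rule sigma_sets_mono')
  moreover have "?H \<subseteq> sigma_sets (space N) ?H" by (rule sigma_sets_superset_generator)
  ultimately have "indep_set (sets (past s)) ?H"
    using ind unfolding indep_sets2_eq by blast
  then show ?thesis unfolding indep_of_past_def using subalgebra_past by simp
qed

end

section \<open>The It\^o integral of the Wiener process against itself\<close>

lemma disjoint_interval_sum:
  fixes \<tau> :: "nat \<Rightarrow> real"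
  assumes "mono_on {..m} \<tau>" "i < m" "s \<in> {\<tau> i<..\<tau> (Suc i)}"
  shows "(\<Sum>j<m. f j * indicator {\<tau> j<..\<tau> (Suc j)} s) = (f i :: real)"
proof -
  have "s \<notin> {\<tau> j<..\<tau> (Suc j)}" if "j < m" "j \<noteq> i" for j
  proof (cases "j < i")
    case True
    then have "\<tau> (Suc j) \<le> \<tau> i" using assms by (intro mono_onD[OF assms(1)]) auto
    then show ?thesis using assms by auto
  next
    case False
    then have "\<tau> (Suc i) \<le> \<tau> j" using that assms by (intro mono_onD[OF assms(1)]) auto
    then show ?thesis using assms by auto
  qed
  then have "(\<Sum>j<m. f j * indicator {\<tau> j<..\<tau> (Suc j)} s) = (\<Sum>j<m. if j = i then f i else 0)"
    using assms by (intro sum.cong) (auto simp: indicator_def)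
  then show ?thesis using assms by simp
qed

context wiener
begin

text \<open>
  By continuity of the paths, \<open>W\<close> is the pointwise limit of processes that are constant on the
  intervals of a grid, and these are jointly measurable. The maximum with 0 is there because nothing
  is known about \<open>W\<close> at negative times.
\<close>

lemma measurable_W_joint: "(\<lambda>(\<omega>, t). W (max 0 t) \<omega>) \<in> borel_measurable (N \<Otimes>\<^sub>M borel)"
proof (rule borel_measurable_LIMSEQ_metric)
  fix n :: nat
  define c where "c = real (Suc n)"
  have c: "0 < c" by (simp add: c_def)
  have "(\<lambda>p. nat \<lfloor>c * snd p\<rfloor>) \<in> N \<Otimes>\<^sub>M borel \<rightarrow>\<^sub>M count_space UNIV"
    by measurable
  moreover have "(\<lambda>p. W (real k / c) (fst p)) \<in> borel_measurable (N \<Otimes>\<^sub>M borel)" for k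
    by (rule measurable_compose[OF measurable_fst measurable_W]) (use c in simp)
  ultimately have "(\<lambda>p. W (real (nat \<lfloor>c * snd p\<rfloor>) / c) (fst p)) \<in> borel_measurable (N \<Otimes>\<^sub>M borel)"
    by (rule measurable_compose_countable[rotated])
  then show "(\<lambda>p. W (real (nat \<lfloor>real (Suc n) * snd p\<rfloor>) / real (Suc n)) (fst p)) \<in> borel_measurable (N \<Otimes>\<^sub>M borel)"
    by (simp only: c_def)
next
  fix p assume "p \<in> space (N \<Otimes>\<^sub>M (borel :: real measure))"
  then obtain \<omega> t where p: "p = (\<omega>, t)" "\<omega> \<in> space N" by (auto simp: space_pair_measure)
  let ?t = "\<lambda>n. real (nat \<lfloor>real (Suc n) * t\<rfloor>) / real (Suc n)"
  have "?t \<longlonglongrightarrow> max 0 t"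
  proof (rule tendsto_sandwich)
    have b: "real (Suc n) * max 0 t - 1 \<le> real (nat \<lfloor>real (Suc n) * t\<rfloor>)"
      "real (nat \<lfloor>real (Suc n) * t\<rfloor>) \<le> real (Suc n) * max 0 t" for n
    proof -
      have "real (Suc n) * max 0 t = max 0 (real (Suc n) * t)"
        by (simp add: max_def mult_le_0_iff zero_le_mult_iff)
      moreover have "max 0 x - 1 \<le> real (nat \<lfloor>x\<rfloor>) \<and> real (nat \<lfloor>x\<rfloor>) \<le> max 0 x" for x :: real
        by linarith
      ultimately show "real (Suc n) * max 0 t - 1 \<le> real (nat \<lfloor>real (Suc n) * t\<rfloor>)"
        "real (nat \<lfloor>real (Suc n) * t\<rfloor>) \<le> real (Suc n) * max 0 t" by metis+
    qed
    have upper: "k / real (Suc n) \<le> x \<longleftrightarrow> k \<le> real (Suc n) * x" for x k n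
      by (simp add: pos_divide_le_eq mult.commute)
    have lower: "x - 1 / real (Suc n) \<le> k / real (Suc n) \<longleftrightarrow> real (Suc n) * x - 1 \<le> k" for x k n
    proof -
      have "x - 1 / real (Suc n) = (real (Suc n) * x - 1) / real (Suc n)" by (simp add: diff_divide_distrib)
      then show ?thesis by (simp only: divide_le_cancel) simp
    qed
    show "eventually (\<lambda>n. max 0 t - 1 / real (Suc n) \<le> ?t n) sequentially"
      using b(1) by (intro always_eventually allI) (simp only: lower)
    show "eventually (\<lambda>n. ?t n \<le> max 0 t) sequentially"
      using b(2) by (intro always_eventually allI) (simp only: upper)
    show "(\<lambda>n. max 0 t - 1 / real (Suc n)) \<longlonglongrightarrow> max 0 t"
      using tendsto_diff[OF tendsto_const LIMSEQ_Suc[OF lim_1_over_n], of "max 0 t"] by simp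
  qed simp
  then have "(\<lambda>n. W (?t n) \<omega>) \<longlonglongrightarrow> W (max 0 t) \<omega>"
    by (rule continuous_on_tendsto_compose[OF continuous_W[OF p(2)]]) auto
  then show "(\<lambda>n. W (real (nat \<lfloor>real (Suc n) * snd p\<rfloor>) / real (Suc n)) (fst p)) \<longlonglongrightarrow> (case p of (\<omega>, t) \<Rightarrow> W (max 0 t) \<omega>)"
    using p by simp
qed

lemma measurable_W_max [measurable]:
  "(\<lambda>p. W (max 0 (snd p)) (fst p)) \<in> borel_measurable (N \<Otimes>\<^sub>M borel)"
  using measurable_W_joint by (simp add: case_prod_beta)

text \<open>
  The value of \<open>\<integral>\<^sub>0\<^sup>1 W dW\<close> that It\^o's formula predicts.
\<close>

abbreviation ito_square :: "'b \<Rightarrow> real" where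
  "ito_square \<omega> \<equiv> ((W 1 \<omega>)\<^sup>2 - 1) / 2"

lemma ito_square_measurable [measurable]: "ito_square \<in> borel_measurable N"
  by measurable

lemma
  shows integrable_ito_square_sq: "integrable N (\<lambda>\<omega>. (ito_square \<omega>)\<^sup>2)"
    and ito_square_second_moment: "expectation (\<lambda>\<omega>. (ito_square \<omega>)\<^sup>2) = 1 / 2"
proof -
  have *: "(ito_square \<omega>)\<^sup>2 = W 1 \<omega> ^ 4 / 4 - (W 1 \<omega>)\<^sup>2 / 2 + 1 / 4" for \<omega>
    by (simp add: power2_eq_square power4_eq_xxxx field_simps)
  show "integrable N (\<lambda>\<omega>. (ito_square \<omega>)\<^sup>2)" "expectation (\<lambda>\<omega>. (ito_square \<omega>)\<^sup>2) = 1 / 2"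
    unfolding * using integrable_W_power[of 1] by (simp_all add: W_second_moment W_fourth_moment prob_space)
qed

text \<open>
  The covariance of one summand of a simple integral with the candidate value. Write
  \<open>W 1 = A + D + R\<close> with \<open>A = W s\<close> and the increments \<open>D\<close>, \<open>R\<close> over \<open>[s, t]\<close> and \<open>[t, 1]\<close>, and expand
  \<open>e * D * (W 1)\<^sup>2\<close>. Independence kills every term except \<open>2 * e * A * D\<^sup>2\<close>.
\<close>

lemma ito_square_cross:
  assumes st: "0 \<le> s" "s \<le> t" "t \<le> 1"
    and e: "e \<in> borel_measurable (past s)" and e2: "integrable N (\<lambda>\<omega>. (e \<omega>)\<^sup>2)"
  shows "expectation (\<lambda>\<omega>. e \<omega> * (W t \<omega> - W s \<omega>) * ito_square \<omega>) = (t - s) * expectation (\<lambda>\<omega>. e \<omega> * W s \<omega>)"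
proof -
  define A D R where "A = W s" and "D = (\<lambda>\<omega>. W t \<omega> - W s \<omega>)" and "R = (\<lambda>\<omega>. W 1 \<omega> - W t \<omega>)"
  have iD: "indep_of_past N (past s) D" and iR: "indep_of_past N (past t) R"
    unfolding D_def R_def using st by (auto intro: increment_indep_of_past)
  have mA: "A \<in> borel_measurable (past s)" and mWt: "W t \<in> borel_measurable (past t)"
    unfolding A_def using st by (auto intro: W_past)
  have met: "e \<in> borel_measurable (past t)" by (rule past_mono[OF st(2) e])
  have mDt: "D \<in> borel_measurable (past t)" unfolding D_def using st
    by (intro borel_measurable_diff W_past) auto
  note [measurable] = past_measurable[OF e] past_measurable[OF mA] past_measurable[OF mDt] past_measurable[OF mWt]
  have A2: "integrable N (\<lambda>\<omega>. (A \<omega>)\<^sup>2)" and A4: "integrable N (\<lambda>\<omega>. ((A \<omega>)\<^sup>2)\<^sup>2)"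
    unfolding A_def power_mult[symmetric] using st by (auto intro: integrable_W_power)
  have Wt2: "integrable N (\<lambda>\<omega>. (W t \<omega>)\<^sup>2)" using st by (auto intro: integrable_W_power)
  have intD: "integrable N (\<lambda>\<omega>. D \<omega> ^ k)" and intR: "integrable N (\<lambda>\<omega>. R \<omega> ^ k)" for k
    unfolding D_def R_def using st by (auto intro: integrable_increment_power)
  have intD1: "integrable N D" and intR1: "integrable N R" using intD[of 1] intR[of 1] by simp_all
  have ED: "expectation D = 0" "expectation (\<lambda>\<omega>. (D \<omega>)\<^sup>2) = t - s" "expectation (\<lambda>\<omega>. D \<omega> ^ 3) = 0" "expectation R = 0"
    unfolding D_def R_def using st by (auto simp: increment_mean increment_variance increment_third_moment)
  have ie: "integrable N e" by (rule square_integrable_imp_integrable[OF _ e2]) simp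
  have ieA: "integrable N (\<lambda>\<omega>. e \<omega> * A \<omega>)" by (rule integrable_mult_square_integrable[OF _ _ e2 A2]) simp_all
  have ieAA: "integrable N (\<lambda>\<omega>. e \<omega> * (A \<omega>)\<^sup>2)" by (rule integrable_mult_square_integrable[OF _ _ e2 A4]) simp_all
  have eD2: "integrable N (\<lambda>\<omega>. (e \<omega> * D \<omega>)\<^sup>2)"
    using indep_of_past_mult(1)[OF iD borel_measurable_power[OF e] _ e2, of "\<lambda>x. x\<^sup>2"] intD[of 2]
    by (simp add: power_mult_distrib)
  have eDW: "integrable N (\<lambda>\<omega>. e \<omega> * D \<omega> * W t \<omega>)"
    by (rule integrable_mult_square_integrable[OF _ _ eD2 Wt2]) simp_all
  \<comment> \<open>The increments after time \<open>s\<close> enter only through their first three moments.\<close>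
  have 1: "integrable N (\<lambda>\<omega>. e \<omega> * (A \<omega>)\<^sup>2 * D \<omega>)" "expectation (\<lambda>\<omega>. e \<omega> * (A \<omega>)\<^sup>2 * D \<omega>) = 0"
    using indep_of_past_mult[OF iD borel_measurable_times[OF e borel_measurable_power[OF mA]] _ ieAA, of "\<lambda>x. x"] intD1 ED
    by simp_all
  have 2: "integrable N (\<lambda>\<omega>. e \<omega> * A \<omega> * (D \<omega>)\<^sup>2)"
    "expectation (\<lambda>\<omega>. e \<omega> * A \<omega> * (D \<omega>)\<^sup>2) = expectation (\<lambda>\<omega>. e \<omega> * A \<omega>) * (t - s)"
    using indep_of_past_mult[OF iD borel_measurable_times[OF e mA] _ ieA, of "\<lambda>x. x\<^sup>2"] intD[of 2] ED
    by simp_all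
  have 3: "integrable N (\<lambda>\<omega>. e \<omega> * D \<omega> ^ 3)" "expectation (\<lambda>\<omega>. e \<omega> * D \<omega> ^ 3) = 0"
    using indep_of_past_mult[OF iD e _ ie, of "\<lambda>x. x ^ 3"] intD[of 3] ED by simp_all
  have 4: "integrable N (\<lambda>\<omega>. e \<omega> * D \<omega>)" "expectation (\<lambda>\<omega>. e \<omega> * D \<omega>) = 0"
    using indep_of_past_mult[OF iD e _ ie, of "\<lambda>x. x"] intD1 ED by simp_all
  have 5: "integrable N (\<lambda>\<omega>. e \<omega> * D \<omega> * W t \<omega> * R \<omega>)" "expectation (\<lambda>\<omega>. e \<omega> * D \<omega> * W t \<omega> * R \<omega>) = 0"
    using indep_of_past_mult[OF iR borel_measurable_times[OF borel_measurable_times[OF met mDt] mWt] _ eDW, of "\<lambda>x. x"] intR1 ED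
    by simp_all
  have 6: "integrable N (\<lambda>\<omega>. e \<omega> * D \<omega> * (R \<omega>)\<^sup>2)" "expectation (\<lambda>\<omega>. e \<omega> * D \<omega> * (R \<omega>)\<^sup>2) = 0"
    using indep_of_past_mult[OF iR borel_measurable_times[OF met mDt] _ 4(1), of "\<lambda>x. x\<^sup>2"] intR[of 2] 4(2)
    by simp_all
  have eq: "e \<omega> * (W t \<omega> - W s \<omega>) * ito_square \<omega> =
      (e \<omega> * (A \<omega>)\<^sup>2 * D \<omega> + 2 * (e \<omega> * A \<omega> * (D \<omega>)\<^sup>2) + e \<omega> * D \<omega> ^ 3 - e \<omega> * D \<omega>
        + 2 * (e \<omega> * D \<omega> * W t \<omega> * R \<omega>) + e \<omega> * D \<omega> * (R \<omega>)\<^sup>2) / 2" for \<omega>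
    unfolding A_def D_def R_def by (simp add: power2_eq_square power3_eq_cube algebra_simps)
  show ?thesis
    unfolding eq using 1 2 3 4 5 6 by (simp add: A_def mult.commute)
qed

text \<open>
  The isometry between \<open>W - \<phi>\<close> and \<open>ito_square - \<integral> \<phi> dW\<close>, obtained by computing both sides. On the
  side of the integrals the square is expanded, using orthogonality for the simple integral and
  the preceding lemma for the mixed term. On the other side Tonelli's theorem reduces the claim to a
  fixed time \<open>t\<close>, at which at most one of the intervals of \<open>\<phi>\<close> is active. A single identity therefore
  gives existence of the It\^o integral (take the step processes below) and its uniqueness.
\<close>

lemma ito_square_isometry:
  assumes "simple_process N past 1 \<phi>"
  shows "(\<integral>\<^sup>+\<omega>. (\<integral>\<^sup>+t\<in>{0..1}. ennreal ((W t \<omega> - simple_value \<phi> t \<omega>)\<^sup>2) \<partial>lborel) \<partial>N) =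
    (\<integral>\<^sup>+\<omega>. ennreal ((simple_integral W \<phi> \<omega> - ito_square \<omega>)\<^sup>2) \<partial>N)"
    and "(\<lambda>\<omega>. simple_integral W \<phi> \<omega>) \<in> borel_measurable N"
    and "(\<integral>\<^sup>+\<omega>. ennreal ((simple_integral W \<phi> \<omega> - ito_square \<omega>)\<^sup>2) \<partial>N) =
      ennreal (1 / 2 + (\<Sum>i<fst \<phi>. (fst (snd \<phi>) (Suc i) - fst (snd \<phi>) i) *
        (expectation (\<lambda>\<omega>. (snd (snd \<phi>) i \<omega>)\<^sup>2) - 2 * expectation (\<lambda>\<omega>. snd (snd \<phi>) i \<omega> * W (fst (snd \<phi>) i) \<omega>))))"
proof -
  obtain m \<tau> e where \<phi>: "\<phi> = (m, \<tau>, e)" by (cases \<phi>)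
  have \<tau>: "0 \<le> \<tau> 0" "mono_on {..m} \<tau>" "\<tau> m \<le> 1"
    and e: "\<And>i. i < m \<Longrightarrow> e i \<in> borel_measurable (past (\<tau> i))"
    and e2: "\<And>i. i < m \<Longrightarrow> integrable N (\<lambda>\<omega>. (e i \<omega>)\<^sup>2)"
    using assms by (auto simp: \<phi> simple_process_def)
  have \<tau>_mono: "\<tau> i \<le> \<tau> j" if "i \<le> j" "j \<le> m" for i j
    using that by (intro mono_onD[OF \<tau>(2)]) auto
  have \<tau>_pos: "0 \<le> \<tau> i" if "i \<le> m" for i using \<tau>_mono[of 0 i] \<tau>(1) that by simp
  have \<tau>_le: "\<tau> i \<le> 1" if "i \<le> m" for i using \<tau>_mono[of i m] \<tau>(3) that by simp
  have eN: "e i \<in> borel_measurable N" if "i < m" for i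
    by (rule past_measurable[OF e[OF that]])
  define D where "D i \<omega> = W (\<tau> (Suc i)) \<omega> - W (\<tau> i) \<omega>" for i \<omega>
  have DN: "D i \<in> borel_measurable N" if "i < m" for i
    unfolding D_def using \<tau>_pos[of i] \<tau>_pos[of "Suc i"] that by simp
  define I where "I \<omega> = (\<Sum>i<m. e i \<omega> * D i \<omega>)" for \<omega>
  have I: "simple_integral W \<phi> = I" by (auto simp: \<phi> simple_integral_def I_def D_def)
  have IN: "I \<in> borel_measurable N" unfolding I_def using eN DN by (intro borel_measurable_sum borel_measurable_times) auto
  then show "(\<lambda>\<omega>. simple_integral W \<phi> \<omega>) \<in> borel_measurable N" by (simp add: I)
  have I2: "integrable N (\<lambda>\<omega>. (I \<omega>)\<^sup>2) \<and> expectation (\<lambda>\<omega>. (I \<omega>)\<^sup>2) = (\<Sum>i<m. (\<tau> (Suc i) - \<tau> i) * expectation (\<lambda>\<omega>. (e i \<omega>)\<^sup>2))"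
  proof -
    have s: "0 \<le> \<tau> i" "\<tau> i \<le> \<tau> (Suc i)" if "i < m" for i
      using that \<tau>_pos[of i] \<tau>_mono[of i "Suc i"] by auto
    have 1: "indep_of_past N (past (\<tau> i)) (D i)" if "i < m" for i
      unfolding D_def by (rule increment_indep_of_past[OF s[OF that]])
    have 2: "integrable N (\<lambda>\<omega>. (D i \<omega>)\<^sup>2)" "expectation (D i) = 0"
      "expectation (\<lambda>\<omega>. (D i \<omega>)\<^sup>2) = \<tau> (Suc i) - \<tau> i" if "i < m" for i
      unfolding D_def using s[OF that] by (auto intro: integrable_increment_power simp: increment_mean increment_variance)
    have 3: "D i \<in> borel_measurable (past (\<tau> j))" if "i < j" "j < m" for i j
      unfolding D_def using that \<tau>_pos \<tau>_mono by (intro borel_measurable_diff W_past) auto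
    have 4: "sets (past (\<tau> i)) \<subseteq> sets (past (\<tau> j))" if "i \<le> j" "j < m" for i j
      using that by (intro sets_past_mono \<tau>_mono) auto
    show ?thesis
      unfolding I_def
      using predictable_transform_second_moment[of m "\<lambda>i. past (\<tau> i)" D e "\<lambda>i. \<tau> (Suc i) - \<tau> i", OF 1 4 3 e e2 2]
      by blast
  qed
  define J where "J = ito_square"
  have JN: "J \<in> borel_measurable N" and J2: "integrable N (\<lambda>\<omega>. (J \<omega>)\<^sup>2)" "expectation (\<lambda>\<omega>. (J \<omega>)\<^sup>2) = 1 / 2"
    unfolding J_def by (simp_all add: integrable_ito_square_sq ito_square_second_moment)
  define c where "c i = expectation (\<lambda>\<omega>. (e i \<omega>)\<^sup>2) - 2 * expectation (\<lambda>\<omega>. e i \<omega> * W (\<tau> i) \<omega>)" for i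
  have eDJ: "integrable N (\<lambda>\<omega>. e i \<omega> * D i \<omega> * J \<omega>)"
    "expectation (\<lambda>\<omega>. e i \<omega> * D i \<omega> * J \<omega>) = (\<tau> (Suc i) - \<tau> i) * expectation (\<lambda>\<omega>. e i \<omega> * W (\<tau> i) \<omega>)"
    if i: "i < m" for i
  proof -
    have "integrable N (\<lambda>\<omega>. (e i \<omega>)\<^sup>2 * (D i \<omega>)\<^sup>2)"
      unfolding D_def using \<tau>_pos[of i] \<tau>_mono[of i "Suc i"] i e2
      by (intro indep_of_past_mult(1)[OF increment_indep_of_past, where g = "\<lambda>x. x\<^sup>2"]
          borel_measurable_power e integrable_increment_power) auto
    then show "integrable N (\<lambda>\<omega>. e i \<omega> * D i \<omega> * J \<omega>)"
      using eN[OF i] DN[OF i] JN J2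
      by (intro integrable_mult_square_integrable) (auto simp: power_mult_distrib)
    show "expectation (\<lambda>\<omega>. e i \<omega> * D i \<omega> * J \<omega>) = (\<tau> (Suc i) - \<tau> i) * expectation (\<lambda>\<omega>. e i \<omega> * W (\<tau> i) \<omega>)"
      unfolding D_def J_def using i \<tau>_pos[of i] \<tau>_mono[of i "Suc i"] \<tau>_le[of "Suc i"] e e2
      by (intro ito_square_cross) auto
  qed
  have eqIJ: "(I \<omega> - J \<omega>)\<^sup>2 = (I \<omega>)\<^sup>2 + ((J \<omega>)\<^sup>2 - 2 * (\<Sum>i<m. e i \<omega> * D i \<omega> * J \<omega>))" for \<omega>
  proof -
    have "(a - b)\<^sup>2 = a\<^sup>2 + (b\<^sup>2 - 2 * (a * b))" for a b :: real
      by (simp add: power2_eq_square algebra_simps)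
    then show ?thesis unfolding I_def sum_distrib_right[symmetric] .
  qed
  have int_IJ: "integrable N (\<lambda>\<omega>. (I \<omega> - J \<omega>)\<^sup>2)"
    unfolding eqIJ using I2 eDJ J2
    by (intro Bochner_Integration.integrable_add Bochner_Integration.integrable_diff integrable_mult_right Bochner_Integration.integrable_sum) auto
  have exp_IJ: "expectation (\<lambda>\<omega>. (I \<omega> - J \<omega>)\<^sup>2) = 1 / 2 + (\<Sum>i<m. (\<tau> (Suc i) - \<tau> i) * c i)"
  proof -
    have "expectation (\<lambda>\<omega>. (I \<omega> - J \<omega>)\<^sup>2) = expectation (\<lambda>\<omega>. (I \<omega>)\<^sup>2) +
        (expectation (\<lambda>\<omega>. (J \<omega>)\<^sup>2) - 2 * (\<Sum>i<m. expectation (\<lambda>\<omega>. e i \<omega> * D i \<omega> * J \<omega>)))"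
    proof -
      have "integrable N (\<lambda>\<omega>. \<Sum>i<m. e i \<omega> * D i \<omega> * J \<omega>)"
        "expectation (\<lambda>\<omega>. \<Sum>i<m. e i \<omega> * D i \<omega> * J \<omega>) = (\<Sum>i<m. expectation (\<lambda>\<omega>. e i \<omega> * D i \<omega> * J \<omega>))"
        using eDJ(1) by (auto intro!: Bochner_Integration.integrable_sum Bochner_Integration.integral_sum)
      then show ?thesis unfolding eqIJ using I2 J2(1) by simp
    qed
    then show ?thesis
      using I2 eDJ(2) by (simp add: J2 c_def right_diff_distrib sum_subtractf sum_distrib_left mult.left_commute)
  qed
  have nn: "(\<integral>\<^sup>+\<omega>. ennreal ((I \<omega> - J \<omega>)\<^sup>2) \<partial>N) = ennreal (1 / 2 + (\<Sum>i<m. (\<tau> (Suc i) - \<tau> i) * c i))"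
    using nn_integral_eq_integral[OF int_IJ] exp_IJ by simp
  then show "(\<integral>\<^sup>+\<omega>. ennreal ((simple_integral W \<phi> \<omega> - ito_square \<omega>)\<^sup>2) \<partial>N) =
      ennreal (1 / 2 + (\<Sum>i<fst \<phi>. (fst (snd \<phi>) (Suc i) - fst (snd \<phi>) i) *
        (expectation (\<lambda>\<omega>. (snd (snd \<phi>) i \<omega>)\<^sup>2) - 2 * expectation (\<lambda>\<omega>. snd (snd \<phi>) i \<omega> * W (fst (snd \<phi>) i) \<omega>))))"
    unfolding I by (simp add: \<phi> c_def J_def)
  define h where "h t = t + (\<Sum>i<m. c i * indicator {\<tau> i<..\<tau> (Suc i)} t)" for t
  let ?V = "simple_value \<phi>"
  have V: "?V t \<omega> = (\<Sum>i<m. e i \<omega> * indicator {\<tau> i<..\<tau> (Suc i)} t)" for t \<omega>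
    by (simp add: \<phi> simple_value_def)
  have slice: "(\<integral>\<^sup>+\<omega>. ennreal ((W t \<omega> - ?V t \<omega>)\<^sup>2) \<partial>N) = ennreal (h t) \<and> 0 \<le> h t" if t: "t \<in> {0..1}" for t
  proof -
    have [measurable]: "W t \<in> borel_measurable N" using t by simp
    have "integrable N (\<lambda>\<omega>. (W t \<omega> - ?V t \<omega>)\<^sup>2) \<and> expectation (\<lambda>\<omega>. (W t \<omega> - ?V t \<omega>)\<^sup>2) = h t"
    proof (cases "\<exists>i<m. t \<in> {\<tau> i<..\<tau> (Suc i)}")
      case True
      then obtain i where i: "i < m" "t \<in> {\<tau> i<..\<tau> (Suc i)}" by auto
      have s: "0 \<le> \<tau> i" "\<tau> i \<le> t" using i \<tau>_pos[of i] by auto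
      have ie: "integrable N (e i)" by (rule square_integrable_imp_integrable[OF eN e2]) (use i in auto)
      have eW: "integrable N (\<lambda>\<omega>. e i \<omega> * W (\<tau> i) \<omega>)"
        using s i by (intro integrable_mult_square_integrable eN e2 integrable_W_power) auto
      have eD: "integrable N (\<lambda>\<omega>. e i \<omega> * (W t \<omega> - W (\<tau> i) \<omega>))" "expectation (\<lambda>\<omega>. e i \<omega> * (W t \<omega> - W (\<tau> i) \<omega>)) = 0"
        using indep_of_past_mult[OF increment_indep_of_past[OF s] e[OF i(1)] _ ie, of "\<lambda>x. x"]
          integrable_increment[OF s] increment_mean[OF s] by simp_all
      have "(W t \<omega> - ?V t \<omega>)\<^sup>2 = (W t \<omega>)\<^sup>2 + ((e i \<omega>)\<^sup>2 - 2 * (e i \<omega> * W (\<tau> i) \<omega>) - 2 * (e i \<omega> * (W t \<omega> - W (\<tau> i) \<omega>)))" for \<omega>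
        unfolding V disjoint_interval_sum[OF \<tau>(2) i] by (simp add: power2_eq_square algebra_simps)
      moreover have "h t = t + c i" unfolding h_def disjoint_interval_sum[OF \<tau>(2) i] ..
      ultimately show ?thesis
        using eW eD e2[OF i(1)] integrable_W_power[of t 2] t by (simp add: W_second_moment c_def)
    next
      case False
      then have "\<And>\<omega>. ?V t \<omega> = 0" "h t = t" unfolding V h_def by (auto simp: indicator_def intro!: sum.neutral)
      then show ?thesis using t integrable_W_power[of t 2] by (simp add: W_second_moment)
    qed
    then have int: "integrable N (\<lambda>\<omega>. (W t \<omega> - ?V t \<omega>)\<^sup>2)"
      and exp: "h t = expectation (\<lambda>\<omega>. (W t \<omega> - ?V t \<omega>)\<^sup>2)" by auto
    show ?thesis using nn_integral_eq_integral[OF int] by (simp add: exp)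
  qed
  have joint: "(\<lambda>(\<omega>, t). ennreal ((W t \<omega> - ?V t \<omega>)\<^sup>2) * indicator {0..1} t) \<in> borel_measurable (N \<Otimes>\<^sub>M lborel)"
  proof -
    have [measurable]: "(\<lambda>p. ?V (snd p) (fst p)) \<in> borel_measurable (N \<Otimes>\<^sub>M borel)"
      unfolding V
    proof (intro borel_measurable_sum borel_measurable_times)
      fix i assume "i \<in> {..<m}"
      then have [measurable]: "e i \<in> borel_measurable N" using eN by simp
      show "(\<lambda>p. e i (fst p)) \<in> borel_measurable (N \<Otimes>\<^sub>M borel)" by measurable
      show "(\<lambda>p. indicator {\<tau> i<..\<tau> (Suc i)} (snd p)) \<in> borel_measurable (N \<Otimes>\<^sub>M borel)" by measurable
    qed
    have "(\<lambda>p. ennreal ((W (max 0 (snd p)) (fst p) - ?V (snd p) (fst p))\<^sup>2) * indicator {0..1} (snd p))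
        \<in> borel_measurable (N \<Otimes>\<^sub>M borel)" by measurable
    moreover have "(\<lambda>p. ennreal ((W (max 0 (snd p)) (fst p) - ?V (snd p) (fst p))\<^sup>2) * indicator {0..1} (snd p)) =
        (\<lambda>(\<omega>, t). ennreal ((W t \<omega> - ?V t \<omega>)\<^sup>2) * indicator {0..1} t)"
      by (auto simp: fun_eq_iff indicator_def)
    ultimately show ?thesis by (simp cong: measurable_cong_sets)
  qed
  interpret P: pair_sigma_finite N lborel ..
  have "(\<integral>\<^sup>+\<omega>. (\<integral>\<^sup>+t\<in>{0..1}. ennreal ((W t \<omega> - ?V t \<omega>)\<^sup>2) \<partial>lborel) \<partial>N) =
      (\<integral>\<^sup>+t. (\<integral>\<^sup>+\<omega>. ennreal ((W t \<omega> - ?V t \<omega>)\<^sup>2) * indicator {0..1} t \<partial>N) \<partial>lborel)"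
    by (rule P.Fubini'[OF joint, symmetric])
  also have "\<dots> = (\<integral>\<^sup>+t. ennreal (h t * indicator {0..1} t) \<partial>lborel)"
  proof (rule nn_integral_cong)
    fix t :: real
    show "(\<integral>\<^sup>+\<omega>. ennreal ((W t \<omega> - ?V t \<omega>)\<^sup>2) * indicator {0..1} t \<partial>N) = ennreal (h t * indicator {0..1} t)"
      using slice[of t] by (cases "t \<in> {0..1}") auto
  qed
  also have "\<dots> = ennreal (1 / 2 + (\<Sum>i<m. (\<tau> (Suc i) - \<tau> i) * c i))"
  proof -
    have int_t: "has_bochner_integral lborel (\<lambda>t. t * indicator {0..1} t) (1 / 2 :: real)"
    proof -
      have "((\<lambda>t. t\<^sup>2 / 2) has_real_derivative x) (at x)" for x :: real
        by (auto intro!: derivative_eq_intros)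
      then show ?thesis using has_bochner_integral_FTC_Icc_real[of 0 1 "\<lambda>t. t\<^sup>2 / 2" "\<lambda>t. t"] by simp
    qed
    have "has_bochner_integral lborel (\<lambda>t. t * indicator {0..1} t + (\<Sum>i<m. indicator {\<tau> i<..\<tau> (Suc i)} t *\<^sub>R c i))
        (1 / 2 + (\<Sum>i<m. (\<tau> (Suc i) - \<tau> i) * c i))"
    proof (intro has_bochner_integral_add int_t has_bochner_integral_sum)
      fix i assume "i \<in> {..<m}"
      then have "\<tau> i \<le> \<tau> (Suc i)" using \<tau>_mono by simp
      then show "has_bochner_integral lborel (\<lambda>t. indicator {\<tau> i<..\<tau> (Suc i)} t *\<^sub>R c i) ((\<tau> (Suc i) - \<tau> i) * c i)"
        using has_bochner_integral_indicator[of "{\<tau> i<..\<tau> (Suc i)}" lborel "c i"] by simp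
    qed
    moreover have "t * indicator {0..1} t + (\<Sum>i<m. indicator {\<tau> i<..\<tau> (Suc i)} t *\<^sub>R c i) = h t * indicator {0..1} t" for t
    proof (cases "t \<in> {0..1}")
      case False
      have "t \<notin> {\<tau> i<..\<tau> (Suc i)}" if "i < m" for i
        using False \<tau>_pos[of i] \<tau>_le[of "Suc i"] that by auto
      then show ?thesis using False by (auto intro!: sum.neutral)
    qed (simp add: h_def mult.commute)
    ultimately have "has_bochner_integral lborel (\<lambda>t. h t * indicator {0..1} t) (1 / 2 + (\<Sum>i<m. (\<tau> (Suc i) - \<tau> i) * c i))"
      by simp
    then show ?thesis
      using slice by (subst nn_integral_eq_integral)
        (auto simp: has_bochner_integral_iff indicator_def)
  qed
  finally show "(\<integral>\<^sup>+\<omega>. (\<integral>\<^sup>+t\<in>{0..1}. ennreal ((W t \<omega> - simple_value \<phi> t \<omega>)\<^sup>2) \<partial>lborel) \<partial>N) =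
      (\<integral>\<^sup>+\<omega>. ennreal ((simple_integral W \<phi> \<omega> - ito_square \<omega>)\<^sup>2) \<partial>N)"
    using nn unfolding I J_def by simp
qed

text \<open>
  For \<open>n = 0\<close> the partition is empty, so the division by zero does no harm.
\<close>

definition uniform_step_process :: "nat \<Rightarrow> 'b simple_process" where
  "uniform_step_process n = (n, \<lambda>i. real i / real n, \<lambda>i. W (real i / real n))"

lemma simple_process_uniform_step_process: "simple_process N past 1 (uniform_step_process n)"
  unfolding simple_process_def uniform_step_process_def
  by (auto intro!: mono_onI divide_right_mono W_past integrable_W_power)

lemma uniform_step_process_error:
  "(\<lambda>n. \<integral>\<^sup>+\<omega>. ennreal ((simple_integral W (uniform_step_process n) \<omega> - ito_square \<omega>)\<^sup>2) \<partial>N) \<longlonglongrightarrow> 0"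
proof -
  have "(\<integral>\<^sup>+\<omega>. ennreal ((simple_integral W (uniform_step_process n) \<omega> - ito_square \<omega>)\<^sup>2) \<partial>N) = ennreal (1 / (2 * real n))" if n: "n \<ge> 1" for n
  proof -
    have *: "expectation (\<lambda>\<omega>. W (real i / real n) \<omega> * W (real i / real n) \<omega>) = real i / real n" for i
      using W_second_moment[of "real i / real n"] by (simp add: power2_eq_square)
    have "1 / 2 + (\<Sum>i<n. (real (Suc i) / real n - real i / real n) *
        (expectation (\<lambda>\<omega>. (W (real i / real n) \<omega>)\<^sup>2) - 2 * expectation (\<lambda>\<omega>. W (real i / real n) \<omega> * W (real i / real n) \<omega>)))
        = 1 / 2 - (\<Sum>i<n. real i) / (real n * real n)"
      unfolding * by (simp add: W_second_moment diff_divide_distrib[symmetric] sum_divide_distrib sum_negf)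
    also have "(\<Sum>i<n. real i) = real n * (real n - 1) / 2"
      by (induction n) (auto simp: field_simps)
    also have "1 / 2 - (real n * (real n - 1) / 2) / (real n * real n) = 1 / (2 * real n)"
      using n by (simp add: field_simps)
    finally show ?thesis
      unfolding ito_square_isometry(3)[OF simple_process_uniform_step_process] by (simp add: uniform_step_process_def)
  qed
  then have "eventually (\<lambda>n. ennreal (1 / (2 * real n)) = (\<integral>\<^sup>+\<omega>. ennreal ((simple_integral W (uniform_step_process n) \<omega> - ito_square \<omega>)\<^sup>2) \<partial>N)) sequentially"
    by (intro eventually_sequentiallyI[of 1]) simp
  moreover have "(\<lambda>n. ennreal (1 / (2 * real n))) \<longlonglongrightarrow> ennreal 0"
    by (intro tendsto_ennrealI) real_asymp
  ultimately show ?thesis by (simp add: tendsto_cong)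
qed

lemma ito_integrand_W: "ito_integrand N past 1 W"
proof -
  have joint: "(\<lambda>p. W (max 0 (fst p)) (snd p)) \<in> borel_measurable (borel \<Otimes>\<^sub>M N)"
    using measurable_compose[OF measurable_pair_swap' measurable_W_max] by (simp add: case_prod_beta)
  have id_pair: "(\<lambda>p. (fst p, snd p)) \<in> restrict_space lborel {0..1::real} \<Otimes>\<^sub>M N \<rightarrow>\<^sub>M borel \<Otimes>\<^sub>M N"
  proof -
    have id: "(\<lambda>t. t) \<in> restrict_space lborel {0..1} \<rightarrow>\<^sub>M (borel :: real measure)"
      by (intro measurable_restrict_space1) simp
    show ?thesis
      by (rule measurable_Pair, rule measurable_compose[OF measurable_fst id], rule measurable_snd)
  qed
  have "(\<lambda>p. W (max 0 (fst p)) (snd p)) \<in> borel_measurable (restrict_space lborel {0..1} \<Otimes>\<^sub>M N)"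
    using measurable_compose[OF id_pair joint] by (simp only: fst_conv snd_conv)
  then have 1: "(\<lambda>(t, \<omega>). W t \<omega>) \<in> borel_measurable (restrict_space lborel {0..1} \<Otimes>\<^sub>M N)"
    by (rule measurable_cong[THEN iffD1, rotated]) (auto simp: space_pair_measure space_restrict_space)
  have "simple_process N past 1 (0, \<lambda>_. 0, \<lambda>_ _. 0)"
    by (auto simp: simple_process_def intro: mono_onI)
  from ito_square_isometry(1,3)[OF this]
  have "(\<integral>\<^sup>+\<omega>. (\<integral>\<^sup>+t\<in>{0..1}. ennreal ((W t \<omega>)\<^sup>2) \<partial>lborel) \<partial>N) = ennreal (1 / 2)"
    by (simp add: simple_value_def)
  then have "(\<integral>\<^sup>+\<omega>. (\<integral>\<^sup>+t\<in>{0..1}. ennreal ((W t \<omega>)\<^sup>2) \<partial>lborel) \<partial>N) < \<infinity>"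
    by (simp only: ennreal_less_top infinity_ennreal_def)
  then show ?thesis
    unfolding ito_integrand_def using 1 by (auto intro: W_past)
qed

lemma has_ito_integral_ito_square: "has_ito_integral N W 1 W ito_square"
  unfolding has_ito_integral_def
  using ito_integrand_W simple_process_uniform_step_process uniform_step_process_error
    ito_square_isometry(1)[OF simple_process_uniform_step_process]
  by (intro conjI exI[of _ uniform_step_process]) auto

lemma has_ito_integral_unique:
  assumes "has_ito_integral N W 1 W I"
  shows "AE \<omega> in N. I \<omega> = ito_square \<omega>"
proof -
  have [measurable]: "I \<in> borel_measurable N" using assms by (simp add: has_ito_integral_def)
  from assms obtain \<phi> where \<phi>: "\<And>n. simple_process N past 1 (\<phi> n)"
    "(\<lambda>n. \<integral>\<^sup>+\<omega>. (\<integral>\<^sup>+t\<in>{0..1}. ennreal ((W t \<omega> - simple_value (\<phi> n) t \<omega>)\<^sup>2) \<partial>lborel) \<partial>N) \<longlonglongrightarrow> 0"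
    "(\<lambda>n. \<integral>\<^sup>+\<omega>. ennreal ((simple_integral W (\<phi> n) \<omega> - I \<omega>)\<^sup>2) \<partial>N) \<longlonglongrightarrow> 0"
    by (auto simp: has_ito_integral_def)
  have [measurable]: "simple_integral W (\<phi> n) \<in> borel_measurable N" for n
    using ito_square_isometry(2)[OF \<phi>(1)] by simp
  let ?a = "\<lambda>n. \<integral>\<^sup>+\<omega>. ennreal ((simple_integral W (\<phi> n) \<omega> - I \<omega>)\<^sup>2) \<partial>N"
  let ?b = "\<lambda>n. \<integral>\<^sup>+\<omega>. ennreal ((simple_integral W (\<phi> n) \<omega> - ito_square \<omega>)\<^sup>2) \<partial>N"
  have b: "?b \<longlonglongrightarrow> 0" using \<phi>(2) by (simp only: ito_square_isometry(1)[OF \<phi>(1)])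
  have "(\<integral>\<^sup>+\<omega>. ennreal ((I \<omega> - ito_square \<omega>)\<^sup>2) \<partial>N) \<le> 2 * ?a n + 2 * ?b n" for n
  proof -
    have sq: "(x - y)\<^sup>2 \<le> 2 * (z - x)\<^sup>2 + 2 * (z - y)\<^sup>2" for x y z :: real
      using zero_le_power2[of "(z - x) + (z - y)"] by (simp add: power2_eq_square algebra_simps)
    have "(\<integral>\<^sup>+\<omega>. ennreal ((I \<omega> - ito_square \<omega>)\<^sup>2) \<partial>N) \<le>
        (\<integral>\<^sup>+\<omega>. 2 * ennreal ((simple_integral W (\<phi> n) \<omega> - I \<omega>)\<^sup>2) + 2 * ennreal ((simple_integral W (\<phi> n) \<omega> - ito_square \<omega>)\<^sup>2) \<partial>N)"
    proof (rule nn_integral_mono)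
      fix \<omega>
      have "2 * ennreal ((simple_integral W (\<phi> n) \<omega> - I \<omega>)\<^sup>2) + 2 * ennreal ((simple_integral W (\<phi> n) \<omega> - ito_square \<omega>)\<^sup>2)
          = ennreal (2 * (simple_integral W (\<phi> n) \<omega> - I \<omega>)\<^sup>2 + 2 * (simple_integral W (\<phi> n) \<omega> - ito_square \<omega>)\<^sup>2)"
        by (simp add: ennreal_mult' ennreal_plus del: ennreal_plus[symmetric])
      then show "ennreal ((I \<omega> - ito_square \<omega>)\<^sup>2) \<le> 2 * ennreal ((simple_integral W (\<phi> n) \<omega> - I \<omega>)\<^sup>2) + 2 * ennreal ((simple_integral W (\<phi> n) \<omega> - ito_square \<omega>)\<^sup>2)"
        using sq[of "I \<omega>" "ito_square \<omega>" "simple_integral W (\<phi> n) \<omega>"] by (simp only:) (rule ennreal_leI)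
    qed
    also have "\<dots> = 2 * ?a n + 2 * ?b n"
      by (subst nn_integral_add) (auto simp: nn_integral_cmult)
    finally show ?thesis .
  qed
  moreover have "(\<lambda>n. 2 * ?a n + 2 * ?b n) \<longlonglongrightarrow> 2 * 0 + 2 * 0"
    by (intro tendsto_add ennreal_tendsto_cmult \<phi>(3) b) auto
  ultimately have "(\<integral>\<^sup>+\<omega>. ennreal ((I \<omega> - ito_square \<omega>)\<^sup>2) \<partial>N) \<le> 2 * 0 + 2 * 0"
    by (intro LIMSEQ_le_const[of "\<lambda>n. 2 * ?a n + 2 * ?b n"]) auto
  then have "(\<integral>\<^sup>+\<omega>. ennreal ((I \<omega> - ito_square \<omega>)\<^sup>2) \<partial>N) = 0" by simp
  then have "AE \<omega> in N. ennreal ((I \<omega> - ito_square \<omega>)\<^sup>2) = 0"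
    by (subst (asm) nn_integral_0_iff_AE) auto
  then show ?thesis by eventually_elim simp
qed

lemma
  shows ito_integral_W: "AE \<omega> in N. ito_integral N W 1 W \<omega> = ito_square \<omega>"
    and ito_integral_W_measurable: "ito_integral N W 1 W \<in> borel_measurable N"
proof -
  have "has_ito_integral N W 1 W (ito_integral N W 1 W)"
    unfolding ito_integral_def by (rule someI[of "has_ito_integral N W 1 W"]) (rule has_ito_integral_ito_square)
  then show "AE \<omega> in N. ito_integral N W 1 W \<omega> = ito_square \<omega>"
    "ito_integral N W 1 W \<in> borel_measurable N"
    using has_ito_integral_unique by (auto simp: has_ito_integral_def)
qed

end

section \<open>Convergence in law and in probability\<close>

abbreviation converges_in_law ::
  "'a measure \<Rightarrow> (nat \<Rightarrow> 'a \<Rightarrow> real) \<Rightarrow> 'b measure \<Rightarrow> ('b \<Rightarrow> real) \<Rightarrow> bool" where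
  "converges_in_law M X N Z \<equiv> weak_conv_m (\<lambda>n. distr M borel (X n)) (distr N borel Z)"

definition vanishes_in_prob :: "'a measure \<Rightarrow> (nat \<Rightarrow> 'a \<Rightarrow> real) \<Rightarrow> bool" where
  "vanishes_in_prob M X \<longleftrightarrow>
     (\<forall>\<delta>>0. \<forall>\<eta>>0. \<forall>\<^sub>F n in sequentially. measure M {\<omega>\<in>space M. \<delta> < \<bar>X n \<omega>\<bar>} \<le> \<eta>)"

definition bounded_in_prob :: "'a measure \<Rightarrow> (nat \<Rightarrow> 'a \<Rightarrow> real) \<Rightarrow> bool" where
  "bounded_in_prob M X \<longleftrightarrow>
     (\<forall>\<eta>>0. \<exists>K>0. \<forall>\<^sub>F n in sequentially. measure M {\<omega>\<in>space M. K < \<bar>X n \<omega>\<bar>} \<le> \<eta>)"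

context prob_space
begin

lemma expectation_diff_le:
  fixes u v :: "'a \<Rightarrow> real"
  assumes [measurable]: "u \<in> borel_measurable M" "v \<in> borel_measurable M" "A \<in> events"
    and b: "\<And>\<omega>. \<bar>u \<omega>\<bar> \<le> b" "\<And>\<omega>. \<bar>v \<omega>\<bar> \<le> b"
    and e: "0 \<le> e" "\<And>\<omega>. \<omega> \<in> space M \<Longrightarrow> \<omega> \<notin> A \<Longrightarrow> \<bar>u \<omega> - v \<omega>\<bar> \<le> e"
  shows "\<bar>expectation u - expectation v\<bar> \<le> e + 2 * b * prob A"
proof -
  have int: "integrable M u" "integrable M v"
    using b by (auto intro!: integrable_const_bound[where B = b])
  have "\<bar>expectation u - expectation v\<bar> = \<bar>expectation (\<lambda>\<omega>. u \<omega> - v \<omega>)\<bar>" using int by simp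
  also have "\<dots> \<le> expectation (\<lambda>\<omega>. \<bar>u \<omega> - v \<omega>\<bar>)" by (rule integral_abs_bound)
  also have "\<dots> \<le> expectation (\<lambda>\<omega>. e + 2 * b * indicator A \<omega>)"
  proof (rule integral_mono)
    fix \<omega> assume "\<omega> \<in> space M"
    then show "\<bar>u \<omega> - v \<omega>\<bar> \<le> e + 2 * b * indicator A \<omega>"
      using b[of \<omega>] e(2)[of \<omega>] e(1) by (cases "\<omega> \<in> A") (auto simp: abs_le_iff)
  qed (use int in \<open>auto simp: emeasure_eq_measure\<close>)
  also have "\<dots> = e + 2 * b * prob A" by (simp add: prob_space emeasure_eq_measure)
  finally show ?thesis .
qed

lemma prob_gt_le_expectation:
  fixes X :: "'a \<Rightarrow> real"
  assumes [measurable]: "integrable M X" and c: "0 < c"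
  shows "prob {\<omega>\<in>space M. c < \<bar>X \<omega>\<bar>} \<le> expectation (\<lambda>\<omega>. \<bar>X \<omega>\<bar>) / c"
proof -
  have "prob {\<omega>\<in>space M. c < \<bar>X \<omega>\<bar>} \<le> prob {\<omega>\<in>space M. c \<le> \<bar>X \<omega>\<bar>}"
    by (intro finite_measure_mono) auto
  also have "\<dots> \<le> expectation (\<lambda>\<omega>. \<bar>X \<omega>\<bar>) / c"
    using c by (intro integral_Markov_inequality_measure[where A = "{}"]) (auto intro: integrable_abs assms)
  finally show ?thesis .
qed

lemma vanishes_in_probI_L1:
  assumes int: "\<And>n. integrable M (X n)" and c: "\<forall>\<^sub>F n in sequentially. expectation (\<lambda>\<omega>. \<bar>X n \<omega>\<bar>) \<le> c n"
    and lim: "c \<longlonglongrightarrow> 0"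
  shows "vanishes_in_prob M X"
  unfolding vanishes_in_prob_def
proof (intro allI impI)
  fix \<delta> \<eta> :: real assume pos: "0 < \<delta>" "0 < \<eta>"
  then have "\<forall>\<^sub>F n in sequentially. c n < \<eta> * \<delta>"
    using order_tendstoD(2)[OF lim] by simp
  with c show "\<forall>\<^sub>F n in sequentially. prob {\<omega>\<in>space M. \<delta> < \<bar>X n \<omega>\<bar>} \<le> \<eta>"
  proof eventually_elim
    case (elim n)
    have "prob {\<omega>\<in>space M. \<delta> < \<bar>X n \<omega>\<bar>} \<le> expectation (\<lambda>\<omega>. \<bar>X n \<omega>\<bar>) / \<delta>"
      by (rule prob_gt_le_expectation[OF int pos(1)])
    also have "\<dots> \<le> \<eta>" using elim pos by (simp add: pos_divide_le_eq)
    finally show ?case .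
  qed
qed

lemma bounded_in_probI_L1:
  assumes int: "\<And>n. integrable M (X n)" and c: "\<forall>\<^sub>F n in sequentially. expectation (\<lambda>\<omega>. \<bar>X n \<omega>\<bar>) \<le> c"
  shows "bounded_in_prob M X"
  unfolding bounded_in_prob_def
proof (intro allI impI)
  fix \<eta> :: real assume pos: "0 < \<eta>"
  define K where "K = (\<bar>c\<bar> + 1) / \<eta>"
  have K: "0 < K" using pos by (simp add: K_def)
  show "\<exists>K>0. \<forall>\<^sub>F n in sequentially. prob {\<omega>\<in>space M. K < \<bar>X n \<omega>\<bar>} \<le> \<eta>"
  proof (intro exI[of _ K] conjI)
    show "0 < K" by (rule K)
    show "\<forall>\<^sub>F n in sequentially. prob {\<omega>\<in>space M. K < \<bar>X n \<omega>\<bar>} \<le> \<eta>"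
      using c
    proof eventually_elim
      case (elim n)
      have "prob {\<omega>\<in>space M. K < \<bar>X n \<omega>\<bar>} \<le> expectation (\<lambda>\<omega>. \<bar>X n \<omega>\<bar>) / K"
        by (rule prob_gt_le_expectation[OF int K])
      also have "\<dots> \<le> \<eta>" using elim pos K by (simp add: pos_divide_le_eq) (simp add: K_def)
      finally show ?case .
    qed
  qed
qed

lemma prob_le_sum:
  assumes [measurable]: "A \<in> events" "B \<in> events" "C \<in> events" and "A \<subseteq> B \<union> C"
  shows "prob A \<le> prob B + prob C"
proof -
  have "prob A \<le> prob (B \<union> C)" using assms by (intro finite_measure_mono) auto
  also have "\<dots> \<le> prob B + prob C" by (rule measure_Un_le[OF assms(2,3)])
  finally show ?thesis .
qed

lemma vanishes_in_probD:
  "vanishes_in_prob M X \<Longrightarrow> 0 < \<delta> \<Longrightarrow> 0 < \<eta> \<Longrightarrow> \<forall>\<^sub>F n in sequentially. prob {\<omega>\<in>space M. \<delta> < \<bar>X n \<omega>\<bar>} \<le> \<eta>"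
  by (simp add: vanishes_in_prob_def)

lemma vanishes_in_prob_add:
  assumes [measurable]: "\<And>n. X n \<in> borel_measurable M" "\<And>n. Y n \<in> borel_measurable M"
    and X: "vanishes_in_prob M X" and Y: "vanishes_in_prob M Y"
  shows "vanishes_in_prob M (\<lambda>n \<omega>. X n \<omega> + Y n \<omega>)"
  unfolding vanishes_in_prob_def
proof (intro allI impI)
  fix \<delta> \<eta> :: real assume pos: "0 < \<delta>" "0 < \<eta>"
  have "\<forall>\<^sub>F n in sequentially. prob {\<omega>\<in>space M. \<delta> / 2 < \<bar>X n \<omega>\<bar>} \<le> \<eta> / 2"
    "\<forall>\<^sub>F n in sequentially. prob {\<omega>\<in>space M. \<delta> / 2 < \<bar>Y n \<omega>\<bar>} \<le> \<eta> / 2"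
    using vanishes_in_probD[OF X, of "\<delta> / 2" "\<eta> / 2"] vanishes_in_probD[OF Y, of "\<delta> / 2" "\<eta> / 2"] pos by auto
  then show "\<forall>\<^sub>F n in sequentially. prob {\<omega>\<in>space M. \<delta> < \<bar>X n \<omega> + Y n \<omega>\<bar>} \<le> \<eta>"
  proof eventually_elim
    case (elim n)
    have "prob {\<omega>\<in>space M. \<delta> < \<bar>X n \<omega> + Y n \<omega>\<bar>} \<le>
        prob {\<omega>\<in>space M. \<delta> / 2 < \<bar>X n \<omega>\<bar>} + prob {\<omega>\<in>space M. \<delta> / 2 < \<bar>Y n \<omega>\<bar>}"
      by (rule prob_le_sum) (auto simp: abs_if split: if_splits)
    then show ?case using elim by simp
  qed
qed

lemma vanishes_in_prob_mult:
  assumes [measurable]: "\<And>n. X n \<in> borel_measurable M" "\<And>n. Y n \<in> borel_measurable M"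
    and X: "vanishes_in_prob M X" and Y: "bounded_in_prob M Y"
  shows "vanishes_in_prob M (\<lambda>n \<omega>. X n \<omega> * Y n \<omega>)"
  unfolding vanishes_in_prob_def
proof (intro allI impI)
  fix \<delta> \<eta> :: real assume pos: "0 < \<delta>" "0 < \<eta>"
  from Y pos obtain K where K: "0 < K" "\<forall>\<^sub>F n in sequentially. prob {\<omega>\<in>space M. K < \<bar>Y n \<omega>\<bar>} \<le> \<eta> / 2"
    unfolding bounded_in_prob_def by (meson half_gt_zero)
  have "\<forall>\<^sub>F n in sequentially. prob {\<omega>\<in>space M. \<delta> / K < \<bar>X n \<omega>\<bar>} \<le> \<eta> / 2"
    using pos K by (intro vanishes_in_probD X) auto
  with K(2) show "\<forall>\<^sub>F n in sequentially. prob {\<omega>\<in>space M. \<delta> < \<bar>X n \<omega> * Y n \<omega>\<bar>} \<le> \<eta>"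
  proof eventually_elim
    case (elim n)
    have sub: "\<delta> / K < \<bar>x\<bar> \<or> K < \<bar>y\<bar>" if "\<delta> < \<bar>x * y\<bar>" for x y
    proof (rule ccontr)
      assume "\<not> (\<delta> / K < \<bar>x\<bar> \<or> K < \<bar>y\<bar>)"
      then have "\<bar>x\<bar> * \<bar>y\<bar> \<le> \<delta> / K * K" using pos K by (intro mult_mono) auto
      then show False using that K by (simp add: abs_mult)
    qed
    have "prob {\<omega>\<in>space M. \<delta> < \<bar>X n \<omega> * Y n \<omega>\<bar>} \<le>
        prob {\<omega>\<in>space M. \<delta> / K < \<bar>X n \<omega>\<bar>} + prob {\<omega>\<in>space M. K < \<bar>Y n \<omega>\<bar>}"
      by (rule prob_le_sum) (auto dest: sub)
    then show ?case using elim by simp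
  qed
qed

lemma vanishes_imp_bounded_in_prob: "vanishes_in_prob M X \<Longrightarrow> bounded_in_prob M X"
  unfolding vanishes_in_prob_def bounded_in_prob_def by (meson zero_less_one)

lemma bounded_in_prob_const: "bounded_in_prob M (\<lambda>n \<omega>. c)"
  unfolding bounded_in_prob_def
proof (intro allI impI exI[of _ "\<bar>c\<bar> + 1"])
  fix \<eta> :: real assume "0 < \<eta>"
  then show "0 < \<bar>c\<bar> + 1 \<and> (\<forall>\<^sub>F n in sequentially. prob {\<omega>\<in>space M. \<bar>c\<bar> + 1 < \<bar>c\<bar>} \<le> \<eta>)" by simp
qed

lemma vanishes_in_prob_cmult:
  assumes [measurable]: "\<And>n. X n \<in> borel_measurable M" and X: "vanishes_in_prob M X"
  shows "vanishes_in_prob M (\<lambda>n \<omega>. X n \<omega> * c)"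
  using vanishes_in_prob_mult[OF assms(1) _ X bounded_in_prob_const] by simp

lemma weak_convD:
  fixes g :: "real \<Rightarrow> real"
  assumes N: "prob_space N" and [measurable]: "\<And>n. X n \<in> borel_measurable M" "Z \<in> borel_measurable N"
    and conv: "converges_in_law M X N Z" and g: "continuous_on UNIV g" "\<And>x. \<bar>g x\<bar> \<le> B"
  shows "(\<lambda>n. expectation (\<lambda>\<omega>. g (X n \<omega>))) \<longlonglongrightarrow> (\<integral>\<omega>. g (Z \<omega>) \<partial>N)"
proof -
  interpret N: prob_space N by fact
  have [measurable]: "g \<in> borel_measurable borel" by (rule borel_measurable_continuous_onI[OF g(1)])
  have "(\<lambda>n. integral\<^sup>L (distr M borel (X n)) g) \<longlonglongrightarrow> integral\<^sup>L (distr N borel Z) g"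
    using g by (intro weak_conv_imp_integral_bdd_continuous_conv[OF _ _ conv])
      (auto simp: continuous_on_eq_continuous_at N.real_distribution_distr)
  then show ?thesis by (simp add: integral_distr)
qed

lemma weak_convI_bdd_uniformly_continuous:
  assumes N: "prob_space N" and [measurable]: "\<And>n. X n \<in> borel_measurable M" "Z \<in> borel_measurable N"
    and conv: "\<And>g :: real \<Rightarrow> real. uniformly_continuous_on UNIV g \<Longrightarrow> (\<And>x. \<bar>g x\<bar> \<le> 1) \<Longrightarrow>
      (\<lambda>n. expectation (\<lambda>\<omega>. g (X n \<omega>))) \<longlonglongrightarrow> (\<integral>\<omega>. g (Z \<omega>) \<partial>N)"
  shows "converges_in_law M X N Z"
proof -
  interpret N: prob_space N by fact
  show ?thesis
  proof (rule integral_cts_step_conv_imp_weak_conv)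
    fix x y :: real assume xy: "x < y"
    note u = cts_step_uniformly_continuous[OF xy]
    have [measurable]: "cts_step x y \<in> borel_measurable borel"
      by (intro borel_measurable_continuous_onI uniformly_continuous_imp_continuous u)
    have "\<bar>cts_step x y z\<bar> \<le> 1" for z using xy by (auto simp: cts_step_def)
    from conv[OF u this] show "(\<lambda>n. integral\<^sup>L (distr M borel (X n)) (cts_step x y)) \<longlonglongrightarrow> integral\<^sup>L (distr N borel Z) (cts_step x y)"
      by (simp add: integral_distr)
  qed (auto simp: N.real_distribution_distr)
qed

text \<open>
  Convergence together: if \<open>Y m n\<close> converges in law to \<open>V m\<close> for every fixed resolution \<open>m\<close>, the limits
  \<open>V m\<close> converge to \<open>Z\<close>, and \<open>Y m n\<close> approximates \<open>X n\<close> in probability as first \<open>n\<close> and then \<open>m\<close> grows,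
  then \<open>X n\<close> converges in law to \<open>Z\<close>. This replaces tightness in the space of continuous functions;
  Slutsky's theorem is the case in which nothing depends on \<open>m\<close>.
\<close>

lemma converges_in_law_approx:
  assumes N: "prob_space N"
    and [measurable]: "\<And>n. X n \<in> borel_measurable M" "\<And>m n. Y m n \<in> borel_measurable M"
      "\<And>m. V m \<in> borel_measurable N" "Z \<in> borel_measurable N"
    and Y: "\<forall>\<^sub>F m in sequentially. converges_in_law M (Y m) N (V m)"
    and V: "AE \<omega> in N. (\<lambda>m. V m \<omega>) \<longlonglongrightarrow> Z \<omega>"
    and approx: "\<And>\<delta> \<eta> :: real. 0 < \<delta> \<Longrightarrow> 0 < \<eta> \<Longrightarrow>
      \<forall>\<^sub>F m in sequentially. \<forall>\<^sub>F n in sequentially. prob {\<omega>\<in>space M. \<delta> < \<bar>X n \<omega> - Y m n \<omega>\<bar>} \<le> \<eta>"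
  shows "converges_in_law M X N Z"
proof (rule weak_convI_bdd_uniformly_continuous[OF N])
  interpret N: prob_space N by fact
  fix g :: "real \<Rightarrow> real"
  assume uc: "uniformly_continuous_on UNIV g" and b: "\<And>x. \<bar>g x\<bar> \<le> 1"
  have cont: "continuous_on UNIV g" by (rule uniformly_continuous_imp_continuous[OF uc])
  have [measurable]: "g \<in> borel_measurable borel" by (rule borel_measurable_continuous_onI[OF cont])
  have "(\<lambda>m. N.expectation (\<lambda>\<omega>. g (V m \<omega>))) \<longlonglongrightarrow> N.expectation (\<lambda>\<omega>. g (Z \<omega>))"
  proof (rule integral_dominated_convergence[where w = "\<lambda>_. 1"])
    show "AE \<omega> in N. (\<lambda>m. g (V m \<omega>)) \<longlonglongrightarrow> g (Z \<omega>)"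
      using V by eventually_elim (rule continuous_on_tendsto_compose[OF cont]; simp)
  qed (use b in auto)
  note Vg = this
  show "(\<lambda>n. expectation (\<lambda>\<omega>. g (X n \<omega>))) \<longlonglongrightarrow> N.expectation (\<lambda>\<omega>. g (Z \<omega>))"
  proof (rule LIMSEQ_I)
    fix r :: real assume r: "0 < r"
    define e where "e = r / 5"
    have e: "0 < e" using r by (simp add: e_def)
    from uc e obtain \<delta> where \<delta>: "0 < \<delta>" "\<And>x y. dist y x < \<delta> \<Longrightarrow> dist (g y) (g x) < e"
      unfolding uniformly_continuous_on_def by (metis UNIV_I)
    have "\<forall>\<^sub>F m in sequentially. \<bar>N.expectation (\<lambda>\<omega>. g (V m \<omega>)) - N.expectation (\<lambda>\<omega>. g (Z \<omega>))\<bar> < e"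
      using tendstoD[OF Vg e] by (simp add: dist_real_def)
    with Y approx[of "\<delta> / 2" e] \<delta>(1) e have "\<forall>\<^sub>F m in sequentially. converges_in_law M (Y m) N (V m) \<and>
        (\<forall>\<^sub>F n in sequentially. prob {\<omega>\<in>space M. \<delta> / 2 < \<bar>X n \<omega> - Y m n \<omega>\<bar>} \<le> e) \<and>
        \<bar>N.expectation (\<lambda>\<omega>. g (V m \<omega>)) - N.expectation (\<lambda>\<omega>. g (Z \<omega>))\<bar> < e"
      by (simp add: eventually_conj_iff)
    then obtain m where m: "converges_in_law M (Y m) N (V m)"
        "\<forall>\<^sub>F n in sequentially. prob {\<omega>\<in>space M. \<delta> / 2 < \<bar>X n \<omega> - Y m n \<omega>\<bar>} \<le> e"
        "\<bar>N.expectation (\<lambda>\<omega>. g (V m \<omega>)) - N.expectation (\<lambda>\<omega>. g (Z \<omega>))\<bar> < e"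
      using eventually_happens'[OF sequentially_bot] by blast
    have "(\<lambda>n. expectation (\<lambda>\<omega>. g (Y m n \<omega>))) \<longlonglongrightarrow> N.expectation (\<lambda>\<omega>. g (V m \<omega>))"
      by (rule weak_convD[OF N _ _ m(1) cont b]) simp_all
    from tendstoD[OF this e] m(2)
    have "\<forall>\<^sub>F n in sequentially. norm (expectation (\<lambda>\<omega>. g (X n \<omega>)) - N.expectation (\<lambda>\<omega>. g (Z \<omega>))) < r"
    proof eventually_elim
      case (elim n)
      have "\<bar>expectation (\<lambda>\<omega>. g (X n \<omega>)) - expectation (\<lambda>\<omega>. g (Y m n \<omega>))\<bar>
          \<le> e + 2 * 1 * prob {\<omega>\<in>space M. \<delta> / 2 < \<bar>X n \<omega> - Y m n \<omega>\<bar>}"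
      proof (rule expectation_diff_le)
        fix \<omega> assume "\<omega> \<in> space M" "\<omega> \<notin> {\<omega> \<in> space M. \<delta> / 2 < \<bar>X n \<omega> - Y m n \<omega>\<bar>}"
        then have "dist (X n \<omega>) (Y m n \<omega>) < \<delta>" using \<delta>(1) by (auto simp: dist_real_def)
        from \<delta>(2)[OF this] show "\<bar>g (X n \<omega>) - g (Y m n \<omega>)\<bar> \<le> e" by (simp add: dist_real_def)
      qed (use e b in auto)
      then have "\<bar>expectation (\<lambda>\<omega>. g (X n \<omega>)) - expectation (\<lambda>\<omega>. g (Y m n \<omega>))\<bar> \<le> 3 * e"
        using elim by simp
      then have "\<bar>expectation (\<lambda>\<omega>. g (X n \<omega>)) - N.expectation (\<lambda>\<omega>. g (Z \<omega>))\<bar> < 5 * e"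
        using elim(1) m(3) unfolding dist_real_def by linarith
      then show ?case by (simp add: e_def)
    qed
    then show "\<exists>no. \<forall>n\<ge>no. norm (expectation (\<lambda>\<omega>. g (X n \<omega>)) - N.expectation (\<lambda>\<omega>. g (Z \<omega>))) < r"
      by (simp add: eventually_sequentially)
  qed
qed simp_all

lemma converges_in_law_Slutsky:
  assumes N: "prob_space N"
    and [measurable]: "\<And>n. X n \<in> borel_measurable M" "\<And>n. Y n \<in> borel_measurable M" "Z \<in> borel_measurable N"
    and Y: "converges_in_law M Y N Z" and van: "vanishes_in_prob M (\<lambda>n \<omega>. X n \<omega> - Y n \<omega>)"
  shows "converges_in_law M X N Z"
proof (rule converges_in_law_approx[OF N assms(2) _ _ assms(4), where Y = "\<lambda>_. Y" and V = "\<lambda>_. Z"])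
  show "\<forall>\<^sub>F m in sequentially. converges_in_law M Y N Z" using Y by (intro always_eventually allI)
  fix \<delta> \<eta> :: real assume "0 < \<delta>" "0 < \<eta>"
  then have "\<forall>\<^sub>F n in sequentially. prob {\<omega>\<in>space M. \<delta> < \<bar>X n \<omega> - Y n \<omega>\<bar>} \<le> \<eta>"
    by (rule vanishes_in_probD[OF van])
  then show "\<forall>\<^sub>F m in sequentially. \<forall>\<^sub>F n in sequentially. prob {\<omega>\<in>space M. \<delta> < \<bar>X n \<omega> - Y n \<omega>\<bar>} \<le> \<eta>"
    by simp
qed (auto intro: assms(3,4))

text \<open>
  The cut-off functions \<open>g k\<close> are continuous and lie between the indicators of \<open>{x. \<bar>x\<bar> > k + 1}\<close> and
  \<open>{x. \<bar>x\<bar> > k}\<close>; their limiting expectations tend to zero.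
\<close>

lemma converges_in_law_imp_bounded:
  assumes N: "prob_space N" and [measurable]: "\<And>n. X n \<in> borel_measurable M" "Z \<in> borel_measurable N"
    and conv: "converges_in_law M X N Z"
  shows "bounded_in_prob M X"
  unfolding bounded_in_prob_def
proof (intro allI impI)
  interpret N: prob_space N by fact
  fix \<eta> :: real assume \<eta>: "0 < \<eta>"
  define g where "g k x = min 1 (max 0 (\<bar>x\<bar> - real k))" for k and x :: real
  have cont: "continuous_on UNIV (g k)" for k unfolding g_def by (intro continuous_intros)
  have b: "\<bar>g k x\<bar> \<le> 1" for k x by (auto simp: g_def)
  have g_nonneg: "0 \<le> g k x" and g_le: "g k x \<le> 1" for k x by (simp_all add: g_def)
  have g_one: "g k x = 1" if "real k + 1 < \<bar>x\<bar>" for k x using that by (simp add: g_def)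
  have [measurable]: "g k \<in> borel_measurable borel" for k by (rule borel_measurable_continuous_onI[OF cont])
  have "(\<lambda>k. N.expectation (\<lambda>\<omega>. g k (Z \<omega>))) \<longlonglongrightarrow> N.expectation (\<lambda>\<omega>. 0)"
  proof (rule integral_dominated_convergence[where w = "\<lambda>_. 1"])
    show "AE \<omega> in N. (\<lambda>k. g k (Z \<omega>)) \<longlonglongrightarrow> 0"
    proof (rule AE_I2)
      fix \<omega>
      have "\<forall>\<^sub>F k in sequentially. 0 = g k (Z \<omega>)"
        using eventually_ge_at_top[of "nat \<lceil>\<bar>Z \<omega>\<bar>\<rceil>"]
        by eventually_elim (auto simp: g_def max_def min_def; linarith)
      then show "(\<lambda>k. g k (Z \<omega>)) \<longlonglongrightarrow> 0" by (rule Lim_transform_eventually[OF tendsto_const])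
    qed
  qed (use b in auto)
  then have "\<forall>\<^sub>F k in sequentially. N.expectation (\<lambda>\<omega>. g k (Z \<omega>)) < \<eta>"
    using \<eta> by (intro order_tendstoD) auto
  then obtain k where k: "N.expectation (\<lambda>\<omega>. g k (Z \<omega>)) < \<eta>"
    using eventually_happens'[OF sequentially_bot] by blast
  have "\<forall>\<^sub>F n in sequentially. expectation (\<lambda>\<omega>. g k (X n \<omega>)) < \<eta>"
    using weak_convD[OF N _ _ conv cont b, of k] k by (intro order_tendstoD) auto
  then have "\<forall>\<^sub>F n in sequentially. prob {\<omega>\<in>space M. real k + 1 < \<bar>X n \<omega>\<bar>} \<le> \<eta>"
  proof eventually_elim
    case (elim n)
    have "prob {\<omega>\<in>space M. real k + 1 < \<bar>X n \<omega>\<bar>} = expectation (indicator {\<omega>\<in>space M. real k + 1 < \<bar>X n \<omega>\<bar>})"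
      by simp
    also have "\<dots> \<le> expectation (\<lambda>\<omega>. g k (X n \<omega>))"
      by (intro integral_mono integrable_const_bound[where B = 1]) (auto simp: indicator_def g_nonneg g_one g_le)
    finally show ?case using elim by simp
  qed
  then show "\<exists>K>0. \<forall>\<^sub>F n in sequentially. prob {\<omega>\<in>space M. K < \<bar>X n \<omega>\<bar>} \<le> \<eta>"
    by (intro exI[of _ "real k + 1"]) auto
qed

text \<open>
  A law carried by the positive half-line puts little mass near 0, and a continuous cut-off function
  transfers this to the approximating variables.
\<close>

lemma bounded_in_prob_inverse:
  assumes N: "prob_space N" and [measurable]: "\<And>n. X n \<in> borel_measurable M" "Z \<in> borel_measurable N"
    and conv: "converges_in_law M X N Z" and pos: "AE \<omega> in N. 0 < Z \<omega>"
  shows "\<And>\<eta>. 0 < \<eta> \<Longrightarrow> \<exists>c>0. \<forall>\<^sub>F n in sequentially. prob {\<omega>\<in>space M. X n \<omega> < c} \<le> \<eta>"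
    and "bounded_in_prob M (\<lambda>n \<omega>. 1 / X n \<omega>)"
proof -
  interpret N: prob_space N by fact
  show *: "\<exists>c>0. \<forall>\<^sub>F n in sequentially. prob {\<omega>\<in>space M. X n \<omega> < c} \<le> \<eta>" if \<eta>: "0 < \<eta>" for \<eta>
  proof -
    define g where "g k x = min 1 (max 0 (2 - real (Suc k) * x))" for k and x :: real
    have g_nonneg: "0 \<le> g k x" for k x by (auto simp: g_def)
    have cont: "continuous_on UNIV (g k)" for k unfolding g_def by (intro continuous_intros)
    have b: "\<bar>g k x\<bar> \<le> 1" for k x by (auto simp: g_def)
    have [measurable]: "g k \<in> borel_measurable borel" for k by (rule borel_measurable_continuous_onI[OF cont])
    have "(\<lambda>k. N.expectation (\<lambda>\<omega>. g k (Z \<omega>))) \<longlonglongrightarrow> N.expectation (\<lambda>\<omega>. 0)"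
    proof (rule integral_dominated_convergence[where w = "\<lambda>_. 1"])
      show "AE \<omega> in N. (\<lambda>k. g k (Z \<omega>)) \<longlonglongrightarrow> 0"
        using pos
      proof eventually_elim
        case (elim \<omega>)
        have "\<forall>\<^sub>F k in sequentially. 0 = g k (Z \<omega>)"
          using eventually_ge_at_top[of "nat \<lceil>2 / Z \<omega>\<rceil>"]
        proof eventually_elim
          case (elim k)
          then have "2 / Z \<omega> \<le> real (Suc k)" by linarith
          then have "2 \<le> real (Suc k) * Z \<omega>" using \<open>0 < Z \<omega>\<close> by (simp add: pos_divide_le_eq)
          then show ?case by (simp add: g_def)
        qed
        then show "(\<lambda>k. g k (Z \<omega>)) \<longlonglongrightarrow> 0" by (rule Lim_transform_eventually[OF tendsto_const])
      qed
    qed (simp_all add: b)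
    then have "\<forall>\<^sub>F k in sequentially. N.expectation (\<lambda>\<omega>. g k (Z \<omega>)) < \<eta>"
      using \<eta> by (intro order_tendstoD) auto
    then obtain k where k: "N.expectation (\<lambda>\<omega>. g k (Z \<omega>)) < \<eta>"
      using eventually_happens'[OF sequentially_bot] by blast
    have "\<forall>\<^sub>F n in sequentially. expectation (\<lambda>\<omega>. g k (X n \<omega>)) < \<eta>"
      using weak_convD[OF N _ _ conv cont b, of k] k by (intro order_tendstoD) auto
    then have "\<forall>\<^sub>F n in sequentially. prob {\<omega>\<in>space M. X n \<omega> < 1 / real (Suc k)} \<le> \<eta>"
    proof eventually_elim
      case (elim n)
      have "prob {\<omega>\<in>space M. X n \<omega> < 1 / real (Suc k)} = expectation (indicator {\<omega>\<in>space M. X n \<omega> < 1 / real (Suc k)})"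
        by simp
      also have "\<dots> \<le> expectation (\<lambda>\<omega>. g k (X n \<omega>))"
      proof (intro integral_mono integrable_const_bound[where B = 1])
        fix \<omega>
        have "1 \<le> g k (X n \<omega>)" if "X n \<omega> < 1 / real (Suc k)"
        proof -
          have "real (Suc k) * X n \<omega> < 1"
            using that by (subst (asm) pos_less_divide_eq) (simp_all add: mult.commute)
          then show ?thesis by (simp add: g_def)
        qed
        then show "indicator {\<omega>\<in>space M. X n \<omega> < 1 / real (Suc k)} \<omega> \<le> g k (X n \<omega>)"
          by (auto simp: indicator_def g_nonneg)
      qed (use b in auto)
      finally show ?case using elim by simp
    qed
    then show ?thesis by (intro exI[of _ "1 / real (Suc k)"]) auto
  qed
  show "bounded_in_prob M (\<lambda>n \<omega>. 1 / X n \<omega>)"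
    unfolding bounded_in_prob_def
  proof (intro allI impI)
    fix \<eta> :: real assume "0 < \<eta>"
    from *[OF this] obtain c where c: "0 < c" "\<forall>\<^sub>F n in sequentially. prob {\<omega>\<in>space M. X n \<omega> < c} \<le> \<eta>"
      by auto
    show "\<exists>K>0. \<forall>\<^sub>F n in sequentially. prob {\<omega>\<in>space M. K < \<bar>1 / X n \<omega>\<bar>} \<le> \<eta>"
    proof (intro exI[of _ "1 / c"] conjI)
      show "\<forall>\<^sub>F n in sequentially. prob {\<omega>\<in>space M. 1 / c < \<bar>1 / X n \<omega>\<bar>} \<le> \<eta>"
        using c(2)
      proof eventually_elim
        case (elim n)
        have "x < c" if "1 / c < \<bar>1 / x\<bar>" for x :: real
        proof (rule ccontr)
          assume "\<not> x < c"
          then have "1 / x \<le> 1 / c" "0 < x" using c(1) by (auto intro!: divide_left_mono mult_pos_pos)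
          then show False using that by simp
        qed
        then have "prob {\<omega>\<in>space M. 1 / c < \<bar>1 / X n \<omega>\<bar>} \<le> prob {\<omega>\<in>space M. X n \<omega> < c}"
          by (intro finite_measure_mono) auto
        then show ?case using elim by simp
      qed
    qed (use c in auto)
  qed
qed

text \<open>
  For a positive denominator, \<open>A / B \<le> x\<close> means \<open>A - x * B \<le> 0\<close>. Hence convergence in law of a quotient
  follows from one-dimensional convergence of the linear combinations \<open>A - x * B\<close>, without a joint
  limit theorem for the pair. The limiting distribution function is continuous at the point that
  matters precisely when that of the quotient is continuous at \<open>x\<close>.
\<close>

lemma converges_in_law_ratio:
  assumes N: "prob_space N"
    and [measurable]: "\<And>n. R n \<in> borel_measurable M" "\<And>n. A n \<in> borel_measurable M"
      "\<And>n. B n \<in> borel_measurable M" "a \<in> borel_measurable N" "b \<in> borel_measurable N"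
    and ratio: "\<And>n. AE \<omega> in M. 0 < B n \<omega> \<longrightarrow> R n \<omega> = A n \<omega> / B n \<omega>"
    and lin: "\<And>x. converges_in_law M (\<lambda>n \<omega>. A n \<omega> - x * B n \<omega>) N (\<lambda>\<omega>. a \<omega> - x * b \<omega>)"
    and den: "converges_in_law M B N b" and pos: "AE \<omega> in N. 0 < b \<omega>"
  shows "converges_in_law M R N (\<lambda>\<omega>. a \<omega> / b \<omega>)"
proof -
  interpret N: prob_space N by fact
  have div_eq: "p / q = z \<longleftrightarrow> p - z * q = 0" and div_le: "p / q \<le> z \<longleftrightarrow> p - z * q \<le> 0" if "0 < q" for p q z :: real
    using that by (auto simp: field_simps)
  have cdf_eq: "cdf (distr M borel Y) x = prob {\<omega>\<in>space M. Y \<omega> \<le> x}" if "Y \<in> borel_measurable M" for Y x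
    using that by (simp add: cdf_def measure_distr vimage_def Int_def conj_commute)
  have cdf_eqN: "cdf (distr N borel Y) x = N.prob {\<omega>\<in>space N. Y \<omega> \<le> x}" if "Y \<in> borel_measurable N" for Y x
    using that by (simp add: cdf_def measure_distr vimage_def Int_def conj_commute)
  have pointN: "measure (distr N borel Y) {x} = N.prob {\<omega>\<in>space N. Y \<omega> = x}" if "Y \<in> borel_measurable N" for Y and x :: real
    using that by (subst measure_distr) (auto intro!: arg_cong[where f = N.prob])
  show ?thesis
    unfolding weak_conv_m_def weak_conv_def
  proof (intro allI impI)
    fix x assume cont: "isCont (cdf (distr N borel (\<lambda>\<omega>. a \<omega> / b \<omega>))) x"
    have rm: "(\<lambda>\<omega>. a \<omega> / b \<omega>) \<in> borel_measurable N" by measurable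
    have "measure (distr N borel (\<lambda>\<omega>. a \<omega> / b \<omega>)) {x} = 0"
      using cont by (simp only: finite_borel_measure.isCont_cdf[OF real_distribution.finite_borel_measure_M[OF N.real_distribution_distr[OF rm]]])
    then have x0: "N.prob {\<omega>\<in>space N. a \<omega> / b \<omega> = x} = 0" by (simp only: pointN[OF rm])
    \<comment> \<open>Clearing the positive denominator turns the distribution function of the quotient at \<open>x\<close>
        into that of a linear combination at \<open>0\<close>.\<close>
    let ?L = "\<lambda>\<omega>. a \<omega> - x * b \<omega>"
    have lm: "?L \<in> borel_measurable N" by measurable
    have "N.prob {\<omega>\<in>space N. ?L \<omega> = 0} = N.prob {\<omega>\<in>space N. a \<omega> / b \<omega> = x}"
    proof (rule N.finite_measure_eq_AE)
      show "AE \<omega> in N. \<omega> \<in> {\<omega>\<in>space N. ?L \<omega> = 0} \<longleftrightarrow> \<omega> \<in> {\<omega>\<in>space N. a \<omega> / b \<omega> = x}"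
        using pos by eventually_elim (simp add: div_eq)
    qed simp_all
    then have "isCont (cdf (distr N borel ?L)) 0"
      by (simp only: x0 pointN[OF lm] finite_borel_measure.isCont_cdf[OF real_distribution.finite_borel_measure_M[OF N.real_distribution_distr[OF lm]]])
    then have "(\<lambda>n. cdf (distr M borel (\<lambda>\<omega>. A n \<omega> - x * B n \<omega>)) 0) \<longlonglongrightarrow> cdf (distr N borel ?L) 0"
      using lin[of x] unfolding weak_conv_m_def weak_conv_def by auto
    then have L: "(\<lambda>n. prob {\<omega>\<in>space M. A n \<omega> - x * B n \<omega> \<le> 0}) \<longlonglongrightarrow> N.prob {\<omega>\<in>space N. a \<omega> / b \<omega> \<le> x}"
    proof -
      have "N.prob {\<omega>\<in>space N. ?L \<omega> \<le> 0} = N.prob {\<omega>\<in>space N. a \<omega> / b \<omega> \<le> x}"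
      proof (rule N.finite_measure_eq_AE)
        show "AE \<omega> in N. \<omega> \<in> {\<omega>\<in>space N. ?L \<omega> \<le> 0} \<longleftrightarrow> \<omega> \<in> {\<omega>\<in>space N. a \<omega> / b \<omega> \<le> x}"
          using pos by eventually_elim (simp add: div_le)
      qed simp_all
      moreover assume "(\<lambda>n. cdf (distr M borel (\<lambda>\<omega>. A n \<omega> - x * B n \<omega>)) 0) \<longlonglongrightarrow> cdf (distr N borel ?L) 0"
      ultimately show ?thesis by (simp add: cdf_eq cdf_eqN)
    qed
    have "(\<lambda>n. prob {\<omega>\<in>space M. R n \<omega> \<le> x} - prob {\<omega>\<in>space M. A n \<omega> - x * B n \<omega> \<le> 0}) \<longlonglongrightarrow> 0"
    proof (rule LIMSEQ_I)
      fix r :: real assume r: "0 < r"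
      then obtain c where c: "0 < c" "\<forall>\<^sub>F n in sequentially. prob {\<omega>\<in>space M. B n \<omega> < c} \<le> r / 2"
        using bounded_in_prob_inverse(1)[OF N _ _ den pos, of "r / 2"] by auto
      have "\<forall>\<^sub>F n in sequentially. norm (prob {\<omega>\<in>space M. R n \<omega> \<le> x} - prob {\<omega>\<in>space M. A n \<omega> - x * B n \<omega> \<le> 0} - 0) < r"
        using c(2)
      proof eventually_elim
        case (elim n)
        let ?R = "{\<omega>\<in>space M. R n \<omega> \<le> x}" and ?L = "{\<omega>\<in>space M. A n \<omega> - x * B n \<omega> \<le> 0}"
          and ?B = "{\<omega>\<in>space M. B n \<omega> < c}"
        have AE: "AE \<omega> in M. \<omega> \<notin> ?B \<longrightarrow> (\<omega> \<in> ?R \<longleftrightarrow> \<omega> \<in> ?L)"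
          using ratio[of n]
        proof eventually_elim
          case (elim \<omega>)
          then show ?case using c(1) by (auto simp: div_le)
        qed
        have "prob ?R \<le> prob (?L \<union> ?B)"
        proof (rule finite_measure_mono_AE)
          show "AE \<omega> in M. \<omega> \<in> ?R \<longrightarrow> \<omega> \<in> ?L \<union> ?B" using AE by eventually_elim blast
        qed measurable
        moreover have "prob ?L \<le> prob (?R \<union> ?B)"
        proof (rule finite_measure_mono_AE)
          show "AE \<omega> in M. \<omega> \<in> ?L \<longrightarrow> \<omega> \<in> ?R \<union> ?B" using AE by eventually_elim blast
        qed measurable
        moreover have "prob (?L \<union> ?B) \<le> prob ?L + prob ?B" "prob (?R \<union> ?B) \<le> prob ?R + prob ?B"
          by (auto intro!: measure_Un_le)
        ultimately show ?case using elim r by (simp add: abs_less_iff)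
      qed
      then show "\<exists>no. \<forall>n\<ge>no. norm (prob {\<omega>\<in>space M. R n \<omega> \<le> x} - prob {\<omega>\<in>space M. A n \<omega> - x * B n \<omega> \<le> 0} - 0) < r"
        by (simp add: eventually_sequentially)
    qed
    from tendsto_add[OF this L]
    show "(\<lambda>n. cdf (distr M borel (R n)) x) \<longlonglongrightarrow> cdf (distr N borel (\<lambda>\<omega>. a \<omega> / b \<omega>)) x"
      by (simp add: cdf_eq cdf_eqN)
  qed
qed

text \<open>
  The vectors to be treated lie asymptotically on the line spanned by \<open>(1, -1)\<close>. On a compact set
  that carries most of the mass, \<open>f\<close> is uniformly continuous, so the vanishing deviation from the line
  may be dropped.
\<close>

lemma converges_in_law_imp_plane:
  fixes f :: "real \<times> real \<Rightarrow> real"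
  assumes N: "prob_space N"
    and [measurable]: "\<And>n. R n \<in> borel_measurable M" "\<And>n. D n \<in> borel_measurable M" "\<rho> \<in> borel_measurable N"
    and R: "converges_in_law M R N \<rho>" and D: "vanishes_in_prob M D"
    and f: "continuous_on UNIV f" "\<And>p. \<bar>f p\<bar> \<le> B"
  shows "(\<lambda>n. expectation (\<lambda>\<omega>. f (R n \<omega>, D n \<omega> - R n \<omega>))) \<longlonglongrightarrow> (\<integral>\<omega>. f (\<rho> \<omega>, - \<rho> \<omega>) \<partial>N)"
proof -
  interpret N: prob_space N by fact
  have [measurable]: "f \<in> borel_measurable borel" by (rule borel_measurable_continuous_onI[OF f(1)])
  have B: "0 \<le> B" using f(2)[of 0] by linarith
  have "continuous_on UNIV (\<lambda>x. f (x, - x))"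
    by (intro continuous_on_compose2[OF f(1)] continuous_intros) auto
  then have lim: "(\<lambda>n. expectation (\<lambda>\<omega>. f (R n \<omega>, - R n \<omega>))) \<longlonglongrightarrow> (\<integral>\<omega>. f (\<rho> \<omega>, - \<rho> \<omega>) \<partial>N)"
    using f(2) by (intro weak_convD[OF N _ _ R, where B = B]) auto
  have "(\<lambda>n. expectation (\<lambda>\<omega>. f (R n \<omega>, D n \<omega> - R n \<omega>)) - expectation (\<lambda>\<omega>. f (R n \<omega>, - R n \<omega>))) \<longlonglongrightarrow> 0"
  proof (rule LIMSEQ_I)
    fix r :: real assume r: "0 < r"
    define \<eta> where "\<eta> = r / (8 * (B + 1))"
    have \<eta>: "0 < \<eta>" using r B by (simp add: \<eta>_def)
    obtain K where K: "0 < K" "\<forall>\<^sub>F n in sequentially. prob {\<omega>\<in>space M. K < \<bar>R n \<omega>\<bar>} \<le> \<eta>"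
      using converges_in_law_imp_bounded[OF N _ _ R] \<eta> by (auto simp: bounded_in_prob_def)
    define S where "S = {-K..K} \<times> {-K-1..K+1}"
    have "uniformly_continuous_on S f"
      unfolding S_def by (intro compact_uniformly_continuous continuous_on_subset[OF f(1)] compact_Times) auto
    then obtain d where d: "0 < d" "\<And>p q. p \<in> S \<Longrightarrow> q \<in> S \<Longrightarrow> dist q p < d \<Longrightarrow> dist (f q) (f p) < r / 4"
      unfolding uniformly_continuous_on_def using r by (metis divide_pos_pos zero_less_numeral)
    define \<delta> where "\<delta> = min 1 (d / 2)"
    have \<delta>: "0 < \<delta>" "\<delta> \<le> 1" "\<delta> < d" using d(1) by (auto simp: \<delta>_def)
    have "\<forall>\<^sub>F n in sequentially. prob {\<omega>\<in>space M. \<delta> < \<bar>D n \<omega>\<bar>} \<le> \<eta>"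
      using D \<delta>(1) \<eta> by (auto simp: vanishes_in_prob_def)
    with K(2) have "\<forall>\<^sub>F n in sequentially. norm (expectation (\<lambda>\<omega>. f (R n \<omega>, D n \<omega> - R n \<omega>)) - expectation (\<lambda>\<omega>. f (R n \<omega>, - R n \<omega>)) - 0) < r"
    proof eventually_elim
      case (elim n)
      let ?A = "{\<omega>\<in>space M. K < \<bar>R n \<omega>\<bar> \<or> \<delta> < \<bar>D n \<omega>\<bar>}"
      have "prob ?A \<le> prob {\<omega>\<in>space M. K < \<bar>R n \<omega>\<bar>} + prob {\<omega>\<in>space M. \<delta> < \<bar>D n \<omega>\<bar>}"
        by (rule prob_le_sum) auto
      then have A: "prob ?A \<le> 2 * \<eta>" using elim by simp
      have "\<bar>expectation (\<lambda>\<omega>. f (R n \<omega>, D n \<omega> - R n \<omega>)) - expectation (\<lambda>\<omega>. f (R n \<omega>, - R n \<omega>))\<bar> \<le> r / 4 + 2 * B * prob ?A"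
      proof (rule expectation_diff_le)
        fix \<omega> assume "\<omega> \<in> space M" "\<omega> \<notin> ?A"
        then have *: "\<bar>R n \<omega>\<bar> \<le> K" "\<bar>D n \<omega>\<bar> \<le> \<delta>" by auto
        have "dist (f (R n \<omega>, D n \<omega> - R n \<omega>)) (f (R n \<omega>, - R n \<omega>)) < r / 4"
          using * \<delta> by (intro d(2)) (auto simp: S_def dist_Pair_Pair dist_real_def abs_le_iff)
        then show "\<bar>f (R n \<omega>, D n \<omega> - R n \<omega>) - f (R n \<omega>, - R n \<omega>)\<bar> \<le> r / 4" by (simp add: dist_real_def)
      qed (use f(2) r in auto)
      also have "\<dots> \<le> r / 4 + 2 * B * (2 * \<eta>)" using A B by (intro add_left_mono mult_left_mono) auto
      also have "\<dots> \<le> r / 4 + r / 2"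
        using B r by (simp add: \<eta>_def field_simps)
      finally show ?case using r by simp
    qed
    then show "\<exists>no. \<forall>n\<ge>no. norm (expectation (\<lambda>\<omega>. f (R n \<omega>, D n \<omega> - R n \<omega>)) - expectation (\<lambda>\<omega>. f (R n \<omega>, - R n \<omega>)) - 0) < r"
      by (simp add: eventually_sequentially)
  qed
  from tendsto_add[OF this lim] show ?thesis by simp
qed

end

section \<open>Independent vectors\<close>

lemma distr_PiM_coordinatewise:
  fixes S :: "nat \<Rightarrow> 'c \<Rightarrow> real"
  assumes \<Omega>: "\<And>j. prob_space (\<Omega> j)" and [measurable]: "\<And>j. S j \<in> borel_measurable (\<Omega> j)"
  shows "distr (PiM {..<m} \<Omega>) (PiM {..<m} (\<lambda>_. borel)) (\<lambda>x. \<lambda>j\<in>{..<m}. S j (x j)) =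
    PiM {..<m} (\<lambda>j. distr (\<Omega> j) borel (S j))"
proof -
  interpret P: product_prob_space \<Omega> by (intro product_prob_spaceI \<Omega>)
  interpret Q: product_prob_space "\<lambda>j. distr (\<Omega> j) borel (S j)"
    by (intro product_prob_spaceI prob_space.prob_space_distr \<Omega>) simp
  let ?T = "\<lambda>x. \<lambda>j\<in>{..<m}. S j (x j)"
  have T: "?T \<in> PiM {..<m} \<Omega> \<rightarrow>\<^sub>M PiM {..<m} (\<lambda>_. borel)" by measurable
  show ?thesis
  proof (rule Q.PiM_eqI)
    show "sets (distr (PiM {..<m} \<Omega>) (PiM {..<m} (\<lambda>_. borel)) ?T) = sets (PiM {..<m} (\<lambda>j. distr (\<Omega> j) borel (S j)))"
      by (simp cong: sets_PiM_cong)
    fix A assume "\<And>j. j \<in> {..<m} \<Longrightarrow> A j \<in> sets (distr (\<Omega> j) borel (S j))"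
    then have A: "A j \<in> sets borel" if "j < m" for j using that by simp
    have "emeasure (distr (PiM {..<m} \<Omega>) (PiM {..<m} (\<lambda>_. borel)) ?T) (Pi\<^sub>E {..<m} A) =
        emeasure (PiM {..<m} \<Omega>) (?T -` Pi\<^sub>E {..<m} A \<inter> space (PiM {..<m} \<Omega>))"
      using A by (intro emeasure_distr[OF T] sets_PiM_I_finite) auto
    also have "?T -` Pi\<^sub>E {..<m} A \<inter> space (PiM {..<m} \<Omega>) = Pi\<^sub>E {..<m} (\<lambda>j. S j -` A j \<inter> space (\<Omega> j))"
      by (auto simp: space_PiM PiE_iff)
    also have "emeasure (PiM {..<m} \<Omega>) \<dots> = (\<Prod>j<m. emeasure (\<Omega> j) (S j -` A j \<inter> space (\<Omega> j)))"
      using A by (intro P.emeasure_PiM) auto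
    also have "\<dots> = (\<Prod>j<m. emeasure (distr (\<Omega> j) borel (S j)) (A j))"
      using A by (intro prod.cong) (auto simp: emeasure_distr)
    finally show "emeasure (distr (PiM {..<m} \<Omega>) (PiM {..<m} (\<lambda>_. borel)) ?T) (Pi\<^sub>E {..<m} A) =
        (\<Prod>j<m. emeasure (distr (\<Omega> j) borel (S j)) (A j))" .
  qed simp
qed

text \<open>
  A continuous mapping theorem for vectors with independent components. Skorohod's theorem gives
  almost sure versions of each component; on the product of the underlying spaces they have the right
  joint law, and the functions \<open>h n\<close> may be applied pointwise. The functions may vary with \<open>n\<close> because
  the lengths of the blocks used later only approach equality.
\<close>

lemma converges_in_law_independent_vector:
  fixes Y :: "nat \<Rightarrow> nat \<Rightarrow> 'a \<Rightarrow> real" and G :: "nat \<Rightarrow> 'b \<Rightarrow> real"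
    and h :: "nat \<Rightarrow> (nat \<Rightarrow> real) \<Rightarrow> real"
  assumes M: "prob_space M" and N: "prob_space N" and m: "0 < m"
    and [measurable]: "\<And>n j. Y n j \<in> borel_measurable M" "\<And>j. G j \<in> borel_measurable N"
    and conv: "\<And>j. converges_in_law M (\<lambda>n. Y n j) N (G j)"
    and Y: "\<And>n. prob_space.indep_vars M (\<lambda>_. borel) (Y n) {..<m}"
    and G: "prob_space.indep_vars N (\<lambda>_. borel) G {..<m}"
    and [measurable]: "\<And>n. h n \<in> borel_measurable (PiM {..<m} (\<lambda>_. borel))" "h' \<in> borel_measurable (PiM {..<m} (\<lambda>_. borel))"
    and h: "\<And>y y'. (\<And>j. j < m \<Longrightarrow> (\<lambda>n. y n j) \<longlonglongrightarrow> y' j) \<Longrightarrow> (\<lambda>n. h n (y n)) \<longlonglongrightarrow> h' y'"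
  shows "converges_in_law M (\<lambda>n \<omega>. h n (\<lambda>j\<in>{..<m}. Y n j \<omega>)) N (\<lambda>\<omega>. h' (\<lambda>j\<in>{..<m}. G j \<omega>))"
proof -
  interpret M: prob_space M by fact
  interpret N: prob_space N by fact
  have "\<exists>(\<Omega> :: real measure) Ys Y'. prob_space \<Omega> \<and> (\<forall>n. Ys n \<in> borel_measurable \<Omega>) \<and>
      (\<forall>n. distr \<Omega> borel (Ys n) = distr M borel (Y n j)) \<and> Y' \<in> borel_measurable \<Omega> \<and>
      distr \<Omega> borel Y' = distr N borel (G j) \<and> (\<forall>x\<in>space \<Omega>. (\<lambda>n. Ys n x) \<longlonglongrightarrow> Y' x)" for j
    using Skorohod[OF M.real_distribution_distr N.real_distribution_distr conv[of j]] by simp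
  then obtain \<Omega> :: "nat \<Rightarrow> real measure" and S S' where
    \<Omega>: "\<And>j. prob_space (\<Omega> j)" and Sm [measurable]: "\<And>j n. S j n \<in> borel_measurable (\<Omega> j)"
    and S: "\<And>j n. distr (\<Omega> j) borel (S j n) = distr M borel (Y n j)"
    and S'm [measurable]: "\<And>j. S' j \<in> borel_measurable (\<Omega> j)"
    and S': "\<And>j. distr (\<Omega> j) borel (S' j) = distr N borel (G j)"
    and lim: "\<And>j x. x \<in> space (\<Omega> j) \<Longrightarrow> (\<lambda>n. S j n x) \<longlonglongrightarrow> S' j x"
    by metis
  let ?P = "PiM {..<m} \<Omega>" and ?B = "PiM {..<m} (\<lambda>_. borel :: real measure)"
  interpret P: product_prob_space \<Omega> by (intro product_prob_spaceI \<Omega>)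
  interpret PP: prob_space ?P by (rule prob_space_PiM) (rule \<Omega>)
  let ?T = "\<lambda>n x. \<lambda>j\<in>{..<m}. S j n (x j)" and ?T' = "\<lambda>x. \<lambda>j\<in>{..<m}. S' j (x j)"
  have "distr M ?B (\<lambda>\<omega>. \<lambda>j\<in>{..<m}. Y n j \<omega>) = distr ?P ?B (?T n)" for n
    using Y[of n] m unfolding distr_PiM_coordinatewise[where \<Omega> = \<Omega> and S = "\<lambda>j. S j n", OF \<Omega> Sm] S
    by (subst (asm) M.indep_vars_iff_distr_eq_PiM) auto
  then have "distr (distr M ?B (\<lambda>\<omega>. \<lambda>j\<in>{..<m}. Y n j \<omega>)) borel (h n) = distr (distr ?P ?B (?T n)) borel (h n)" for n
    by simp
  then have lawY: "distr M borel (\<lambda>\<omega>. h n (\<lambda>j\<in>{..<m}. Y n j \<omega>)) = distr ?P borel (\<lambda>x. h n (?T n x))" for n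
    by (simp add: distr_distr comp_def)
  have "distr N ?B (\<lambda>\<omega>. \<lambda>j\<in>{..<m}. G j \<omega>) = distr ?P ?B ?T'"
    using G m unfolding distr_PiM_coordinatewise[where \<Omega> = \<Omega> and S = S', OF \<Omega> S'm] S'
    by (subst (asm) N.indep_vars_iff_distr_eq_PiM) auto
  then have "distr (distr N ?B (\<lambda>\<omega>. \<lambda>j\<in>{..<m}. G j \<omega>)) borel h' = distr (distr ?P ?B ?T') borel h'"
    by simp
  then have lawG: "distr N borel (\<lambda>\<omega>. h' (\<lambda>j\<in>{..<m}. G j \<omega>)) = distr ?P borel (\<lambda>x. h' (?T' x))"
    by (simp add: distr_distr comp_def)
  show ?thesis
    unfolding lawY lawG
  proof (rule PP.weak_convI_bdd_uniformly_continuous)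
    fix g :: "real \<Rightarrow> real" assume uc: "uniformly_continuous_on UNIV g" and b: "\<And>x. \<bar>g x\<bar> \<le> 1"
    have cont: "continuous_on UNIV g" by (rule uniformly_continuous_imp_continuous[OF uc])
    have [measurable]: "g \<in> borel_measurable borel" by (rule borel_measurable_continuous_onI[OF cont])
    show "(\<lambda>n. PP.expectation (\<lambda>x. g (h n (?T n x)))) \<longlonglongrightarrow> PP.expectation (\<lambda>x. g (h' (?T' x)))"
    proof (rule integral_dominated_convergence[where w = "\<lambda>_. 1"])
      show "AE x in ?P. (\<lambda>n. g (h n (?T n x))) \<longlonglongrightarrow> g (h' (?T' x))"
      proof (rule AE_I2)
        fix x assume x: "x \<in> space ?P"
        have "(\<lambda>n. h n (?T n x)) \<longlonglongrightarrow> h' (?T' x)"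
          by (rule h) (use x lim in \<open>auto simp: space_PiM PiE_iff\<close>)
        then show "(\<lambda>n. g (h n (?T n x))) \<longlonglongrightarrow> g (h' (?T' x))"
          by (rule continuous_on_tendsto_compose[OF cont]) auto
      qed
    qed (use b in auto)
  qed (auto intro: PP.prob_space_axioms)
qed

section \<open>Innovations\<close>

text \<open>
  Time is shifted so that the innovations are \<open>e 0, e 1, \<dots>\<close>; thus \<open>e i\<close> stands for \<open>\<epsilon> (i + 1)\<close>.
\<close>

locale innovations = prob_space M for M :: "'a measure" +
  fixes e :: "nat \<Rightarrow> 'a \<Rightarrow> real" and \<mu> \<sigma>2 :: real
  assumes e_indep: "indep_vars (\<lambda>_. borel) e UNIV"
    and e_law: "\<And>i. distr M borel (e i) = distr M borel (e 0)"
    and e_square: "integrable M (\<lambda>\<omega>. (e 0 \<omega>)\<^sup>2)"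
    and \<mu>_def: "\<mu> = expectation (e 0)"
    and \<sigma>2_def: "\<sigma>2 = variance (e 0)"
begin

lemma measurable_e [measurable]: "e i \<in> borel_measurable M"
  using e_indep by (auto simp: indep_vars_def)

lemma
  fixes g :: "real \<Rightarrow> real"
  assumes [measurable]: "g \<in> borel_measurable borel"
  shows expectation_e_cong: "expectation (\<lambda>\<omega>. g (e i \<omega>)) = expectation (\<lambda>\<omega>. g (e 0 \<omega>))"
    and integrable_e_cong: "integrable M (\<lambda>\<omega>. g (e i \<omega>)) \<longleftrightarrow> integrable M (\<lambda>\<omega>. g (e 0 \<omega>))"
  using integral_distr[of "e i" M borel g] integral_distr[of "e 0" M borel g]
    integrable_distr_eq[of "e i" M borel g] integrable_distr_eq[of "e 0" M borel g] e_law[of i] by auto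

definition m :: "nat \<Rightarrow> 'a \<Rightarrow> real" where
  "m i \<omega> = e i \<omega> - \<mu>"

lemma measurable_m [measurable]: "m i \<in> borel_measurable M"
  unfolding m_def by measurable

lemma integrable_e: "integrable M (e i)"
  using square_integrable_imp_integrable[OF measurable_e e_square] integrable_e_cong[of "\<lambda>x. x" i] by simp

lemma integrable_e_square: "integrable M (\<lambda>\<omega>. (e i \<omega>)\<^sup>2)"
  using e_square integrable_e_cong[of "\<lambda>x. x\<^sup>2" i] by simp

lemma integrable_m_square: "integrable M (\<lambda>\<omega>. (m i \<omega>)\<^sup>2)"
  unfolding m_def power2_diff using integrable_e[of i] integrable_e_square[of i] by simp

lemma integrable_m: "integrable M (m i)"
  by (rule square_integrable_imp_integrable[OF measurable_m integrable_m_square])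

lemma m_mean: "expectation (m i) = 0"
  unfolding m_def using integrable_e[of i] expectation_e_cong[of "\<lambda>x. x" i] by (simp add: prob_space \<mu>_def)

lemma m_variance: "expectation (\<lambda>\<omega>. (m i \<omega>)\<^sup>2) = \<sigma>2"
  unfolding m_def using expectation_e_cong[of "\<lambda>x. (x - \<mu>)\<^sup>2" i] by (simp add: \<sigma>2_def \<mu>_def)

lemma \<sigma>2_nonneg: "0 \<le> \<sigma>2"
  unfolding m_variance[of 0, symmetric] by (intro Bochner_Integration.integral_nonneg) simp

lemma e_second_moment: "expectation (\<lambda>\<omega>. (e i \<omega>)\<^sup>2) = \<mu>\<^sup>2 + \<sigma>2"
proof -
  have "(e i \<omega>)\<^sup>2 = (m i \<omega>)\<^sup>2 + 2 * \<mu> * m i \<omega> + \<mu>\<^sup>2" for \<omega>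
    by (simp add: m_def power2_eq_square algebra_simps)
  then show ?thesis using integrable_m_square integrable_m by (simp add: m_mean m_variance prob_space)
qed

definition history :: "nat \<Rightarrow> 'a measure" where
  "history j = vimage_algebra (space M) (\<lambda>\<omega>. \<lambda>i\<in>{..<j}. e i \<omega>) (PiM {..<j} (\<lambda>_. borel))"

lemma space_history [simp]: "space (history j) = space M"
  by (simp add: history_def)

lemma measurable_history_vector: "(\<lambda>\<omega>. \<lambda>i\<in>{..<j}. e i \<omega>) \<in> history j \<rightarrow>\<^sub>M PiM {..<j} (\<lambda>_. borel)"
  unfolding history_def by (rule measurable_vimage_algebra1) (auto simp: space_PiM)

lemma e_history: "i < j \<Longrightarrow> e i \<in> borel_measurable (history j)"
  using measurable_compose[OF measurable_history_vector measurable_component_singleton, of i j] by simp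

lemma m_history: "i < j \<Longrightarrow> m i \<in> borel_measurable (history j)"
  unfolding m_def by (intro borel_measurable_diff e_history) auto

lemma subalgebra_history: "subalgebra M (history j)"
proof -
  have "(\<lambda>\<omega>. \<lambda>i\<in>{..<j}. e i \<omega>) \<in> M \<rightarrow>\<^sub>M PiM {..<j} (\<lambda>_. borel)" by measurable
  from sets_image_in_sets[OF refl this] show ?thesis by (simp add: subalgebra_def history_def)
qed

lemma sets_history_mono: "i \<le> j \<Longrightarrow> sets (history i) \<subseteq> sets (history j)"
proof -
  assume "i \<le> j"
  then have "(\<lambda>\<omega>. \<lambda>k\<in>{..<i}. e k \<omega>) \<in> history j \<rightarrow>\<^sub>M PiM {..<i} (\<lambda>_. borel)"
    by (intro measurable_restrict e_history) auto
  from sets_image_in_sets[OF space_history this] show ?thesis by (simp add: history_def)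
qed

lemma innovation_indep_of_history:
  assumes [measurable]: "g \<in> borel_measurable borel"
  shows "indep_of_past M (history j) (\<lambda>\<omega>. g (e j \<omega>))"
  unfolding indep_of_past_def
proof (intro conjI subalgebra_history)
  let ?f = "\<lambda>\<omega>. \<lambda>i\<in>{..<j}. e i \<omega>"
  have "indep_var (PiM {..<j} (\<lambda>_. borel)) ?f (PiM {j} (\<lambda>_. borel)) (\<lambda>\<omega>. \<lambda>i\<in>{j}. e i \<omega>)"
    by (rule indep_var_restrict[OF e_indep]) auto
  then have ind: "indep_set (sigma_sets (space M) {?f -` A \<inter> space M | A. A \<in> sets (PiM {..<j} (\<lambda>_. borel))})
      (sigma_sets (space M) {(\<lambda>\<omega>. \<lambda>i\<in>{j}. e i \<omega>) -` A \<inter> space M | A. A \<in> sets (PiM {j} (\<lambda>_. borel))})"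
    by (simp add: indep_var_eq)
  have g: "{(\<lambda>\<omega>. g (e j \<omega>)) -` B \<inter> space M | B. B \<in> sets borel} \<subseteq>
      {(\<lambda>\<omega>. \<lambda>i\<in>{j}. e i \<omega>) -` A \<inter> space M | A. A \<in> sets (PiM {j} (\<lambda>_. borel))}"
  proof clarify
    fix B :: "real set" assume B: "B \<in> sets borel"
    have "(\<lambda>x. g (x j)) \<in> borel_measurable (PiM {j} (\<lambda>_. borel))"
      by measurable
    from measurable_sets[OF this B]
    show "\<exists>A. (\<lambda>\<omega>. g (e j \<omega>)) -` B \<inter> space M = (\<lambda>\<omega>. \<lambda>i\<in>{j}. e i \<omega>) -` A \<inter> space M \<and> A \<in> sets (PiM {j} (\<lambda>_. borel))"
      by (intro exI[of _ "(\<lambda>x. g (x j)) -` B \<inter> space (PiM {j} (\<lambda>_. borel))"]) (auto simp: space_PiM)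
  qed
  have "sets (history j) = {?f -` A \<inter> space M | A. A \<in> sets (PiM {..<j} (\<lambda>_. borel))}"
    unfolding history_def by (rule sets_vimage_algebra2) (auto simp: space_PiM)
  then have hist: "sets (history j) \<subseteq> sigma_sets (space M) {?f -` A \<inter> space M | A. A \<in> sets (PiM {..<j} (\<lambda>_. borel))}"
    by (simp only: sigma_sets_superset_generator)
  have "{(\<lambda>\<omega>. g (e j \<omega>)) -` B \<inter> space M | B. B \<in> sets borel} \<subseteq>
      sigma_sets (space M) {(\<lambda>\<omega>. \<lambda>i\<in>{j}. e i \<omega>) -` A \<inter> space M | A. A \<in> sets (PiM {j} (\<lambda>_. borel))}"
    by (rule order_trans[OF g sigma_sets_superset_generator])
  with hist ind show "indep_set (sets (history j)) {(\<lambda>\<omega>. g (e j \<omega>)) -` B \<inter> space M | B. B \<in> sets borel}"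
    unfolding indep_sets2_eq by blast
qed simp

lemma
  assumes H: "\<And>i. i < n \<Longrightarrow> H i \<in> borel_measurable (history i)" "\<And>i. i < n \<Longrightarrow> integrable M (\<lambda>\<omega>. (H i \<omega>)\<^sup>2)"
  shows integrable_martingale_square: "integrable M (\<lambda>\<omega>. (\<Sum>i<n. H i \<omega> * m i \<omega>)\<^sup>2)"
    and martingale_second_moment: "expectation (\<lambda>\<omega>. (\<Sum>i<n. H i \<omega> * m i \<omega>)\<^sup>2) = (\<Sum>i<n. \<sigma>2 * expectation (\<lambda>\<omega>. (H i \<omega>)\<^sup>2))"
proof -
  have 1: "indep_of_past M (history i) (m i)" for i
    using innovation_indep_of_history[of "\<lambda>x. x - \<mu>" i] by (simp add: m_def[abs_def])
  note predictable_transform_second_moment[of n history m H "\<lambda>_. \<sigma>2", OF 1 sets_history_mono m_history H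
      integrable_m_square m_mean m_variance]
  then show "integrable M (\<lambda>\<omega>. (\<Sum>i<n. H i \<omega> * m i \<omega>)\<^sup>2)"
    "expectation (\<lambda>\<omega>. (\<Sum>i<n. H i \<omega> * m i \<omega>)\<^sup>2) = (\<Sum>i<n. \<sigma>2 * expectation (\<lambda>\<omega>. (H i \<omega>)\<^sup>2))"
    by blast+
qed

lemma
  fixes c :: "nat \<Rightarrow> real"
  shows integrable_weighted_sum_square: "integrable M (\<lambda>\<omega>. (\<Sum>i<n. c i * m i \<omega>)\<^sup>2)"
    and weighted_sum_second_moment: "expectation (\<lambda>\<omega>. (\<Sum>i<n. c i * m i \<omega>)\<^sup>2) = \<sigma>2 * (\<Sum>i<n. (c i)\<^sup>2)"
proof -
  show "integrable M (\<lambda>\<omega>. (\<Sum>i<n. c i * m i \<omega>)\<^sup>2)"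
    by (rule integrable_martingale_square[of n "\<lambda>i _. c i"]) simp_all
  have "expectation (\<lambda>\<omega>. (\<Sum>i<n. c i * m i \<omega>)\<^sup>2) = (\<Sum>i<n. \<sigma>2 * expectation (\<lambda>\<omega>. (c i)\<^sup>2))"
    by (rule martingale_second_moment[of n "\<lambda>i _. c i"]) simp_all
  then show "expectation (\<lambda>\<omega>. (\<Sum>i<n. c i * m i \<omega>)\<^sup>2) = \<sigma>2 * (\<Sum>i<n. (c i)\<^sup>2)"
    by (simp only: prob_space lebesgue_integral_const sum_distrib_left) (simp add: prob_space)
qed

text \<open>
  The law of large numbers in the mean for the squares \<open>(m i)\<^sup>2\<close>, which have a first moment only.
  Truncation at a level \<open>c\<close> costs twice the tail \<open>\<sigma>2 - \<theta> c\<close> uniformly in \<open>n\<close>, and the truncated variables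
  are bounded, so that orthogonality controls their average.
\<close>

lemma mean_square_convergence:
  "(\<lambda>n. expectation (\<lambda>\<omega>. \<bar>(\<Sum>i<n. (m i \<omega>)\<^sup>2) / real n - \<sigma>2\<bar>)) \<longlonglongrightarrow> 0"
proof (rule LIMSEQ_I)
  fix r :: real assume r: "0 < r"
  define t where "t c x = min ((x - \<mu>)\<^sup>2) (real c)" for c :: nat and x :: real
  have [measurable]: "t c \<in> borel_measurable borel" for c unfolding t_def[abs_def] by measurable
  have tb: "\<bar>t c x\<bar> \<le> real c" "t c x \<le> (x - \<mu>)\<^sup>2" "0 \<le> t c x" for c x by (auto simp: t_def)
  have int_t: "integrable M (\<lambda>\<omega>. t c (e i \<omega>))" for c i
    using tb by (intro integrable_const_bound[where B = "real c"]) auto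
  define \<theta> where "\<theta> c = expectation (\<lambda>\<omega>. t c (e 0 \<omega>))" for c
  have E_t: "expectation (\<lambda>\<omega>. t c (e i \<omega>)) = \<theta> c" for c i
    unfolding \<theta>_def by (rule expectation_e_cong) simp
  \<comment> \<open>The truncated means exhaust the variance.\<close>
  have "\<theta> \<longlonglongrightarrow> expectation (\<lambda>\<omega>. (m 0 \<omega>)\<^sup>2)"
    unfolding \<theta>_def
  proof (rule integral_dominated_convergence[where w = "\<lambda>\<omega>. (m 0 \<omega>)\<^sup>2"])
    show "AE \<omega> in M. (\<lambda>c. t c (e 0 \<omega>)) \<longlonglongrightarrow> (m 0 \<omega>)\<^sup>2"
    proof (rule AE_I2)
      fix \<omega>
      have "\<forall>\<^sub>F c in sequentially. (m 0 \<omega>)\<^sup>2 = t c (e 0 \<omega>)"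
        using eventually_ge_at_top[of "nat \<lceil>(m 0 \<omega>)\<^sup>2\<rceil>"]
      proof eventually_elim
        case (elim c)
        then have "(m 0 \<omega>)\<^sup>2 \<le> real c" by linarith
        then show ?case by (simp add: t_def m_def)
      qed
      then show "(\<lambda>c. t c (e 0 \<omega>)) \<longlonglongrightarrow> (m 0 \<omega>)\<^sup>2" by (rule Lim_transform_eventually[OF tendsto_const])
    qed
    show "AE \<omega> in M. norm (t c (e 0 \<omega>)) \<le> (m 0 \<omega>)\<^sup>2" for c
      using tb by (auto simp: m_def)
  qed (simp_all add: integrable_m_square)
  then have "\<theta> \<longlonglongrightarrow> \<sigma>2" by (simp only: m_variance)
  moreover have "\<sigma>2 - r / 8 < \<sigma>2" using r by linarith
  ultimately have "\<forall>\<^sub>F c in sequentially. \<sigma>2 - r / 8 < \<theta> c" by (rule order_tendstoD(1))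
  then obtain c where c: "\<sigma>2 - r / 8 < \<theta> c" using eventually_happens'[OF sequentially_bot] by blast
  let ?D = "\<lambda>i \<omega>. t c (e i \<omega>) - \<theta> c"
  have D2: "integrable M (\<lambda>\<omega>. (?D i \<omega>)\<^sup>2)" for i
  proof (rule integrable_const_bound[where B = "(real c + \<bar>\<theta> c\<bar>)\<^sup>2"])
    show "AE \<omega> in M. norm ((?D i \<omega>)\<^sup>2) \<le> (real c + \<bar>\<theta> c\<bar>)\<^sup>2"
    proof (rule AE_I2)
      fix \<omega>
      have "\<bar>?D i \<omega>\<bar> \<le> real c + \<bar>\<theta> c\<bar>" using tb(1)[of c "e i \<omega>"] by linarith
      then show "norm ((?D i \<omega>)\<^sup>2) \<le> (real c + \<bar>\<theta> c\<bar>)\<^sup>2" by (simp add: abs_le_square_iff[symmetric])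
    qed
  qed simp
  define V where "V = expectation (\<lambda>\<omega>. (?D 0 \<omega>)\<^sup>2)"
  have V: "expectation (\<lambda>\<omega>. (?D i \<omega>)\<^sup>2) = V" for i
    unfolding V_def by (rule expectation_e_cong[of "\<lambda>x. (t c x - \<theta> c)\<^sup>2"]) simp
  have V0: "0 \<le> V" unfolding V_def by (intro Bochner_Integration.integral_nonneg) simp
  have D_mean: "expectation (?D i) = 0" for i using int_t by (simp add: prob_space E_t)
  have S: "integrable M (\<lambda>\<omega>. (\<Sum>i<n. ?D i \<omega>)\<^sup>2) \<and> expectation (\<lambda>\<omega>. (\<Sum>i<n. ?D i \<omega>)\<^sup>2) = real n * V" for n
  proof -
    have 1: "indep_of_past M (history i) (?D i)" for i
      by (rule innovation_indep_of_history[of "\<lambda>x. t c x - \<theta> c"]) simp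
    have 2: "?D i \<in> borel_measurable (history j)" if "i < j" for i j
      using measurable_compose[OF e_history[OF that], of "\<lambda>x. t c x - \<theta> c" borel] by simp
    have 3: "integrable M (\<lambda>\<omega>. (1::real)\<^sup>2)" by simp
    show ?thesis
      using predictable_transform_second_moment[of n history ?D "\<lambda>_ _. 1" "\<lambda>_. V", OF 1 sets_history_mono 2 borel_measurable_const 3 D2 D_mean V]
      by (simp add: prob_space)
  qed
  have avg: "expectation (\<lambda>\<omega>. \<bar>\<Sum>i<n. ?D i \<omega>\<bar>) \<le> sqrt (real n * V)" for n
    using S[of n] V0 by (intro expectation_abs_le_sqrt_moment) auto
  have bound: "expectation (\<lambda>\<omega>. \<bar>(\<Sum>i<n. (m i \<omega>)\<^sup>2) / real n - \<sigma>2\<bar>) \<le> r / 4 + sqrt (V / real n)" if n: "n > 0" for n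
  proof -
    have intA: "integrable M (\<lambda>\<omega>. \<Sum>i<n. (m i \<omega>)\<^sup>2 - t c (e i \<omega>))"
      and intB: "integrable M (\<lambda>\<omega>. \<bar>\<Sum>i<n. ?D i \<omega>\<bar>)"
      using integrable_m_square int_t by (auto intro!: Bochner_Integration.integrable_sum integrable_abs)
    have "expectation (\<lambda>\<omega>. \<bar>(\<Sum>i<n. (m i \<omega>)\<^sup>2) / real n - \<sigma>2\<bar>) \<le>
        expectation (\<lambda>\<omega>. (\<Sum>i<n. (m i \<omega>)\<^sup>2 - t c (e i \<omega>)) / real n + (\<bar>\<Sum>i<n. ?D i \<omega>\<bar> / real n + \<bar>\<theta> c - \<sigma>2\<bar>))"
    proof (rule integral_mono)
      fix \<omega>
      have "(\<Sum>i<n. (m i \<omega>)\<^sup>2) / real n - \<sigma>2 =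
          (\<Sum>i<n. (m i \<omega>)\<^sup>2 - t c (e i \<omega>)) / real n + ((\<Sum>i<n. ?D i \<omega>) / real n + (\<theta> c - \<sigma>2))"
        using n by (simp add: sum_subtractf field_simps)
      moreover have "0 \<le> (\<Sum>i<n. (m i \<omega>)\<^sup>2 - t c (e i \<omega>)) / real n"
        using tb by (intro divide_nonneg_nonneg sum_nonneg) (auto simp: m_def)
      moreover have "\<bar>(\<Sum>i<n. ?D i \<omega>) / real n\<bar> = \<bar>\<Sum>i<n. ?D i \<omega>\<bar> / real n" by simp
      ultimately show "\<bar>(\<Sum>i<n. (m i \<omega>)\<^sup>2) / real n - \<sigma>2\<bar> \<le>
          (\<Sum>i<n. (m i \<omega>)\<^sup>2 - t c (e i \<omega>)) / real n + (\<bar>\<Sum>i<n. ?D i \<omega>\<bar> / real n + \<bar>\<theta> c - \<sigma>2\<bar>)"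
        by linarith
    qed (use intA intB integrable_m_square in auto)
    also have "\<dots> = expectation (\<lambda>\<omega>. \<Sum>i<n. (m i \<omega>)\<^sup>2 - t c (e i \<omega>)) / real n + (expectation (\<lambda>\<omega>. \<bar>\<Sum>i<n. ?D i \<omega>\<bar>) / real n + \<bar>\<theta> c - \<sigma>2\<bar>)"
      using intA intB by (simp add: prob_space)
    also have "expectation (\<lambda>\<omega>. \<Sum>i<n. (m i \<omega>)\<^sup>2 - t c (e i \<omega>)) = real n * (\<sigma>2 - \<theta> c)"
      using integrable_m_square int_t by (simp add: Bochner_Integration.integral_sum m_variance E_t)
    also have "real n * (\<sigma>2 - \<theta> c) / real n = \<sigma>2 - \<theta> c" using n by simp
    also have "\<sigma>2 - \<theta> c + (expectation (\<lambda>\<omega>. \<bar>\<Sum>i<n. ?D i \<omega>\<bar>) / real n + \<bar>\<theta> c - \<sigma>2\<bar>) \<le>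
        r / 4 + sqrt (V / real n)"
    proof -
      have "\<theta> c \<le> \<sigma>2"
        unfolding m_variance[of 0, symmetric] \<theta>_def using int_t integrable_m_square tb
        by (intro integral_mono) (auto simp: m_def)
      moreover have "expectation (\<lambda>\<omega>. \<bar>\<Sum>i<n. ?D i \<omega>\<bar>) / real n \<le> sqrt (real n * V) / real n"
        using avg by (intro divide_right_mono) auto
      moreover have "sqrt (real n * V) / real n = sqrt (V / real n)"
        using n by (simp add: real_sqrt_mult real_sqrt_divide field_simps)
      ultimately show ?thesis using c by linarith
    qed
    finally show ?thesis .
  qed
  have "(\<lambda>n. sqrt (V / real n)) \<longlonglongrightarrow> sqrt 0"
    by (intro tendsto_real_sqrt real_tendsto_divide_at_top[OF tendsto_const] filterlim_real_sequentially)
  then have "\<forall>\<^sub>F n in sequentially. sqrt (V / real n) < r / 4"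
    using r by (intro order_tendstoD) auto
  with eventually_gt_at_top[of 0]
  have "\<forall>\<^sub>F n in sequentially. norm (expectation (\<lambda>\<omega>. \<bar>(\<Sum>i<n. (m i \<omega>)\<^sup>2) / real n - \<sigma>2\<bar>) - 0) < r"
  proof eventually_elim
    case (elim n)
    have "0 \<le> expectation (\<lambda>\<omega>. \<bar>(\<Sum>i<n. (m i \<omega>)\<^sup>2) / real n - \<sigma>2\<bar>)" by (intro Bochner_Integration.integral_nonneg) simp
    then show ?case using bound[OF elim(1)] elim(2) r by simp
  qed
  then show "\<exists>no. \<forall>n\<ge>no. norm (expectation (\<lambda>\<omega>. \<bar>(\<Sum>i<n. (m i \<omega>)\<^sup>2) / real n - \<sigma>2\<bar>) - 0) < r"
    by (simp add: eventually_sequentially)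
qed

section \<open>The observed walk\<close>

text \<open>
  The process with parameter \<open>(0, 1)\<close> consists of two interleaved random walks, one for each parity.
  In \<open>z\<close> the index is shifted by one: \<open>z n\<close> is the value of the process at time \<open>n - 1\<close>, so that the
  two zero initial values have indices 0 and 1. The difference \<open>v\<close> of consecutive values alternates
  in sign, and removing the sign leaves the centred walk \<open>T\<close> with increments \<open>\<plusminus>m\<close>, up to the bounded term
  in \<open>v_eq\<close>.
\<close>

definition T :: "nat \<Rightarrow> 'a \<Rightarrow> real" where
  "T n \<omega> = (\<Sum>i<n. (-1) ^ i * m i \<omega>)"

fun z :: "nat \<Rightarrow> 'a \<Rightarrow> real" where
  "z 0 \<omega> = 0"
| "z (Suc 0) \<omega> = 0"
| "z (Suc (Suc n)) \<omega> = z n \<omega> + e n \<omega>"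

definition v :: "nat \<Rightarrow> 'a \<Rightarrow> real" where
  "v n \<omega> = z (Suc n) \<omega> - z n \<omega>"

lemma v_Suc: "v (Suc n) \<omega> = e n \<omega> - v n \<omega>"
  by (simp add: v_def)

lemma v_eq: "v n \<omega> = (-1) ^ Suc n * T n \<omega> + (if odd n then \<mu> else 0)"
proof (induction n)
  case 0
  then show ?case by (simp add: v_def T_def)
next
  case (Suc n)
  then show ?case
    by (cases "even n") (simp_all add: v_Suc T_def m_def algebra_simps)
qed

lemma z_eq: "z n \<omega> = \<mu> * real (n div 2) + (\<Sum>i<n. (if even (n + i) then 1 else 0) * m i \<omega>)"
proof (induction n \<omega> rule: z.induct)
  case (3 n \<omega>)
  have "(\<Sum>i<Suc (Suc n). (if even (Suc (Suc n) + i) then 1 else 0) * m i \<omega>) =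
      (\<Sum>i<n. (if even (n + i) then 1 else 0) * m i \<omega>) + m n \<omega>"
    by simp
  then show ?case using 3 by (simp add: m_def algebra_simps)
qed simp_all

lemma measurable_z [measurable]: "z n \<in> borel_measurable M"
proof -
  have "z n = (\<lambda>\<omega>. \<mu> * real (n div 2) + (\<Sum>i<n. (if even (n + i) then 1 else 0) * m i \<omega>))"
    by (rule ext) (rule z_eq)
  then show ?thesis by simp
qed

lemma z_history: "z n \<in> borel_measurable (history n)"
proof -
  have "z n = (\<lambda>\<omega>. \<mu> * real (n div 2) + (\<Sum>i<n. (if even (n + i) then 1 else 0) * m i \<omega>))"
    by (rule ext) (rule z_eq)
  then show ?thesis
    by (auto intro!: borel_measurable_add borel_measurable_sum borel_measurable_times m_history)
qed

lemma T_history: "T n \<in> borel_measurable (history n)"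
  unfolding T_def by (intro borel_measurable_sum borel_measurable_times m_history) auto

lemma measurable_T [measurable]: "T n \<in> borel_measurable M"
  unfolding T_def by measurable

lemma v_history: "v n \<in> borel_measurable (history n)"
proof -
  have "v n = (\<lambda>\<omega>. (-1) ^ Suc n * T n \<omega> + (if odd n then \<mu> else 0))"
    by (rule ext) (rule v_eq)
  then show ?thesis
    by (auto intro!: borel_measurable_add borel_measurable_times borel_measurable_uminus T_history)
qed

lemma measurable_v [measurable]: "v n \<in> borel_measurable M"
  unfolding v_def by measurable

lemma T_increment: "a \<le> b \<Longrightarrow> T b \<omega> - T a \<omega> = (\<Sum>i<b. (if a \<le> i then (-1) ^ i else 0) * m i \<omega>)"
proof (induction b rule: dec_induct)
  case base
  then show ?case by (auto intro!: sum.neutral)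
next
  case (step b)
  then show ?case by (simp add: T_def)
qed

lemma
  assumes "a \<le> b"
  shows integrable_T_increment_square: "integrable M (\<lambda>\<omega>. (T b \<omega> - T a \<omega>)\<^sup>2)"
    and T_increment_second_moment: "expectation (\<lambda>\<omega>. (T b \<omega> - T a \<omega>)\<^sup>2) = \<sigma>2 * (real b - real a)"
proof -
  show "integrable M (\<lambda>\<omega>. (T b \<omega> - T a \<omega>)\<^sup>2)"
    unfolding T_increment[OF assms] by (rule integrable_weighted_sum_square)
  have "(\<Sum>i<b. (if a \<le> i then (-1) ^ i else 0 :: real)\<^sup>2) = real b - real a"
    using assms
  proof (induction b rule: dec_induct)
    case base
    then show ?case by (auto intro!: sum.neutral)
  next
    case (step b)
    then show ?case by (simp add: power_even_eq[symmetric] power_mult[symmetric])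
  qed
  then show "expectation (\<lambda>\<omega>. (T b \<omega> - T a \<omega>)\<^sup>2) = \<sigma>2 * (real b - real a)"
    unfolding T_increment[OF assms] weighted_sum_second_moment by simp
qed

lemma integrable_T_square: "integrable M (\<lambda>\<omega>. (T n \<omega>)\<^sup>2)"
  using integrable_T_increment_square[of 0 n] by (simp add: T_def)

lemma T_second_moment: "expectation (\<lambda>\<omega>. (T n \<omega>)\<^sup>2) = \<sigma>2 * real n"
  using T_increment_second_moment[of 0 n] by (simp add: T_def)

lemma expectation_abs_T: "expectation (\<lambda>\<omega>. \<bar>T n \<omega>\<bar>) \<le> sqrt (\<sigma>2 * real n)"
  using integrable_T_square \<sigma>2_nonneg by (intro expectation_abs_le_sqrt_moment) (auto simp: T_second_moment)

text \<open>
  The second moment of an innovation; it serves as a common constant in the moment bounds.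
\<close>

abbreviation e_square_mean :: real where "e_square_mean \<equiv> \<mu>\<^sup>2 + \<sigma>2"

lemma e_square_mean_nonneg: "0 \<le> e_square_mean" using \<sigma>2_nonneg by simp

lemma centred_z_moment:
  defines "N \<equiv> \<lambda>n \<omega>. z n \<omega> - \<mu> * real (n div 2)"
  shows "integrable M (\<lambda>\<omega>. (N n \<omega>)\<^sup>2)" "expectation (\<lambda>\<omega>. (N n \<omega>)\<^sup>2) \<le> \<sigma>2 * real n" "expectation (N n) = 0"
proof -
  have N: "N n \<omega> = (\<Sum>i<n. (if even (n + i) then 1 else 0) * m i \<omega>)" for \<omega>
    unfolding N_def by (simp add: z_eq)
  show "integrable M (\<lambda>\<omega>. (N n \<omega>)\<^sup>2)"
    unfolding N by (rule integrable_weighted_sum_square)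
  have "(\<Sum>i<n. (if even (n + i) then 1 else 0 :: real)\<^sup>2) \<le> (\<Sum>i<n. 1)"
    by (intro sum_mono) auto
  then show "expectation (\<lambda>\<omega>. (N n \<omega>)\<^sup>2) \<le> \<sigma>2 * real n"
    unfolding N weighted_sum_second_moment using \<sigma>2_nonneg by (intro mult_left_mono) auto
  show "expectation (N n) = 0"
    unfolding N using integrable_m by (simp add: Bochner_Integration.integral_sum m_mean)
qed

lemma
  shows integrable_z_square: "integrable M (\<lambda>\<omega>. (z n \<omega>)\<^sup>2)"
    and z_second_moment: "expectation (\<lambda>\<omega>. (z n \<omega>)\<^sup>2) \<le> e_square_mean * (real n)\<^sup>2"
proof -
  let ?N = "\<lambda>\<omega>. z n \<omega> - \<mu> * real (n div 2)"
  have int: "integrable M ?N" by (rule square_integrable_imp_integrable) (auto intro: centred_z_moment)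
  have eq: "(z n \<omega>)\<^sup>2 = (?N \<omega>)\<^sup>2 + (2 * \<mu> * real (n div 2) * ?N \<omega> + (\<mu> * real (n div 2))\<^sup>2)" for \<omega>
    by (simp add: power2_eq_square algebra_simps)
  show "integrable M (\<lambda>\<omega>. (z n \<omega>)\<^sup>2)"
    unfolding eq using int by (intro Bochner_Integration.integrable_add centred_z_moment integrable_mult_right integrable_const)
  have "expectation (\<lambda>\<omega>. (z n \<omega>)\<^sup>2) = expectation (\<lambda>\<omega>. (?N \<omega>)\<^sup>2) + (2 * \<mu> * real (n div 2) * expectation ?N + (\<mu> * real (n div 2))\<^sup>2)"
    unfolding eq by (subst Bochner_Integration.integral_add; (intro Bochner_Integration.integrable_add centred_z_moment integrable_mult_right integrable_const int)?)
      (subst Bochner_Integration.integral_add; (intro integrable_mult_right integrable_const int)?; simp add: prob_space)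
  also have "\<dots> \<le> \<sigma>2 * real n + (\<mu> * real (n div 2))\<^sup>2"
    using centred_z_moment(2,3)[of n] by simp
  also have "\<dots> \<le> \<sigma>2 * (real n)\<^sup>2 + (\<mu> * real n)\<^sup>2"
  proof (intro add_mono mult_left_mono \<sigma>2_nonneg)
    show "real n \<le> (real n)\<^sup>2" by (cases n) (auto simp: power2_eq_square)
    have "real (n div 2) \<le> real n" by simp
    then show "(\<mu> * real (n div 2))\<^sup>2 \<le> (\<mu> * real n)\<^sup>2"
      unfolding power_mult_distrib by (intro mult_left_mono power_mono) auto
  qed
  finally show "expectation (\<lambda>\<omega>. (z n \<omega>)\<^sup>2) \<le> e_square_mean * (real n)\<^sup>2" by (simp add: power_mult_distrib algebra_simps)
qed

lemma
  shows integrable_v_square: "integrable M (\<lambda>\<omega>. (v n \<omega>)\<^sup>2)"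
    and v_second_moment: "expectation (\<lambda>\<omega>. (v n \<omega>)\<^sup>2) \<le> 2 * e_square_mean * (real n + 1)"
proof -
  have b: "(v n \<omega>)\<^sup>2 \<le> 2 * (T n \<omega>)\<^sup>2 + 2 * \<mu>\<^sup>2" for \<omega>
  proof -
    have "(s * x + y)\<^sup>2 \<le> 2 * x\<^sup>2 + 2 * y\<^sup>2" if "s = 1 \<or> s = -1" for s x y :: real
      using that zero_le_power2[of "x - y"] zero_le_power2[of "x + y"]
      by (auto simp: power2_eq_square algebra_simps)
    from this[of "(-1) ^ Suc n" "T n \<omega>" "if odd n then \<mu> else 0"]
    have "(v n \<omega>)\<^sup>2 \<le> 2 * (T n \<omega>)\<^sup>2 + 2 * (if odd n then \<mu> else 0)\<^sup>2"
      unfolding v_eq by (cases "even n") auto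
    also have "(if odd n then \<mu> else 0)\<^sup>2 \<le> \<mu>\<^sup>2" by simp
    finally show ?thesis by simp
  qed
  show int: "integrable M (\<lambda>\<omega>. (v n \<omega>)\<^sup>2)"
    by (rule Bochner_Integration.integrable_bound[where f = "\<lambda>\<omega>. 2 * (T n \<omega>)\<^sup>2 + 2 * \<mu>\<^sup>2"])
      (use b integrable_T_square in auto)
  have "expectation (\<lambda>\<omega>. (v n \<omega>)\<^sup>2) \<le> expectation (\<lambda>\<omega>. 2 * (T n \<omega>)\<^sup>2 + 2 * \<mu>\<^sup>2)"
    using int integrable_T_square b by (intro integral_mono) auto
  also have "\<dots> = 2 * (\<sigma>2 * real n) + 2 * \<mu>\<^sup>2"
    using integrable_T_square by (simp add: T_second_moment prob_space)
  also have "\<dots> \<le> 2 * e_square_mean * (real n + 1)"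
    using \<sigma>2_nonneg by (simp add: algebra_simps)
  finally show "expectation (\<lambda>\<omega>. (v n \<omega>)\<^sup>2) \<le> 2 * e_square_mean * (real n + 1)" .
qed

section \<open>Size of the statistics\<close>

lemma expectation_abs_sum_le:
  assumes "\<And>i. i < n \<Longrightarrow> integrable M (Y i)" "\<And>i. i < n \<Longrightarrow> expectation (\<lambda>\<omega>. \<bar>Y i \<omega>\<bar>) \<le> B"
  shows "expectation (\<lambda>\<omega>. \<bar>\<Sum>i<n. Y i \<omega> :: real\<bar>) \<le> real n * B"
proof -
  have "expectation (\<lambda>\<omega>. \<bar>\<Sum>i<n. Y i \<omega>\<bar>) \<le> expectation (\<lambda>\<omega>. \<Sum>i<n. \<bar>Y i \<omega>\<bar>)"
    using assms(1) by (intro integral_mono integrable_abs Bochner_Integration.integrable_sum sum_abs) auto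
  also have "\<dots> = (\<Sum>i<n. expectation (\<lambda>\<omega>. \<bar>Y i \<omega>\<bar>))"
    using assms(1) by (intro Bochner_Integration.integral_sum integrable_abs) auto
  also have "\<dots> \<le> (\<Sum>i<n. B)" using assms(2) by (intro sum_mono) auto
  finally show ?thesis by simp
qed

lemma vanishes_in_probI_rate:
  assumes int: "\<And>n. integrable M (Y n)" and b: "\<And>n. 0 < n \<Longrightarrow> expectation (\<lambda>\<omega>. \<bar>Y n \<omega>\<bar>) \<le> K / sqrt (real n)"
  shows "vanishes_in_prob M Y"
proof (rule vanishes_in_probI_L1[OF int])
  show "\<forall>\<^sub>F n in sequentially. expectation (\<lambda>\<omega>. \<bar>Y n \<omega>\<bar>) \<le> K / sqrt (real n)"
    using eventually_gt_at_top[of 0] by eventually_elim (rule b)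
  show "(\<lambda>n. K / sqrt (real n)) \<longlonglongrightarrow> 0"
    by (intro real_tendsto_divide_at_top[OF tendsto_const] filterlim_compose[OF sqrt_at_top] filterlim_real_sequentially)
qed

lemma
  fixes K :: real
  assumes "0 < n"
  shows rate_linear: "K * sqrt (real n) / real n = K / sqrt (real n)"
    and rate_square: "real n * (K * sqrt (real n)) / (real n)\<^sup>2 = K / sqrt (real n)"
    and rate_cube: "real n * (K * (sqrt (real n) * real n)) / real n ^ 3 = K / sqrt (real n)"
proof -
  define s where "s = sqrt (real n)"
  have "0 < s" "real n = s * s" using assms by (simp_all add: s_def)
  then show "K * sqrt (real n) / real n = K / sqrt (real n)"
    "real n * (K * sqrt (real n)) / (real n)\<^sup>2 = K / sqrt (real n)"
    "real n * (K * (sqrt (real n) * real n)) / real n ^ 3 = K / sqrt (real n)"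
    unfolding s_def[symmetric] by (simp_all add: field_simps power2_eq_square power3_eq_cube)
qed

lemma integrable_square_imp_integrable:
  "Y \<in> borel_measurable M \<Longrightarrow> integrable M (\<lambda>\<omega>. (Y \<omega>)\<^sup>2) \<Longrightarrow> integrable M (Y :: 'a \<Rightarrow> real)"
  by (rule square_integrable_imp_integrable)

text \<open>
  The process grows like \<open>\<mu> * i / 2\<close> with fluctuations of order \<open>sqrt i\<close>; the difference of the squares
  factors into the fluctuation and a term of order \<open>i\<close>.
\<close>

lemma z_square_deviation:
  shows "integrable M (\<lambda>\<omega>. (z i \<omega>)\<^sup>2 - (\<mu> * real i / 2)\<^sup>2)"
    and "i < n \<Longrightarrow> expectation (\<lambda>\<omega>. \<bar>(z i \<omega>)\<^sup>2 - (\<mu> * real i / 2)\<^sup>2\<bar>) \<le> 3 * e_square_mean * (sqrt (real n) * real n)"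
proof -
  let ?N = "\<lambda>\<omega>. z i \<omega> - \<mu> * real (i div 2)"
  define y where "y = \<mu> * real i / 2"
  \<comment> \<open>The rounding error of the drift.\<close>
  define c where "c = \<mu> * (real (i div 2) - real i / 2)"
  note N2 = centred_z_moment(1,2)[of i]
  show "integrable M (\<lambda>\<omega>. (z i \<omega>)\<^sup>2 - (\<mu> * real i / 2)\<^sup>2)"
    using integrable_z_square by simp
  have sq: "(a + b)\<^sup>2 \<le> 2 * a\<^sup>2 + 2 * b\<^sup>2" for a b :: real
    using zero_le_power2[of "a - b"] by (simp add: power2_eq_square algebra_simps)
  have c: "c\<^sup>2 \<le> \<mu>\<^sup>2"
  proof -
    have "\<bar>real (i div 2) - real i / 2\<bar> \<le> 1" by (cases "even i") (auto elim!: evenE oddE)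
    then have "(real (i div 2) - real i / 2)\<^sup>2 \<le> 1" by (simp add: abs_square_le_1)
    then show ?thesis unfolding c_def power_mult_distrib by (simp add: mult_left_le)
  qed
  have minus_le: "(z i \<omega> - y)\<^sup>2 \<le> 2 * (?N \<omega>)\<^sup>2 + 2 * c\<^sup>2" for \<omega>
    using sq[of "?N \<omega>" c] by (simp add: c_def y_def algebra_simps)
  have plus_le: "(z i \<omega> + y)\<^sup>2 \<le> 2 * (z i \<omega>)\<^sup>2 + 2 * y\<^sup>2" for \<omega> by (rule sq)
  have int_minus: "integrable M (\<lambda>\<omega>. (z i \<omega> - y)\<^sup>2)" and int_plus: "integrable M (\<lambda>\<omega>. (z i \<omega> + y)\<^sup>2)"
    using integrable_square_add[of "z i" M "\<lambda>_. - y"] integrable_square_add[of "z i" M "\<lambda>_. y"] integrable_z_square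
    by simp_all
  have "expectation (\<lambda>\<omega>. (z i \<omega> - y)\<^sup>2) \<le> expectation (\<lambda>\<omega>. 2 * (?N \<omega>)\<^sup>2 + 2 * c\<^sup>2)"
    using int_minus N2(1) minus_le by (intro integral_mono) auto
  also have "\<dots> = 2 * expectation (\<lambda>\<omega>. (?N \<omega>)\<^sup>2) + 2 * c\<^sup>2" using N2(1) by (simp add: prob_space)
  also have "\<dots> \<le> 2 * (\<sigma>2 * real i) + 2 * \<mu>\<^sup>2" using N2(2) c by linarith
  also have "\<dots> \<le> 2 * e_square_mean * (real i + 1)" using \<sigma>2_nonneg by (simp add: algebra_simps)
  finally have E_minus: "expectation (\<lambda>\<omega>. (z i \<omega> - y)\<^sup>2) \<le> (sqrt (2 * e_square_mean * (real i + 1)))\<^sup>2"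
    using \<sigma>2_nonneg by simp
  have "expectation (\<lambda>\<omega>. (z i \<omega> + y)\<^sup>2) \<le> expectation (\<lambda>\<omega>. 2 * (z i \<omega>)\<^sup>2 + 2 * y\<^sup>2)"
    using int_plus integrable_z_square plus_le by (intro integral_mono) auto
  also have "\<dots> = 2 * expectation (\<lambda>\<omega>. (z i \<omega>)\<^sup>2) + 2 * y\<^sup>2" using integrable_z_square by (simp add: prob_space)
  also have "\<dots> \<le> 2 * (e_square_mean * (real i)\<^sup>2) + e_square_mean * (real i)\<^sup>2"
    using z_second_moment[of i] \<sigma>2_nonneg by (intro add_mono mult_left_mono) (auto simp: y_def power_mult_distrib power_divide algebra_simps)
  also have "\<dots> \<le> 3 * e_square_mean * (real i + 1)\<^sup>2"
  proof -
    have "e_square_mean * (real i)\<^sup>2 \<le> e_square_mean * (real i + 1)\<^sup>2" using \<sigma>2_nonneg by (intro mult_left_mono power_mono) auto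
    then show ?thesis by linarith
  qed
  finally have E_plus: "expectation (\<lambda>\<omega>. (z i \<omega> + y)\<^sup>2) \<le> (sqrt (3 * e_square_mean) * (real i + 1))\<^sup>2"
    using \<sigma>2_nonneg by (simp add: power_mult_distrib)
  assume i: "i < n"
  have "expectation (\<lambda>\<omega>. \<bar>(z i \<omega> - y) * (z i \<omega> + y)\<bar>) \<le> sqrt (2 * e_square_mean * (real i + 1)) * (sqrt (3 * e_square_mean) * (real i + 1))"
    using int_minus int_plus E_minus E_plus \<sigma>2_nonneg by (intro expectation_abs_mult_le) auto
  also have "\<dots> = sqrt 6 * e_square_mean * (sqrt (real i + 1) * (real i + 1))"
  proof -
    have "sqrt (2 * K * p) * (sqrt (3 * K) * p) = sqrt 6 * K * (sqrt p * p)" if "0 \<le> K" for K p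
    proof -
      have "sqrt 6 = sqrt 2 * sqrt 3" by (simp flip: real_sqrt_mult)
      moreover have "K = sqrt K * sqrt K" using that by simp
      ultimately have "sqrt 6 * K * (sqrt p * p) = sqrt 2 * sqrt 3 * (sqrt K * sqrt K) * (sqrt p * p)" by simp
      then show ?thesis by (simp only: real_sqrt_mult mult_ac)
    qed
    from this[OF e_square_mean_nonneg] show ?thesis .
  qed
  also have "\<dots> \<le> 3 * e_square_mean * (sqrt (real n) * real n)"
  proof (intro mult_mono)
    show "sqrt 6 \<le> 3" by (rule real_le_lsqrt) auto
  qed (use i \<sigma>2_nonneg in auto)
  finally show "expectation (\<lambda>\<omega>. \<bar>(z i \<omega>)\<^sup>2 - (\<mu> * real i / 2)\<^sup>2\<bar>) \<le> 3 * e_square_mean * (sqrt (real n) * real n)"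
  proof -
    have "(z i \<omega> - y) * (z i \<omega> + y) = (z i \<omega>)\<^sup>2 - (\<mu> * real i / 2)\<^sup>2" for \<omega>
      by (simp add: y_def power2_eq_square algebra_simps)
    moreover assume "expectation (\<lambda>\<omega>. \<bar>(z i \<omega> - y) * (z i \<omega> + y)\<bar>) \<le> 3 * e_square_mean * (sqrt (real n) * real n)"
    ultimately show ?thesis by (simp only:)
  qed
qed

lemma sum_z_square_limit: "vanishes_in_prob M (\<lambda>n \<omega>. (\<Sum>i<n. (z i \<omega>)\<^sup>2) / real n ^ 3 - \<mu>\<^sup>2 / 12)"
proof -
  define d where "d n = (\<Sum>i<n. (\<mu> * real i / 2)\<^sup>2) / real n ^ 3 - \<mu>\<^sup>2 / 12" for n
  have 1: "vanishes_in_prob M (\<lambda>n \<omega>. (\<Sum>i<n. (z i \<omega>)\<^sup>2 - (\<mu> * real i / 2)\<^sup>2) / real n ^ 3)"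
  proof (rule vanishes_in_probI_rate)
    show "integrable M (\<lambda>\<omega>. (\<Sum>i<n. (z i \<omega>)\<^sup>2 - (\<mu> * real i / 2)\<^sup>2) / real n ^ 3)" for n
      by (intro integrable_divide Bochner_Integration.integrable_sum z_square_deviation)
    fix n :: nat assume n: "0 < n"
    have "expectation (\<lambda>\<omega>. \<bar>(\<Sum>i<n. (z i \<omega>)\<^sup>2 - (\<mu> * real i / 2)\<^sup>2) / real n ^ 3\<bar>) =
        expectation (\<lambda>\<omega>. \<bar>\<Sum>i<n. (z i \<omega>)\<^sup>2 - (\<mu> * real i / 2)\<^sup>2\<bar>) / real n ^ 3" by simp
    also have "\<dots> \<le> real n * (3 * e_square_mean * (sqrt (real n) * real n)) / real n ^ 3"
      by (intro divide_right_mono expectation_abs_sum_le z_square_deviation) auto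
    also have "\<dots> = 3 * e_square_mean / sqrt (real n)" by (rule rate_cube[OF n])
    finally show "expectation (\<lambda>\<omega>. \<bar>(\<Sum>i<n. (z i \<omega>)\<^sup>2 - (\<mu> * real i / 2)\<^sup>2) / real n ^ 3\<bar>) \<le> 3 * e_square_mean / sqrt (real n)" .
  qed
  have 2: "vanishes_in_prob M (\<lambda>n \<omega>. d n)"
  proof (rule vanishes_in_probI_L1)
    have sq: "(\<Sum>i<n. (real i)\<^sup>2) = real n * (real n - 1) * (2 * real n - 1) / 6" for n
      by (induction n) (auto simp: power2_eq_square field_simps)
    have "d n = \<mu>\<^sup>2 / 4 * (real n * (real n - 1) * (2 * real n - 1) / 6) / real n ^ 3 - \<mu>\<^sup>2 / 12" for n
      unfolding d_def sq[symmetric] by (simp add: power_mult_distrib power_divide sum_distrib_left)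
    moreover have "(\<lambda>n. \<mu>\<^sup>2 / 4 * (real n * (real n - 1) * (2 * real n - 1) / 6) / real n ^ 3 - \<mu>\<^sup>2 / 12) \<longlonglongrightarrow> 0"
    proof -
      have "(\<lambda>n. (real n * (real n - 1) * (2 * real n - 1) / 6) / real n ^ 3) \<longlonglongrightarrow> 1 / 3" by real_asymp
      from tendsto_diff[OF tendsto_mult_left[OF this, of "\<mu>\<^sup>2 / 4"] tendsto_const[of "\<mu>\<^sup>2 / 12"]]
      show ?thesis by simp
    qed
    ultimately have "d \<longlonglongrightarrow> 0" by presburger
    then show "(\<lambda>n. \<bar>d n\<bar>) \<longlonglongrightarrow> 0" by (simp add: tendsto_rabs_zero)
  qed (simp_all add: prob_space)
  have eq: "(\<Sum>i<n. (z i \<omega>)\<^sup>2) / real n ^ 3 - \<mu>\<^sup>2 / 12 =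
      (\<Sum>i<n. (z i \<omega>)\<^sup>2 - (\<mu> * real i / 2)\<^sup>2) / real n ^ 3 + d n" for n \<omega>
    by (simp add: d_def sum_subtractf diff_divide_distrib)
  show ?thesis unfolding eq by (intro vanishes_in_prob_add 1 2) measurable
qed

lemma sum_v_square_limit: "vanishes_in_prob M (\<lambda>n \<omega>. (\<Sum>i<n. (v i \<omega>)\<^sup>2) / (real n)\<^sup>2 - (\<Sum>i<n. (T i \<omega>)\<^sup>2) / (real n)\<^sup>2)"
proof -
  define K where "K = 2 * \<bar>\<mu>\<bar> * sqrt \<sigma>2 + \<mu>\<^sup>2"
  have int_T: "integrable M (T i)" for i
    by (rule integrable_square_imp_integrable[OF measurable_T integrable_T_square])
  have b: "\<bar>(v i \<omega>)\<^sup>2 - (T i \<omega>)\<^sup>2\<bar> \<le> 2 * \<bar>\<mu>\<bar> * \<bar>T i \<omega>\<bar> + \<mu>\<^sup>2" for i \<omega>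
  proof (cases "even i")
    case False
    then have "(v i \<omega>)\<^sup>2 - (T i \<omega>)\<^sup>2 = 2 * \<mu> * T i \<omega> + \<mu>\<^sup>2"
      by (simp add: v_eq power2_eq_square algebra_simps)
    moreover have "\<bar>2 * \<mu> * T i \<omega> + \<mu>\<^sup>2\<bar> \<le> \<bar>2 * \<mu> * T i \<omega>\<bar> + \<bar>\<mu>\<^sup>2\<bar>" by (rule abs_triangle_ineq)
    ultimately show ?thesis by (simp only: abs_mult abs_numeral abs_power2)
  next
    case True
    then have "(v i \<omega>)\<^sup>2 = (T i \<omega>)\<^sup>2" by (simp add: v_eq)
    then show ?thesis by simp
  qed
  show ?thesis
  proof (rule vanishes_in_probI_rate)
    show "integrable M (\<lambda>\<omega>. (\<Sum>i<n. (v i \<omega>)\<^sup>2) / (real n)\<^sup>2 - (\<Sum>i<n. (T i \<omega>)\<^sup>2) / (real n)\<^sup>2)" for n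
      by (intro Bochner_Integration.integrable_diff integrable_divide Bochner_Integration.integrable_sum integrable_v_square integrable_T_square)
    fix n :: nat assume n: "0 < n"
    have "expectation (\<lambda>\<omega>. \<bar>(\<Sum>i<n. (v i \<omega>)\<^sup>2) / (real n)\<^sup>2 - (\<Sum>i<n. (T i \<omega>)\<^sup>2) / (real n)\<^sup>2\<bar>) =
        expectation (\<lambda>\<omega>. \<bar>\<Sum>i<n. (v i \<omega>)\<^sup>2 - (T i \<omega>)\<^sup>2\<bar>) / (real n)\<^sup>2"
      by (simp add: sum_subtractf diff_divide_distrib[symmetric])
    also have "\<dots> \<le> real n * (K * sqrt (real n)) / (real n)\<^sup>2"
    proof (intro divide_right_mono expectation_abs_sum_le)
      fix i assume i: "i < n"
      show "integrable M (\<lambda>\<omega>. (v i \<omega>)\<^sup>2 - (T i \<omega>)\<^sup>2)" using integrable_v_square integrable_T_square by simp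
      have "expectation (\<lambda>\<omega>. \<bar>(v i \<omega>)\<^sup>2 - (T i \<omega>)\<^sup>2\<bar>) \<le> expectation (\<lambda>\<omega>. 2 * \<bar>\<mu>\<bar> * \<bar>T i \<omega>\<bar> + \<mu>\<^sup>2)"
        using integrable_v_square integrable_T_square int_T b
        by (intro integral_mono integrable_abs Bochner_Integration.integrable_add integrable_mult_right Bochner_Integration.integrable_diff) auto
      also have "\<dots> = 2 * \<bar>\<mu>\<bar> * expectation (\<lambda>\<omega>. \<bar>T i \<omega>\<bar>) + \<mu>\<^sup>2" using int_T by (simp add: prob_space)
      also have "\<dots> \<le> 2 * \<bar>\<mu>\<bar> * (sqrt \<sigma>2 * sqrt (real n)) + \<mu>\<^sup>2 * sqrt (real n)"
      proof (intro add_mono mult_left_mono)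
        have "sqrt (\<sigma>2 * real i) \<le> sqrt \<sigma>2 * sqrt (real n)"
          using i \<sigma>2_nonneg by (simp add: real_sqrt_mult mult_left_mono)
        then show "expectation (\<lambda>\<omega>. \<bar>T i \<omega>\<bar>) \<le> sqrt \<sigma>2 * sqrt (real n)" using expectation_abs_T[of i] by linarith
        show "\<mu>\<^sup>2 \<le> \<mu>\<^sup>2 * sqrt (real n)" using n by (simp add: mult_le_cancel_left1)
      qed auto
      finally show "expectation (\<lambda>\<omega>. \<bar>(v i \<omega>)\<^sup>2 - (T i \<omega>)\<^sup>2\<bar>) \<le> K * sqrt (real n)" by (simp add: K_def algebra_simps)
    qed simp
    also have "\<dots> = K / sqrt (real n)" by (rule rate_square[OF n])
    finally show "expectation (\<lambda>\<omega>. \<bar>(\<Sum>i<n. (v i \<omega>)\<^sup>2) / (real n)\<^sup>2 - (\<Sum>i<n. (T i \<omega>)\<^sup>2) / (real n)\<^sup>2\<bar>) \<le> K / sqrt (real n)" .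
  qed
qed

text \<open>
  Summation by parts: up to the drift correction, \<open>\<Sum> v * m\<close> is \<open>- \<Sum> T dT\<close>, which equals half of
  \<open>\<Sum> (dT)\<^sup>2 - T\<^sub>n\<^sup>2\<close>. This is where the numerator \<open>(W\<^sub>1\<^sup>2 - 1) / 2\<close> comes from.
\<close>

lemma sum_v_m: "(\<Sum>i<n. v i \<omega> * m i \<omega>) = ((\<Sum>i<n. (m i \<omega>)\<^sup>2) - (T n \<omega>)\<^sup>2) / 2 + \<mu> * (\<Sum>i<n. (if odd i then 1 else 0) * m i \<omega>)"
proof (induction n)
  case (Suc n)
  have "(T (Suc n) \<omega>)\<^sup>2 = (T n \<omega>)\<^sup>2 + 2 * (-1) ^ n * T n \<omega> * m n \<omega> + (m n \<omega>)\<^sup>2"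
    by (cases "even n") (simp_all add: T_def power2_eq_square algebra_simps)
  then show ?case using Suc by (cases "even n") (simp_all add: v_eq field_simps)
qed (simp add: T_def)

lemma sum_v_m_limit: "vanishes_in_prob M (\<lambda>n \<omega>. (\<Sum>i<n. v i \<omega> * m i \<omega>) / real n + ((T n \<omega>)\<^sup>2 / real n - \<sigma>2) / 2)"
proof -
  have 1: "vanishes_in_prob M (\<lambda>n \<omega>. (\<Sum>i<n. (m i \<omega>)\<^sup>2) / real n - \<sigma>2)"
    by (rule vanishes_in_probI_L1[OF _ _ mean_square_convergence])
      (auto intro!: Bochner_Integration.integrable_sum Bochner_Integration.integrable_diff integrable_divide integrable_m_square)
  have 2: "vanishes_in_prob M (\<lambda>n \<omega>. \<mu> * ((\<Sum>i<n. (if odd i then 1 else 0) * m i \<omega>) / real n))"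
  proof (rule vanishes_in_probI_rate)
    let ?S = "\<lambda>n \<omega>. \<Sum>i<n. (if odd i then 1 else 0) * m i \<omega>"
    have S: "integrable M (\<lambda>\<omega>. (?S n \<omega>)\<^sup>2)" for n by (rule integrable_weighted_sum_square)
    have intS: "integrable M (?S n)" for n 
      by (rule integrable_square_imp_integrable[OF _ S]) measurable
    show "integrable M (\<lambda>\<omega>. \<mu> * (?S n \<omega> / real n))" for n
      by (intro integrable_mult_right integrable_divide intS)
    fix n :: nat assume n: "0 < n"
    have "(\<Sum>i<n. (if odd i then 1 else 0 :: real)\<^sup>2) \<le> (\<Sum>i<n. 1)" by (intro sum_mono) auto
    then have "expectation (\<lambda>\<omega>. (?S n \<omega>)\<^sup>2) \<le> \<sigma>2 * real n"
      unfolding weighted_sum_second_moment using \<sigma>2_nonneg by (intro mult_left_mono) auto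
    then have "expectation (\<lambda>\<omega>. \<bar>?S n \<omega>\<bar>) \<le> sqrt (\<sigma>2 * real n)"
      using S \<sigma>2_nonneg by (intro expectation_abs_le_sqrt_moment) auto
    then have "\<bar>\<mu>\<bar> * (expectation (\<lambda>\<omega>. \<bar>?S n \<omega>\<bar>) / real n) \<le> \<bar>\<mu>\<bar> * (sqrt (\<sigma>2 * real n) / real n)"
      by (intro mult_left_mono divide_right_mono) auto
    also have "\<dots> = \<bar>\<mu>\<bar> * sqrt \<sigma>2 / sqrt (real n)"
      by (simp add: real_sqrt_mult rate_linear[OF n])
    finally show "expectation (\<lambda>\<omega>. \<bar>\<mu> * (?S n \<omega> / real n)\<bar>) \<le> \<bar>\<mu>\<bar> * sqrt \<sigma>2 / sqrt (real n)"
      by (simp add: abs_mult)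
  qed
  have eq: "(\<Sum>i<n. v i \<omega> * m i \<omega>) / real n + ((T n \<omega>)\<^sup>2 / real n - \<sigma>2) / 2 =
      ((\<Sum>i<n. (m i \<omega>)\<^sup>2) / real n - \<sigma>2) * (1 / 2) + \<mu> * ((\<Sum>i<n. (if odd i then 1 else 0) * m i \<omega>) / real n)" for n \<omega>
    unfolding sum_v_m by (simp add: add_divide_distrib diff_divide_distrib)
  show ?thesis unfolding eq by (intro vanishes_in_prob_add vanishes_in_prob_cmult 1 2) measurable
qed

text \<open>
  The oscillation of \<open>v\<close> makes consecutive products nearly cancel: since \<open>v (i + 1) + v i = e i\<close>,
  adding the products with indices \<open>i\<close> and \<open>i + 1\<close> leaves only \<open>z (i + 1) * e i - (v i)\<^sup>2\<close>.
\<close>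

lemma two_sum_z_v: "2 * (\<Sum>i<n. z i \<omega> * v i \<omega>) = (\<Sum>i<n. z (Suc i) \<omega> * e i \<omega> - (v i \<omega>)\<^sup>2) - z n \<omega> * v n \<omega>"
proof (induction n)
  case (Suc n)
  have "z (Suc n) \<omega> * v (Suc n) \<omega> = z (Suc n) \<omega> * e n \<omega> - z (Suc n) \<omega> * v n \<omega>"
    by (simp add: v_Suc algebra_simps)
  moreover have "z (Suc n) \<omega> = v n \<omega> + z n \<omega>" by (simp add: v_def)
  ultimately show ?case using Suc by (simp add: power2_eq_square algebra_simps)
qed simp

text \<open>
  By the cancellation, \<open>\<Sum> z * v\<close> is of order \<open>n\<^sup>2\<close>, whereas the sizes of \<open>z\<close> and \<open>v\<close> alone would only give
  the order of the normalisation. The two regressors are thus asymptotically orthogonal.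
\<close>

lemma sum_z_v_vanishes: "vanishes_in_prob M (\<lambda>n \<omega>. (\<Sum>i<n. z i \<omega> * v i \<omega>) / ((real n)\<^sup>2 * sqrt (real n)))"
proof (rule vanishes_in_probI_rate)
  have zv: "integrable M (\<lambda>\<omega>. z i \<omega> * v i \<omega>)" for i
    by (intro integrable_mult_square_integrable integrable_z_square integrable_v_square) simp_all
  have ze: "integrable M (\<lambda>\<omega>. z (Suc i) \<omega> * e i \<omega>)" for i
    by (intro integrable_mult_square_integrable integrable_z_square integrable_e_square) simp_all
  show "integrable M (\<lambda>\<omega>. (\<Sum>i<n. z i \<omega> * v i \<omega>) / ((real n)\<^sup>2 * sqrt (real n)))" for n
    by (intro integrable_divide Bochner_Integration.integrable_sum zv)
  fix n :: nat assume n: "0 < n"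
  have z_norm: "expectation (\<lambda>\<omega>. (z i \<omega>)\<^sup>2) \<le> (sqrt e_square_mean * real i)\<^sup>2" for i
    using z_second_moment[of i] \<sigma>2_nonneg by (simp add: power_mult_distrib)
  have 1: "expectation (\<lambda>\<omega>. \<bar>z (Suc i) \<omega> * e i \<omega> - (v i \<omega>)\<^sup>2\<bar>) \<le> 3 * e_square_mean * real n" if i: "i < n" for i
  proof -
    have "expectation (\<lambda>\<omega>. \<bar>z (Suc i) \<omega> * e i \<omega>\<bar>) \<le> (sqrt e_square_mean * real (Suc i)) * sqrt e_square_mean"
      using z_norm[of "Suc i"] \<sigma>2_nonneg e_second_moment[of i]
      by (intro expectation_abs_mult_le integrable_z_square integrable_e_square) auto
    also have "\<dots> = e_square_mean * real (Suc i)" using \<sigma>2_nonneg by (simp add: mult.commute mult.left_commute)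
    also have "\<dots> \<le> e_square_mean * real n" using i \<sigma>2_nonneg by (intro mult_left_mono) auto
    finally have ze_le: "expectation (\<lambda>\<omega>. \<bar>z (Suc i) \<omega> * e i \<omega>\<bar>) \<le> e_square_mean * real n" .
    have "2 * e_square_mean * (real i + 1) \<le> 2 * e_square_mean * real n" using i \<sigma>2_nonneg by (intro mult_left_mono) auto
    then have v_le: "expectation (\<lambda>\<omega>. (v i \<omega>)\<^sup>2) \<le> 2 * e_square_mean * real n" using v_second_moment[of i] by linarith
    have "expectation (\<lambda>\<omega>. \<bar>z (Suc i) \<omega> * e i \<omega> - (v i \<omega>)\<^sup>2\<bar>) \<le> expectation (\<lambda>\<omega>. \<bar>z (Suc i) \<omega> * e i \<omega>\<bar> + (v i \<omega>)\<^sup>2)"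
    proof (rule integral_mono)
      show "\<bar>z (Suc i) \<omega> * e i \<omega> - (v i \<omega>)\<^sup>2\<bar> \<le> \<bar>z (Suc i) \<omega> * e i \<omega>\<bar> + (v i \<omega>)\<^sup>2" for \<omega>
        using abs_triangle_ineq4[of "z (Suc i) \<omega> * e i \<omega>" "(v i \<omega>)\<^sup>2"] by (simp only: abs_power2)
    qed (intro integrable_abs Bochner_Integration.integrable_diff Bochner_Integration.integrable_add ze integrable_v_square)+
    also have "\<dots> = expectation (\<lambda>\<omega>. \<bar>z (Suc i) \<omega> * e i \<omega>\<bar>) + expectation (\<lambda>\<omega>. (v i \<omega>)\<^sup>2)"
      by (intro Bochner_Integration.integral_add integrable_abs ze integrable_v_square)
    finally show ?thesis using ze_le v_le by linarith
  qed
  have int1: "integrable M (\<lambda>\<omega>. \<Sum>i<n. z (Suc i) \<omega> * e i \<omega> - (v i \<omega>)\<^sup>2)"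
    by (intro Bochner_Integration.integrable_sum Bochner_Integration.integrable_diff ze integrable_v_square)
  have S1: "expectation (\<lambda>\<omega>. \<bar>\<Sum>i<n. z (Suc i) \<omega> * e i \<omega> - (v i \<omega>)\<^sup>2\<bar>) \<le> real n * (3 * e_square_mean * real n)"
    by (intro expectation_abs_sum_le 1 Bochner_Integration.integrable_diff ze integrable_v_square)
  have S2: "expectation (\<lambda>\<omega>. \<bar>z n \<omega> * v n \<omega>\<bar>) \<le> (sqrt e_square_mean * real n) * (sqrt e_square_mean * (2 * real n))"
  proof (intro expectation_abs_mult_le integrable_z_square integrable_v_square z_norm)
    have "2 * (real n + 1) \<le> (2 * real n)\<^sup>2"
    proof -
      have "1 * 1 \<le> real n * real n" using n by (intro mult_mono) auto
      moreover have "1 * real n \<le> real n * real n" using n by (intro mult_right_mono) auto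
      ultimately show ?thesis by (simp add: power2_eq_square)
    qed
    then have "e_square_mean * (2 * (real n + 1)) \<le> e_square_mean * (2 * real n)\<^sup>2" using \<sigma>2_nonneg by (intro mult_left_mono) auto
    moreover have "2 * e_square_mean * (real n + 1) = e_square_mean * (2 * (real n + 1))" by (simp only: mult_ac)
    ultimately have "expectation (\<lambda>\<omega>. (v n \<omega>)\<^sup>2) \<le> e_square_mean * (2 * real n)\<^sup>2" using v_second_moment[of n] by linarith
    then show "expectation (\<lambda>\<omega>. (v n \<omega>)\<^sup>2) \<le> (sqrt e_square_mean * (2 * real n))\<^sup>2"
      using \<sigma>2_nonneg by (simp add: power_mult_distrib)
  qed (use \<sigma>2_nonneg in auto)
  have "2 * expectation (\<lambda>\<omega>. \<bar>\<Sum>i<n. z i \<omega> * v i \<omega>\<bar>) = expectation (\<lambda>\<omega>. \<bar>2 * (\<Sum>i<n. z i \<omega> * v i \<omega>)\<bar>)"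
    by (simp add: abs_mult)
  also have "\<dots> \<le> expectation (\<lambda>\<omega>. \<bar>\<Sum>i<n. z (Suc i) \<omega> * e i \<omega> - (v i \<omega>)\<^sup>2\<bar> + \<bar>z n \<omega> * v n \<omega>\<bar>)"
    unfolding two_sum_z_v
    by (intro integral_mono integrable_abs Bochner_Integration.integrable_diff Bochner_Integration.integrable_add int1 zv abs_triangle_ineq4)
  also have "\<dots> = expectation (\<lambda>\<omega>. \<bar>\<Sum>i<n. z (Suc i) \<omega> * e i \<omega> - (v i \<omega>)\<^sup>2\<bar>) + expectation (\<lambda>\<omega>. \<bar>z n \<omega> * v n \<omega>\<bar>)"
    by (intro Bochner_Integration.integral_add integrable_abs int1 zv)
  also have "\<dots> \<le> real n * (3 * e_square_mean * real n) + (sqrt e_square_mean * real n) * (sqrt e_square_mean * (2 * real n))"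
    by (rule add_mono[OF S1 S2])
  also have "\<dots> = 5 * e_square_mean * (real n)\<^sup>2"
    using \<sigma>2_nonneg by (simp add: power2_eq_square algebra_simps flip: real_sqrt_mult) 
  finally have le: "expectation (\<lambda>\<omega>. \<bar>\<Sum>i<n. z i \<omega> * v i \<omega>\<bar>) \<le> 5 / 2 * e_square_mean * (real n)\<^sup>2" by simp
  have "expectation (\<lambda>\<omega>. \<bar>(\<Sum>i<n. z i \<omega> * v i \<omega>) / ((real n)\<^sup>2 * sqrt (real n))\<bar>) =
      expectation (\<lambda>\<omega>. \<bar>\<Sum>i<n. z i \<omega> * v i \<omega>\<bar>) / ((real n)\<^sup>2 * sqrt (real n))"
    by (simp add: abs_mult)
  also have "\<dots> \<le> 5 / 2 * e_square_mean * (real n)\<^sup>2 / ((real n)\<^sup>2 * sqrt (real n))"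
    by (intro divide_right_mono le) auto
  also have "\<dots> = 5 / 2 * e_square_mean / sqrt (real n)" using n by simp
  finally show "expectation (\<lambda>\<omega>. \<bar>(\<Sum>i<n. z i \<omega> * v i \<omega>) / ((real n)\<^sup>2 * sqrt (real n))\<bar>) \<le> 5 / 2 * e_square_mean / sqrt (real n)" .
qed

lemma sum_z_m_bound:
  shows "integrable M (\<lambda>\<omega>. \<Sum>i<n. z i \<omega> * m i \<omega>)"
    and "expectation (\<lambda>\<omega>. \<bar>\<Sum>i<n. z i \<omega> * m i \<omega>\<bar>) \<le> e_square_mean * (real n * sqrt (real n))"
proof -
  have sq: "integrable M (\<lambda>\<omega>. (\<Sum>i<n. z i \<omega> * m i \<omega>)\<^sup>2)"
    by (intro integrable_martingale_square z_history integrable_z_square)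
  show "integrable M (\<lambda>\<omega>. \<Sum>i<n. z i \<omega> * m i \<omega>)"
    by (rule integrable_square_imp_integrable[OF _ sq]) measurable
  have "expectation (\<lambda>\<omega>. (\<Sum>i<n. z i \<omega> * m i \<omega>)\<^sup>2) = (\<Sum>i<n. \<sigma>2 * expectation (\<lambda>\<omega>. (z i \<omega>)\<^sup>2))"
    by (intro martingale_second_moment z_history integrable_z_square)
  also have "\<dots> \<le> (\<Sum>i<n. e_square_mean * (e_square_mean * (real n)\<^sup>2))"
  proof (intro sum_mono mult_mono)
    fix i assume "i \<in> {..<n}"
    then have "e_square_mean * (real i)\<^sup>2 \<le> e_square_mean * (real n)\<^sup>2" using \<sigma>2_nonneg by (intro mult_left_mono power_mono) auto
    then show "expectation (\<lambda>\<omega>. (z i \<omega>)\<^sup>2) \<le> e_square_mean * (real n)\<^sup>2" using z_second_moment[of i] by linarith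
  qed (use \<sigma>2_nonneg in auto)
  also have "\<dots> = (e_square_mean * (real n * sqrt (real n)))\<^sup>2"
    by (simp add: power_mult_distrib) (simp add: power2_eq_square)
  finally show "expectation (\<lambda>\<omega>. \<bar>\<Sum>i<n. z i \<omega> * m i \<omega>\<bar>) \<le> e_square_mean * (real n * sqrt (real n))"
    using sq \<sigma>2_nonneg by (intro expectation_abs_le_sqrt_moment) auto
qed

lemma sum_z_m_bounded: "bounded_in_prob M (\<lambda>n \<omega>. (\<Sum>i<n. z i \<omega> * m i \<omega>) / (real n * sqrt (real n)))"
proof (rule bounded_in_probI_L1)
  show "integrable M (\<lambda>\<omega>. (\<Sum>i<n. z i \<omega> * m i \<omega>) / (real n * sqrt (real n)))" for n
    using sum_z_m_bound(1) by simp
  show "\<forall>\<^sub>F n in sequentially. expectation (\<lambda>\<omega>. \<bar>(\<Sum>i<n. z i \<omega> * m i \<omega>) / (real n * sqrt (real n))\<bar>) \<le> e_square_mean"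
    using eventually_gt_at_top[of 0]
  proof eventually_elim
    case (elim n)
    then have "expectation (\<lambda>\<omega>. \<bar>\<Sum>i<n. z i \<omega> * m i \<omega>\<bar>) / (real n * sqrt (real n)) \<le> e_square_mean"
      using sum_z_m_bound(2)[of n] by (subst pos_divide_le_eq) auto
    then show ?case by (simp add: abs_mult)
  qed
qed

lemma sum_v_square_bounded: "bounded_in_prob M (\<lambda>n \<omega>. (\<Sum>i<n. (v i \<omega>)\<^sup>2) / (real n)\<^sup>2)"
proof (rule bounded_in_probI_L1)
  show "integrable M (\<lambda>\<omega>. (\<Sum>i<n. (v i \<omega>)\<^sup>2) / (real n)\<^sup>2)" for n
    by (intro integrable_divide Bochner_Integration.integrable_sum integrable_v_square)
  show "\<forall>\<^sub>F n in sequentially. expectation (\<lambda>\<omega>. \<bar>(\<Sum>i<n. (v i \<omega>)\<^sup>2) / (real n)\<^sup>2\<bar>) \<le> 2 * e_square_mean"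
    using eventually_gt_at_top[of 0]
  proof eventually_elim
    case (elim n)
    have "expectation (\<lambda>\<omega>. \<bar>\<Sum>i<n. (v i \<omega>)\<^sup>2\<bar>) \<le> real n * (2 * e_square_mean * real n)"
    proof (intro expectation_abs_sum_le integrable_v_square)
      fix i assume "i < n"
      then have "2 * e_square_mean * (real i + 1) \<le> 2 * e_square_mean * real n" using \<sigma>2_nonneg by (intro mult_left_mono) auto
      then show "expectation (\<lambda>\<omega>. \<bar>(v i \<omega>)\<^sup>2\<bar>) \<le> 2 * e_square_mean * real n" using v_second_moment[of i] by simp
    qed
    then have "expectation (\<lambda>\<omega>. \<bar>\<Sum>i<n. (v i \<omega>)\<^sup>2\<bar>) / (real n)\<^sup>2 \<le> 2 * e_square_mean"
      using elim by (subst pos_divide_le_eq) (auto simp: power2_eq_square algebra_simps)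
    then show ?case by simp
  qed
qed

lemma sum_v_m_bounded: "bounded_in_prob M (\<lambda>n \<omega>. (\<Sum>i<n. v i \<omega> * m i \<omega>) / real n)"
proof (rule bounded_in_probI_L1)
  have sq: "integrable M (\<lambda>\<omega>. (\<Sum>i<n. v i \<omega> * m i \<omega>)\<^sup>2)" for n
    by (intro integrable_martingale_square v_history integrable_v_square)
  show "integrable M (\<lambda>\<omega>. (\<Sum>i<n. v i \<omega> * m i \<omega>) / real n)" for n
    by (rule integrable_divide, rule integrable_square_imp_integrable[OF _ sq]) measurable
  show "\<forall>\<^sub>F n in sequentially. expectation (\<lambda>\<omega>. \<bar>(\<Sum>i<n. v i \<omega> * m i \<omega>) / real n\<bar>) \<le> 2 * e_square_mean"
    using eventually_gt_at_top[of 0]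
  proof eventually_elim
    case (elim n)
    have "expectation (\<lambda>\<omega>. (\<Sum>i<n. v i \<omega> * m i \<omega>)\<^sup>2) = (\<Sum>i<n. \<sigma>2 * expectation (\<lambda>\<omega>. (v i \<omega>)\<^sup>2))"
      by (intro martingale_second_moment v_history integrable_v_square)
    also have "\<dots> \<le> (\<Sum>i<n. 2 * e_square_mean * (2 * e_square_mean * real n))"
    proof (intro sum_mono mult_mono)
      fix i assume "i \<in> {..<n}"
      then have "2 * e_square_mean * (real i + 1) \<le> 2 * e_square_mean * real n" using \<sigma>2_nonneg by (intro mult_left_mono) auto
      then show "expectation (\<lambda>\<omega>. (v i \<omega>)\<^sup>2) \<le> 2 * e_square_mean * real n" using v_second_moment[of i] by linarith
    qed (use \<sigma>2_nonneg in auto)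
    also have "\<dots> = (2 * e_square_mean * real n)\<^sup>2" by (simp add: power2_eq_square)
    finally have "expectation (\<lambda>\<omega>. \<bar>\<Sum>i<n. v i \<omega> * m i \<omega>\<bar>) \<le> 2 * e_square_mean * real n"
      using sq \<sigma>2_nonneg by (intro expectation_abs_le_sqrt_moment) auto
    then have "expectation (\<lambda>\<omega>. \<bar>\<Sum>i<n. v i \<omega> * m i \<omega>\<bar>) / real n \<le> 2 * e_square_mean"
      using elim by (subst pos_divide_le_eq) auto
    then show ?case by simp
  qed
qed

end

section \<open>The limit of the walk functionals\<close>

lemma left_Riemann_sums_tendsto_integral:
  fixes f :: "real \<Rightarrow> real"
  assumes f: "continuous_on {0..1} f"
  shows "(\<lambda>m. (\<Sum>j<m. f (real j / real m)) / real m) \<longlonglongrightarrow> integral {0..1} f"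
proof (rule LIMSEQ_I)
  fix r :: real assume r: "0 < r"
  have "uniformly_continuous_on {0..1} f" by (intro compact_uniformly_continuous f) simp
  then obtain d where d: "0 < d" "\<And>x y. x \<in> {0..1} \<Longrightarrow> y \<in> {0..1} \<Longrightarrow> dist y x < d \<Longrightarrow> dist (f y) (f x) < r / 2"
    unfolding uniformly_continuous_on_def using r by (metis half_gt_zero)
  have "norm ((\<Sum>j<m. f (real j / real m)) / real m - integral {0..1} f) < r" if m: "nat \<lceil>1 / d\<rceil> < m" for m
  proof -
    have m0: "0 < m" "1 / d < real m" using m by linarith+
    then have md: "1 / real m < d" using d(1) by (simp add: field_simps)
    let ?t = "\<lambda>j. real j / real m"
    have t: "?t j \<le> ?t (Suc j)" "0 \<le> ?t j" for j by (auto simp: divide_right_mono)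
    have t1: "?t j \<le> 1" if "j \<le> m" for j using that m0 by simp
    have int: "f integrable_on {a..b}" if "0 \<le> a" "b \<le> 1" for a b
      by (rule integrable_continuous_interval) (rule continuous_on_subset[OF f], use that in auto)
    have split: "k \<le> m \<Longrightarrow> integral {0..?t k} f = (\<Sum>j<k. integral {?t j..?t (Suc j)} f)" for k
    proof (induction k)
      case (Suc k)
      have "integral {0..?t k} f + integral {?t k..?t (Suc k)} f = integral {0..?t (Suc k)} f"
        using Suc.prems t1[of "Suc k"] t[of k] by (intro Henstock_Kurzweil_Integration.integral_combine int) auto
      then show ?case using Suc by simp
    qed simp
    have piece: "\<bar>integral {?t j..?t (Suc j)} f - f (?t j) / real m\<bar> \<le> r / 2 / real m" if j: "j < m" for j
    proof -
      have sub: "{?t j..?t (Suc j)} \<subseteq> {0..1}" using t(2)[of j] t1[of "Suc j"] j by auto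
      have len: "?t (Suc j) - ?t j = 1 / real m" by (simp add: diff_divide_distrib[symmetric])
      have c: "continuous_on {?t j..?t (Suc j)} f" by (rule continuous_on_subset[OF f sub])
      have "integral {?t j..?t (Suc j)} (\<lambda>x. f x - f (?t j)) = integral {?t j..?t (Suc j)} f - f (?t j) * (1 / real m)"
        using t(1)[of j] len integrable_continuous_interval[OF c]
        by (subst Henstock_Kurzweil_Integration.integral_diff) (auto simp: mult.commute)
      moreover have "norm (integral {?t j..?t (Suc j)} (\<lambda>x. f x - f (?t j))) \<le> r / 2 * (?t (Suc j) - ?t j)"
      proof (rule integral_bound[OF t(1)])
        show "continuous_on {?t j..?t (Suc j)} (\<lambda>x. f x - f (?t j))" by (intro continuous_intros c)
        fix x assume x: "x \<in> {?t j..?t (Suc j)}"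
        have "dist x (?t j) < d" using x len md by (auto simp: dist_real_def)
        moreover have "?t j \<in> {?t j..?t (Suc j)}" using t(1)[of j] by simp
        then have "?t j \<in> {0..1}" "x \<in> {0..1}" using x sub by blast+
        ultimately have "dist (f x) (f (?t j)) < r / 2" by (intro d(2))
        then show "norm (f x - f (?t j)) \<le> r / 2" by (simp add: dist_norm)
      qed
      ultimately have "norm (integral {?t j..?t (Suc j)} f - f (?t j) * (1 / real m)) \<le> r / 2 * (1 / real m)"
        by (simp only: len)
      then show ?thesis by simp
    qed
    have one: "?t m = 1" using m0 by simp
    have "integral {0..1} f = (\<Sum>j<m. integral {?t j..?t (Suc j)} f)"
      using split[of m] unfolding one by simp
    then have "\<bar>(\<Sum>j<m. f (?t j)) / real m - integral {0..1} f\<bar> = \<bar>\<Sum>j<m. integral {?t j..?t (Suc j)} f - f (?t j) / real m\<bar>"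
      by (simp add: sum_subtractf sum_divide_distrib abs_minus_commute)
    also have "\<dots> \<le> (\<Sum>j<m. \<bar>integral {?t j..?t (Suc j)} f - f (?t j) / real m\<bar>)" by (rule sum_abs)
    also have "\<dots> \<le> (\<Sum>j<m. r / 2 / real m)" using piece by (intro sum_mono) auto
    also have "\<dots> < r" using m0 r by simp
    finally show ?thesis by simp
  qed
  then show "\<exists>no. \<forall>m\<ge>no. norm ((\<Sum>j<m. f (real j / real m)) / real m - integral {0..1} f) < r"
    by (intro exI[of _ "Suc (nat \<lceil>1 / d\<rceil>)"]) auto
qed

context wiener
begin

lemma char_scaled_increment:
  assumes st: "0 \<le> s" "s < t"
  shows "char (distr N borel (\<lambda>\<omega>. c * (W t \<omega> - W s \<omega>))) u = exp (- (c\<^sup>2 * (t - s) * u\<^sup>2) / 2)"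
proof -
  have [measurable]: "W s \<in> borel_measurable N" "W t \<in> borel_measurable N" using st by auto
  define \<theta> where "\<theta> = sqrt (t - s)"
  have \<theta>: "0 < \<theta>" "\<theta>\<^sup>2 = t - s" using st by (auto simp: \<theta>_def)
  have "distributed N lborel (\<lambda>\<omega>. (W t \<omega> - W s \<omega> - 0) / \<theta>) std_normal_density"
    using W_distributed[OF st] normal_standard_normal_convert[OF \<theta>(1), of "\<lambda>\<omega>. W t \<omega> - W s \<omega>" 0]
    by (simp add: \<theta>_def)
  then have "distr N lborel (\<lambda>\<omega>. (W t \<omega> - W s \<omega>) / \<theta>) = std_normal_distribution"
    by (simp add: distributed_def)
  moreover have "distr N lborel (\<lambda>\<omega>. (W t \<omega> - W s \<omega>) / \<theta>) = distr N borel (\<lambda>\<omega>. (W t \<omega> - W s \<omega>) / \<theta>)"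
    by (rule distr_cong) simp_all
  ultimately have law: "distr N borel (\<lambda>\<omega>. (W t \<omega> - W s \<omega>) / \<theta>) = std_normal_distribution" by simp
  have "char (distr N borel (\<lambda>\<omega>. c * (W t \<omega> - W s \<omega>))) u = (CLINT \<omega>|N. iexp (u * (c * (W t \<omega> - W s \<omega>))))"
    unfolding char_def by (subst integral_distr) auto
  also have "\<dots> = (CLINT \<omega>|N. iexp (u * c * \<theta> * ((W t \<omega> - W s \<omega>) / \<theta>)))"
    using \<theta>(1) by (simp add: mult.assoc)
  also have "\<dots> = char (distr N borel (\<lambda>\<omega>. (W t \<omega> - W s \<omega>) / \<theta>)) (u * c * \<theta>)"
    unfolding char_def by (subst integral_distr) auto
  also have "\<dots> = exp (- ((u * c * \<theta>)\<^sup>2) / 2)"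
    unfolding law char_std_normal_distribution by simp
  also have "(u * c * \<theta>)\<^sup>2 = c\<^sup>2 * (t - s) * u\<^sup>2" using \<theta>(2) by (simp add: power_mult_distrib)
  finally show ?thesis .
qed

definition square_integral :: "'b \<Rightarrow> real" where
  "square_integral \<omega> = integral {0..1} (\<lambda>t. (W t \<omega>)\<^sup>2)"

lemma continuous_W_square: "\<omega> \<in> space N \<Longrightarrow> continuous_on {0..1} (\<lambda>t. (W t \<omega>)\<^sup>2)"
  by (intro continuous_on_power continuous_on_subset[OF continuous_W]) auto

lemma Riemann_square_integral: "\<omega> \<in> space N \<Longrightarrow> (\<lambda>m. (\<Sum>j<m. (W (real j / real m) \<omega>)\<^sup>2) / real m) \<longlonglongrightarrow> square_integral \<omega>"
  unfolding square_integral_def by (rule left_Riemann_sums_tendsto_integral[OF continuous_W_square])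

lemma measurable_square_integral [measurable]: "square_integral \<in> borel_measurable N"
  by (rule borel_measurable_LIMSEQ_real[OF Riemann_square_integral]) auto

text \<open>
  A vanishing integral would force the continuous path to vanish identically, in particular at
  time 1, where its law has a density.
\<close>

lemma square_integral_pos: "AE \<omega> in N. 0 < square_integral \<omega>"
proof -
  have [measurable]: "W 1 \<in> borel_measurable N" "W 0 \<in> borel_measurable N" by auto
  have "AE x in lborel. x \<noteq> (0::real)" by (rule AE_lborel_singleton)
  then have "AE \<omega> in N. W 1 \<omega> - W 0 \<omega> \<noteq> 0"
    using distributed_AE2[OF W_distributed[of 0 1], of "\<lambda>x. x \<noteq> 0"] by auto
  with W_start AE_space show ?thesis
  proof eventually_elim
    case (elim \<omega>)
    have c: "continuous_on {0..1} (\<lambda>t. (W t \<omega>)\<^sup>2)" by (rule continuous_W_square) (rule elim)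
    have "square_integral \<omega> \<noteq> 0"
    proof
      assume "square_integral \<omega> = 0"
      then have "\<forall>t\<in>{0..1}. (W t \<omega>)\<^sup>2 = 0"
        unfolding square_integral_def using integral_eq_0_iff[OF c] by auto
      then show False using elim by auto
    qed
    moreover have "0 \<le> square_integral \<omega>"
      unfolding square_integral_def by (intro Henstock_Kurzweil_Integration.integral_nonneg integrable_continuous_interval c) auto
    ultimately show ?case by simp
  qed
qed

lemma square_integral_eq_set_integral:
  assumes "\<omega> \<in> space N"
  shows "(LINT t:{0..1}|lborel. (W t \<omega>)\<^sup>2) = square_integral \<omega>"
proof -
  have "set_integrable lborel {0..1} (\<lambda>t. (W t \<omega>)\<^sup>2)"
    by (rule borel_integrable_atLeastAtMost'[OF continuous_W_square[OF assms]])
  then show ?thesis unfolding square_integral_def by (rule set_borel_integral_eq_integral(2))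
qed

end

text \<open>
  The left end point of block \<open>j\<close> when \<open>{0..<n}\<close> is cut into \<open>k\<close> nearly equal blocks.
\<close>

definition grid :: "nat \<Rightarrow> nat \<Rightarrow> nat \<Rightarrow> nat" where
  "grid k n j = j * n div k"

lemma grid_0 [simp]: "grid k n 0 = 0" by (simp add: grid_def)

lemma grid_last: "0 < k \<Longrightarrow> grid k n k = n" by (simp add: grid_def)

lemma grid_mono: "i \<le> j \<Longrightarrow> grid k n i \<le> grid k n j"
  by (auto simp: grid_def intro!: div_le_mono)

lemma grid_bounds:
  assumes "0 < k"
  shows "real j * real n / real k - 1 \<le> real (grid k n j)" "real (grid k n j) \<le> real j * real n / real k"
proof -
  have "real (j * n div k) = of_int \<lfloor>real (j * n) / real k\<rfloor>"
    using floor_divide_of_nat_eq[of "j * n" k, where 'a = real] by simp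
  then show "real j * real n / real k - 1 \<le> real (grid k n j)" "real (grid k n j) \<le> real j * real n / real k"
    unfolding grid_def by (simp_all add: of_nat_mult)
qed

lemma grid_ratio_tendsto: "0 < k \<Longrightarrow> (\<lambda>n. real (grid k n j) / real n) \<longlonglongrightarrow> real j / real k"
proof (rule tendsto_sandwich)
  assume k: "0 < k"
  show "\<forall>\<^sub>F n in sequentially. real j / real k - 1 / real n \<le> real (grid k n j) / real n"
    using eventually_gt_at_top[of 0]
  proof eventually_elim
    case (elim n)
    have "real j / real k - 1 / real n = (real j * real n / real k - 1) / real n"
      using elim by (simp add: diff_divide_distrib)
    also have "\<dots> \<le> real (grid k n j) / real n" by (intro divide_right_mono grid_bounds k) auto
    finally show ?case .
  qed
  show "\<forall>\<^sub>F n in sequentially. real (grid k n j) / real n \<le> real j / real k"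
    using eventually_gt_at_top[of 0]
  proof eventually_elim
    case (elim n)
    have "real (grid k n j) / real n \<le> (real j * real n / real k) / real n" by (intro divide_right_mono grid_bounds k) auto
    then show ?case using elim by simp
  qed
  show "(\<lambda>n. real j / real k - 1 / real n) \<longlonglongrightarrow> real j / real k"
    using tendsto_diff[OF tendsto_const lim_1_over_n, of "real j / real k"] by simp
qed simp

lemma grid_step_ratio_tendsto:
  assumes "0 < k"
  shows "(\<lambda>n. (real (grid k n (Suc j)) - real (grid k n j)) / real n) \<longlonglongrightarrow> 1 / real k"
proof -
  have "real (Suc j) / real k - real j / real k = 1 / real k" by (simp add: add_divide_distrib)
  then show ?thesis
    using tendsto_diff[OF grid_ratio_tendsto[OF assms, of "Suc j"] grid_ratio_tendsto[OF assms, of j]]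
    by (simp only: diff_divide_distrib)
qed

lemma sum_grid_blocks: "(\<Sum>i<grid k n l. f i) = (\<Sum>j<l. \<Sum>i\<in>{grid k n j..<grid k n (Suc j)}. f i :: real)"
proof (induction l)
  case (Suc l)
  have "(\<Sum>i<grid k n (Suc l). f i) = (\<Sum>i<grid k n l. f i) + (\<Sum>i\<in>{grid k n l..<grid k n (Suc l)}. f i)"
    using grid_mono[of l "Suc l" k n] by (simp add: lessThan_atLeast0 sum.atLeastLessThan_concat)
  then show ?case using Suc by simp
qed simp

context innovations
begin

lemma T_block: "a \<le> b \<Longrightarrow> T b \<omega> - T a \<omega> = (\<Sum>i\<in>{a..<b}. (-1) ^ i * m i \<omega>)"
  unfolding T_def lessThan_atLeast0 by (rule sum_diff_nat_ivl) auto

lemma m_law: "distr M borel (m i) = distr M borel (m 0)"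
proof -
  have "distr M borel (m i) = distr (distr M borel (e i)) borel (\<lambda>x. x - \<mu>)" for i
    by (subst distr_distr) (auto simp: comp_def m_def[abs_def])
  then show ?thesis using e_law[of i] by metis
qed

lemma m_indep: "indep_vars (\<lambda>_. borel) m UNIV"
  unfolding m_def[abs_def] by (rule indep_vars_compose2[OF e_indep]) simp

text \<open>
  The central limit theorem for blocks whose length is a given fraction of \<open>n\<close>. The increments of \<open>T\<close>
  have alternating signs and need not be identically distributed, but the second order expansion of
  the characteristic function does not see the sign.
\<close>

lemma char_block_limit:
  assumes ab: "\<And>n. a n \<le> b n" and lim: "(\<lambda>n. (real (b n) - real (a n)) / real n) \<longlonglongrightarrow> \<theta>"
  shows "(\<lambda>n. char (distr M borel (\<lambda>\<omega>. (T (b n) \<omega> - T (a n) \<omega>) / sqrt (real n))) t) \<longlonglongrightarrow> exp (- (\<sigma>2 * \<theta> * t\<^sup>2) / 2)"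
proof -
  define \<phi> where "\<phi> = char (distr M borel (m 0))"
  define c where "c = t\<^sup>2 * \<sigma>2 / 2"
  have c0: "0 \<le> c" using \<sigma>2_nonneg by (simp add: c_def)
  define \<rho> where "\<rho> n = expectation (\<lambda>\<omega>. min (6 * (m 0 \<omega>)\<^sup>2) (\<bar>t\<bar> / sqrt (real n) * \<bar>m 0 \<omega>\<bar> ^ 3))" for n
  define w :: "nat \<Rightarrow> complex" where "w n = of_real (1 - c / real n)" for n
  have char_eq: "char (distr M borel (\<lambda>\<omega>. (T (b n) \<omega> - T (a n) \<omega>) / sqrt (real n))) t = (\<Prod>i\<in>{a n..<b n}. \<phi> ((-1) ^ i * t / sqrt (real n)))" for n
  proof -
    have "(T (b n) \<omega> - T (a n) \<omega>) / sqrt (real n) = (\<Sum>i\<in>{a n..<b n}. (-1) ^ i * m i \<omega> / sqrt (real n))" for \<omega>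
      by (simp add: T_block[OF ab] sum_divide_distrib)
    then have "char (distr M borel (\<lambda>\<omega>. (T (b n) \<omega> - T (a n) \<omega>) / sqrt (real n))) t =
        (\<Prod>i\<in>{a n..<b n}. char (distr M borel (\<lambda>\<omega>. (-1) ^ i * m i \<omega> / sqrt (real n))) t)"
      using indep_vars_compose2[OF indep_vars_subset[OF m_indep subset_UNIV], of _ "\<lambda>i x. (-1) ^ i * x / sqrt (real n)" "\<lambda>_. borel"]
      by (simp add: char_distr_sum)
    also have "\<dots> = (\<Prod>i\<in>{a n..<b n}. \<phi> ((-1) ^ i * t / sqrt (real n)))"
    proof (rule prod.cong[OF refl])
      fix i
      have "char (distr M borel (\<lambda>\<omega>. (-1) ^ i * m i \<omega> / sqrt (real n))) t = (CLINT \<omega>|M. iexp (t * ((-1) ^ i * m i \<omega> / sqrt (real n))))"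
        unfolding char_def by (subst integral_distr) auto
      also have "\<dots> = char (distr M borel (m i)) ((-1) ^ i * t / sqrt (real n))"
        unfolding char_def by (subst integral_distr) (auto simp: mult_ac)
      finally show "char (distr M borel (\<lambda>\<omega>. (-1) ^ i * m i \<omega> / sqrt (real n))) t = \<phi> ((-1) ^ i * t / sqrt (real n))"
        unfolding \<phi>_def m_law[of i] .
    qed
    finally show ?thesis .
  qed
  have \<phi>_approx: "cmod (\<phi> ((-1) ^ i * t / sqrt (real n)) - w n) \<le> t\<^sup>2 / real n / 6 * \<rho> n" if "0 < n" for i n
  proof -
    define s where "s = (-1) ^ i * t / sqrt (real n)"
    have sq: "s\<^sup>2 = t\<^sup>2 / real n" and ab: "\<bar>s\<bar> = \<bar>t\<bar> / sqrt (real n)"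
      by (simp_all add: s_def power_divide power_mult_distrib abs_mult power_abs power_mult[symmetric])
    have "cmod (\<phi> s - (1 - s\<^sup>2 * \<sigma>2 / 2)) \<le> s\<^sup>2 / 6 * expectation (\<lambda>\<omega>. min (6 * (m 0 \<omega>)\<^sup>2) (\<bar>s\<bar> * \<bar>m 0 \<omega>\<bar> ^ 3))"
      unfolding \<phi>_def
    proof (rule char_approx3'[OF _ _ _ _ _ refl])
      show "variance (m 0) = \<sigma>2" by (simp add: m_mean m_variance)
    qed (simp_all add: integrable_m integrable_m_square m_mean)
    moreover have "w n = 1 - s\<^sup>2 * \<sigma>2 / 2"
    proof -
      have "1 - c / real n = 1 - s\<^sup>2 * \<sigma>2 / 2" by (simp add: c_def sq)
      then have "w n = of_real (1 - s\<^sup>2 * \<sigma>2 / 2)" by (simp only: w_def)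
      then show ?thesis by simp
    qed
    ultimately have "cmod (\<phi> s - w n) \<le> s\<^sup>2 / 6 * expectation (\<lambda>\<omega>. min (6 * (m 0 \<omega>)\<^sup>2) (\<bar>s\<bar> * \<bar>m 0 \<omega>\<bar> ^ 3))"
      by (simp only:)
    then show ?thesis unfolding sq ab \<rho>_def[symmetric] by (simp only: s_def)
  qed
  have \<rho>_lim: "\<rho> \<longlonglongrightarrow> 0"
  proof -
    have "(\<lambda>n. min (6 * x\<^sup>2) (\<bar>t\<bar> / sqrt (real n) * \<bar>x\<bar> ^ 3)) \<longlonglongrightarrow> min (6 * x\<^sup>2) (0 * \<bar>x\<bar> ^ 3)" for x :: real
      by (intro tendsto_min tendsto_const tendsto_mult real_tendsto_divide_at_top[OF tendsto_const] filterlim_compose[OF sqrt_at_top] filterlim_real_sequentially)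
    moreover have "min (6 * x\<^sup>2) (0 * \<bar>x\<bar> ^ 3) = 0" for x :: real by simp
    ultimately have "(\<lambda>n. min (6 * x\<^sup>2) (\<bar>t\<bar> / sqrt (real n) * \<bar>x\<bar> ^ 3)) \<longlonglongrightarrow> 0" for x :: real
      by (simp only:)
    then have "\<rho> \<longlonglongrightarrow> expectation (\<lambda>\<omega>. 0)"
      unfolding \<rho>_def using integrable_m_square[of 0]
      by (intro integral_dominated_convergence[where w = "\<lambda>\<omega>. 6 * (m 0 \<omega>)\<^sup>2"]) auto
    then show ?thesis by simp
  qed
  let ?k = "\<lambda>n. b n - a n"
  have kreal: "real (?k n) = real (b n) - real (a n)" for n using ab[of n] by (simp add: of_nat_diff)
  have "(\<lambda>n. t\<^sup>2 / 6 * ((real (b n) - real (a n)) / real n * \<rho> n)) \<longlonglongrightarrow> t\<^sup>2 / 6 * (\<theta> * 0)"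
    by (intro tendsto_intros lim \<rho>_lim)
  then have err0: "(\<lambda>n. t\<^sup>2 / 6 * ((real (b n) - real (a n)) / real n * \<rho> n)) \<longlonglongrightarrow> 0" by simp
  have diff0: "(\<lambda>n. (\<Prod>i\<in>{a n..<b n}. \<phi> ((-1) ^ i * t / sqrt (real n))) - w n ^ ?k n) \<longlonglongrightarrow> 0"
  proof (rule Lim_null_comparison[OF _ err0])
    show "\<forall>\<^sub>F n in sequentially. norm ((\<Prod>i\<in>{a n..<b n}. \<phi> ((-1) ^ i * t / sqrt (real n))) - w n ^ ?k n)
        \<le> t\<^sup>2 / 6 * ((real (b n) - real (a n)) / real n * \<rho> n)"
      using eventually_gt_at_top[of "nat \<lceil>c\<rceil>"]
    proof eventually_elim
      case (elim n)
      then have n: "0 < n" "c < real n" using c0 by linarith+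
      then have cn: "0 \<le> c / real n" "c / real n \<le> 1" using c0 by auto
      interpret R: real_distribution "distr M borel (m 0)" by simp
      have "norm ((\<Prod>i\<in>{a n..<b n}. \<phi> ((-1) ^ i * t / sqrt (real n))) - (\<Prod>i\<in>{a n..<b n}. w n))
          \<le> (\<Sum>i\<in>{a n..<b n}. norm (\<phi> ((-1) ^ i * t / sqrt (real n)) - w n))"
      proof (rule norm_prod_diff)
        show "norm (w n) \<le> 1" unfolding w_def norm_of_real using cn by linarith
        show "norm (\<phi> ((-1) ^ i * t / sqrt (real n))) \<le> 1" for i unfolding \<phi>_def by (rule R.cmod_char_le_1)
      qed
      also have "\<dots> \<le> (\<Sum>i\<in>{a n..<b n}. t\<^sup>2 / real n / 6 * \<rho> n)" by (intro sum_mono \<phi>_approx n)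
      also have "\<dots> = t\<^sup>2 / 6 * ((real (b n) - real (a n)) / real n * \<rho> n)" by (simp add: kreal[symmetric] mult_ac)
      finally show ?case by simp
    qed
  qed
  have wlim: "(\<lambda>n. w n ^ ?k n) \<longlonglongrightarrow> of_real (exp (- c * \<theta>))"
  proof -
    have "(\<lambda>n. exp ((real (b n) - real (a n)) / real n * (real n * ln (1 - c / real n)))) \<longlonglongrightarrow> exp (\<theta> * (- c))"
    proof (intro tendsto_exp tendsto_mult lim)
      show "(\<lambda>n. real n * ln (1 - c / real n)) \<longlonglongrightarrow> - c" by real_asymp
    qed
    then have "(\<lambda>n. of_real (exp ((real (b n) - real (a n)) / real n * (real n * ln (1 - c / real n)))) :: complex) \<longlonglongrightarrow> of_real (exp (\<theta> * (- c)))"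
      by (rule tendsto_of_real)
    moreover have "\<forall>\<^sub>F n in sequentially. of_real (exp ((real (b n) - real (a n)) / real n * (real n * ln (1 - c / real n)))) = w n ^ ?k n"
      using eventually_gt_at_top[of "nat \<lceil>c\<rceil>"]
    proof eventually_elim
      case (elim n)
      then have n: "0 < n" "c < real n" using c0 by linarith+
      then have pos: "0 < 1 - c / real n" by simp
      have "(real (b n) - real (a n)) / real n * (real n * ln (1 - c / real n)) = real (?k n) * ln (1 - c / real n)"
        using n by (simp add: kreal)
      also have "exp \<dots> = (1 - c / real n) ^ ?k n" using pos by (simp add: exp_of_nat_mult)
      finally show ?case by (simp add: w_def)
    qed
    ultimately have "(\<lambda>n. w n ^ ?k n) \<longlonglongrightarrow> of_real (exp (\<theta> * (- c)))" by (rule Lim_transform_eventually)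
    moreover have "\<theta> * (- c) = - c * \<theta>" by simp
    ultimately show ?thesis by (simp only:)
  qed
  have "(\<lambda>n. (\<Prod>i\<in>{a n..<b n}. \<phi> ((-1) ^ i * t / sqrt (real n)))) \<longlonglongrightarrow> of_real (exp (- c * \<theta>))"
    by (rule Lim_transform[OF wlim diff0])
  moreover have "- c * \<theta> = - (\<sigma>2 * \<theta> * t\<^sup>2) / 2" by (simp add: c_def)
  ultimately show ?thesis unfolding char_eq by (simp only: exp_of_real)
qed

text \<open>
  Replacing \<open>T i\<close> by its value at the beginning of the block of \<open>i\<close> changes \<open>(T i)\<^sup>2\<close> by an amount whose mean
  is at most the product of the norms of \<open>T i - T j\<close> and \<open>T i + T j\<close>, where \<open>j\<close> is that beginning.
\<close>

lemma T_grid_error: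
  assumes k: "0 < k" and n: "0 < n"
  shows "integrable M (\<lambda>\<omega>. (\<Sum>i<n. (T i \<omega>)\<^sup>2) / (real n)\<^sup>2 -
      (\<Sum>j<k. (real (grid k n (Suc j)) - real (grid k n j)) / real n * (T (grid k n j) \<omega> / sqrt (real n))\<^sup>2))"
    (is "integrable M ?err")
    and "expectation (\<lambda>\<omega>. \<bar>(\<Sum>i<n. (T i \<omega>)\<^sup>2) / (real n)\<^sup>2 -
      (\<Sum>j<k. (real (grid k n (Suc j)) - real (grid k n j)) / real n * (T (grid k n j) \<omega> / sqrt (real n))\<^sup>2)\<bar>)
      \<le> 2 * \<sigma>2 * sqrt (1 / real k + 1 / real n)"
proof -
  let ?b = "\<lambda>j. {grid k n j..<grid k n (Suc j)}"
  let ?d = "\<lambda>j i \<omega>. (T i \<omega>)\<^sup>2 - (T (grid k n j) \<omega>)\<^sup>2"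
  have int_d: "integrable M (?d j i)" for j i using integrable_T_square by simp
  have eq: "?err \<omega> = (\<Sum>j<k. \<Sum>i\<in>?b j. ?d j i \<omega>) / (real n)\<^sup>2" for \<omega>
  proof -
    have "(\<Sum>i<n. (T i \<omega>)\<^sup>2) = (\<Sum>j<k. \<Sum>i\<in>?b j. (T i \<omega>)\<^sup>2)"
      using sum_grid_blocks[of "\<lambda>i. (T i \<omega>)\<^sup>2" k n k] grid_last[OF k] by simp
    moreover have "(real (grid k n (Suc j)) - real (grid k n j)) / real n * (T (grid k n j) \<omega> / sqrt (real n))\<^sup>2 =
        (\<Sum>i\<in>?b j. (T (grid k n j) \<omega>)\<^sup>2) / (real n)\<^sup>2" for j
      using grid_mono[of j "Suc j" k n] n by (simp add: power_divide power2_eq_square of_nat_diff)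
    ultimately show ?thesis by (simp add: sum_subtractf diff_divide_distrib sum_divide_distrib)
  qed
  show "integrable M ?err" unfolding eq by (intro integrable_divide Bochner_Integration.integrable_sum int_d)
  define L where "L = sqrt (\<sigma>2 * (real n / real k + 1))"
  have piece: "expectation (\<lambda>\<omega>. \<bar>?d j i \<omega>\<bar>) \<le> L * (2 * sqrt (\<sigma>2 * real n))" if j: "j < k" and i: "i \<in> ?b j" for i j
  proof -
    have "grid k n (Suc j) \<le> n" using grid_mono[of "Suc j" k k n] grid_last[OF k] j by simp
    then have i_le: "grid k n j \<le> i" "i \<le> n" using i by auto
    have "real i - real (grid k n j) \<le> real n / real k + 1"
      using grid_bounds(2)[OF k, of n "Suc j"] grid_bounds(1)[OF k, of j n] i
      by (simp add: add_divide_distrib algebra_simps)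
    then have "expectation (\<lambda>\<omega>. (T i \<omega> - T (grid k n j) \<omega>)\<^sup>2) \<le> L\<^sup>2"
      unfolding T_increment_second_moment[OF i_le(1)] L_def using \<sigma>2_nonneg by (simp add: mult_left_mono)
    moreover have "expectation (\<lambda>\<omega>. (T i \<omega> + T (grid k n j) \<omega>)\<^sup>2) \<le> (2 * sqrt (\<sigma>2 * real n))\<^sup>2"
    proof -
      have "expectation (\<lambda>\<omega>. (T i \<omega> + T (grid k n j) \<omega>)\<^sup>2) \<le> expectation (\<lambda>\<omega>. 2 * (T i \<omega>)\<^sup>2 + 2 * (T (grid k n j) \<omega>)\<^sup>2)"
      proof (rule integral_mono)
        show "(T i \<omega> + T (grid k n j) \<omega>)\<^sup>2 \<le> 2 * (T i \<omega>)\<^sup>2 + 2 * (T (grid k n j) \<omega>)\<^sup>2" for \<omega>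
          using zero_le_power2[of "T i \<omega> - T (grid k n j) \<omega>"] by (simp add: power2_eq_square algebra_simps)
      qed (use integrable_T_square in \<open>auto intro!: integrable_square_add\<close>)
      also have "\<dots> = 2 * (\<sigma>2 * real i) + 2 * (\<sigma>2 * real (grid k n j))"
        using integrable_T_square by (simp add: T_second_moment)
      also have "\<dots> \<le> 2 * (\<sigma>2 * real n) + 2 * (\<sigma>2 * real n)"
        using i_le \<sigma>2_nonneg by (intro add_mono mult_left_mono) auto
      also have "\<dots> = (2 * sqrt (\<sigma>2 * real n))\<^sup>2" using \<sigma>2_nonneg by (simp add: power_mult_distrib)
      finally show ?thesis .
    qed
    ultimately have "expectation (\<lambda>\<omega>. \<bar>(T i \<omega> - T (grid k n j) \<omega>) * (T i \<omega> + T (grid k n j) \<omega>)\<bar>) \<le> L * (2 * sqrt (\<sigma>2 * real n))"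
      using \<sigma>2_nonneg
      by (intro expectation_abs_mult_le integrable_T_increment_square[OF i_le(1)] integrable_square_add integrable_T_square)
        (auto simp: L_def)
    moreover have "(T i \<omega> - T (grid k n j) \<omega>) * (T i \<omega> + T (grid k n j) \<omega>) = ?d j i \<omega>" for \<omega>
      by (simp add: power2_eq_square algebra_simps)
    ultimately show ?thesis by (simp only:)
  qed
  have "expectation (\<lambda>\<omega>. \<bar>\<Sum>j<k. \<Sum>i\<in>?b j. ?d j i \<omega>\<bar>) \<le> expectation (\<lambda>\<omega>. \<Sum>j<k. \<Sum>i\<in>?b j. \<bar>?d j i \<omega>\<bar>)"
    by (intro integral_mono integrable_abs Bochner_Integration.integrable_sum int_d order_trans[OF sum_abs] sum_mono sum_abs)
  also have "\<dots> = (\<Sum>j<k. \<Sum>i\<in>?b j. expectation (\<lambda>\<omega>. \<bar>?d j i \<omega>\<bar>))"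
    by (simp add: Bochner_Integration.integral_sum Bochner_Integration.integrable_sum integrable_abs int_d)
  also have "\<dots> \<le> (\<Sum>j<k. \<Sum>i\<in>?b j. L * (2 * sqrt (\<sigma>2 * real n)))"
    by (intro sum_mono piece) auto
  also have "\<dots> = real n * (L * (2 * sqrt (\<sigma>2 * real n)))"
    using sum_grid_blocks[of "\<lambda>i. L * (2 * sqrt (\<sigma>2 * real n))" k n k] grid_last[OF k] by simp
  finally have "expectation (\<lambda>\<omega>. \<bar>\<Sum>j<k. \<Sum>i\<in>?b j. ?d j i \<omega>\<bar>) / (real n)\<^sup>2 \<le> real n * (L * (2 * sqrt (\<sigma>2 * real n))) / (real n)\<^sup>2"
    by (intro divide_right_mono) auto
  also have "\<dots> = 2 * \<sigma>2 * sqrt (1 / real k + 1 / real n)"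
  proof -
    have "real n / real k + 1 = real n * (1 / real k + 1 / real n)" using n by (simp add: field_simps)
    then have L: "L = sqrt \<sigma>2 * (sqrt (real n) * sqrt (1 / real k + 1 / real n))"
      unfolding L_def by (simp only: real_sqrt_mult)
    define a b c where "a = sqrt \<sigma>2" "b = sqrt (real n)" "c = sqrt (1 / real k + 1 / real n)"
    have *: "\<sigma>2 = a * a" "real n = b * b" "b \<noteq> 0" using \<sigma>2_nonneg n by (simp_all add: a_b_c_def)
    show ?thesis
      unfolding L real_sqrt_mult a_b_c_def(1-3)[symmetric] unfolding *(1,2) using *(3)
      by (simp add: power2_eq_square)
  qed
  finally show "expectation (\<lambda>\<omega>. \<bar>?err \<omega>\<bar>) \<le> 2 * \<sigma>2 * sqrt (1 / real k + 1 / real n)"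
    unfolding eq by simp
qed

text \<open>
  A substitute for Donsker's theorem, restricted to the functionals that are needed. With \<open>k\<close> blocks, the
  functional is a polynomial \<open>H k\<close> in independent block sums, which are asymptotically normal with the law
  of the scaled increments of \<open>W\<close>. The limits for fixed \<open>k\<close> are Riemann sums of the Wiener functional,
  and the discretisation error of the walk is small uniformly in large \<open>n\<close>.
\<close>

lemma walk_functional_limit:
  assumes WN: "wiener N W"
  shows "converges_in_law M (\<lambda>n \<omega>. p * ((T n \<omega>)\<^sup>2 / real n - \<sigma>2) + q * ((\<Sum>i<n. (T i \<omega>)\<^sup>2) / (real n)\<^sup>2))
    N (\<lambda>\<omega>. \<sigma>2 * (p * ((W 1 \<omega>)\<^sup>2 - 1) + q * wiener.square_integral W \<omega>))"
proof -
  interpret w: wiener N W by fact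
  define B where "B k n j \<omega> = (T (grid k n (Suc j)) \<omega> - T (grid k n j) \<omega>) / sqrt (real n)" for k n j \<omega>
  define G where "G k j \<omega> = sqrt \<sigma>2 * (W (real (Suc j) / real k) \<omega> - W (real j / real k) \<omega>)" for k j \<omega>
  define H where "H k u y = p * ((\<Sum>j<k. y j)\<^sup>2 - \<sigma>2) + q * (\<Sum>j<k. u j * (\<Sum>i<j. y i)\<^sup>2)"
    for k and u y :: "nat \<Rightarrow> real"
  define u where "u k n j = (real (grid k n (Suc j)) - real (grid k n j)) / real n" for k n j
  have [measurable]: "B k n j \<in> borel_measurable M" for k n j unfolding B_def[abs_def] by measurable
  have [measurable]: "G k j \<in> borel_measurable N" for k j unfolding G_def[abs_def] by measurable
  have Hm: "H k u \<in> borel_measurable (PiM {..<k} (\<lambda>_. borel))" for k u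
  proof -
    have [measurable]: "(\<lambda>y. \<Sum>i<j. y i) \<in> borel_measurable (PiM {..<k} (\<lambda>_. borel :: real measure))" if "j \<le> k" for j
      using that by (intro borel_measurable_sum[where f = "\<lambda>i y. y i"] measurable_component_singleton) auto
    show ?thesis unfolding H_def[abs_def]
      by (intro borel_measurable_add borel_measurable_times borel_measurable_const borel_measurable_diff borel_measurable_power borel_measurable_sum[where S = "{..<k}"])
        auto
  qed
  have H_cong: "H k u (\<lambda>j\<in>{..<k}. y j) = H k u y" for k u y
    unfolding H_def by (intro arg_cong2[where f = "(+)"] arg_cong[where f = "\<lambda>x. p * (x\<^sup>2 - \<sigma>2)"] arg_cong[where f = "\<lambda>x. q * x"] sum.cong) auto
  have B_sum: "(\<Sum>i<j. B k n i \<omega>) = T (grid k n j) \<omega> / sqrt (real n)" for k n j \<omega>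
    unfolding B_def sum_divide_distrib[symmetric] using sum_lessThan_telescope[of "\<lambda>j. T (grid k n j) \<omega>" j]
    by (simp add: T_def)
  have G_sum: "(\<Sum>i<j. G k i \<omega>) = sqrt \<sigma>2 * (W (real j / real k) \<omega> - W 0 \<omega>)" for k j \<omega>
    unfolding G_def sum_distrib_left[symmetric] using sum_lessThan_telescope[of "\<lambda>j. W (real j / real k) \<omega>" j] by simp
  have block: "converges_in_law M (\<lambda>n \<omega>. H k (u k n) (\<lambda>j. B k n j \<omega>)) N (\<lambda>\<omega>. H k (\<lambda>_. 1 / real k) (\<lambda>j. G k j \<omega>))" if k: "0 < k" for k
  proof -
    have "converges_in_law M (\<lambda>n \<omega>. H k (u k n) (\<lambda>j\<in>{..<k}. B k n j \<omega>)) N (\<lambda>\<omega>. H k (\<lambda>_. 1 / real k) (\<lambda>j\<in>{..<k}. G k j \<omega>))"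
    proof (rule converges_in_law_independent_vector[OF prob_space_axioms w.prob_space_axioms k])
      fix j
      have "0 \<le> real j / real k" "real j / real k < real (Suc j) / real k" using k by (auto simp: divide_strict_right_mono)
      note ch = w.char_scaled_increment[OF this, of "sqrt \<sigma>2"]
      have len: "real (Suc j) / real k - real j / real k = 1 / real k" by (simp add: add_divide_distrib)
      show "converges_in_law M (\<lambda>n. B k n j) N (G k j)"
      proof (rule levy_continuity)
        fix t
        have "char (distr N borel (G k j)) t = exp (- (\<sigma>2 * (1 / real k) * t\<^sup>2) / 2)"
          unfolding G_def[abs_def] ch len using \<sigma>2_nonneg by simp
        then show "(\<lambda>n. char (distr M borel (B k n j)) t) \<longlonglongrightarrow> char (distr N borel (G k j)) t"
          using char_block_limit[of "\<lambda>n. grid k n j" "\<lambda>n. grid k n (Suc j)" "1 / real k" t]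
            grid_step_ratio_tendsto[OF k, of j] grid_mono[of j "Suc j" k]
          by (simp add: B_def[abs_def])
      qed (auto intro: w.real_distribution_distr)
    next
      fix n
      let ?K = "\<lambda>j. {grid k n j..<grid k n (Suc j)}"
      have "disjoint_family_on ?K {..<k}"
        unfolding disjoint_family_on_def
      proof (intro ballI impI)
        fix i j :: nat assume "i \<noteq> j"
        then consider "Suc i \<le> j" | "Suc j \<le> i" by linarith
        then show "?K i \<inter> ?K j = {}"
          by cases (use grid_mono[of "Suc i" j k n] grid_mono[of "Suc j" i k n] in auto)
      qed
      then have "indep_vars (\<lambda>j. PiM (?K j) (\<lambda>_. borel)) (\<lambda>j \<omega>. \<lambda>i\<in>?K j. m i \<omega>) {..<k}"
        by (intro indep_vars_restrict[OF m_indep]) auto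
      then have "indep_vars (\<lambda>_. borel) (\<lambda>j \<omega>. (\<Sum>i\<in>?K j. (-1) ^ i * (\<lambda>i\<in>?K j. m i \<omega>) i) / sqrt (real n)) {..<k}"
      proof (rule indep_vars_compose2)
        fix j
        show "(\<lambda>x. (\<Sum>i\<in>?K j. (-1) ^ i * x i) / sqrt (real n)) \<in> borel_measurable (PiM (?K j) (\<lambda>_. borel))"
          by (intro borel_measurable_divide borel_measurable_sum borel_measurable_times borel_measurable_const measurable_component_singleton)
      qed
      moreover have "(\<Sum>i\<in>?K j. (-1) ^ i * (\<lambda>i\<in>?K j. m i \<omega>) i) / sqrt (real n) = B k n j \<omega>" for j \<omega>
        using grid_mono[of j "Suc j" k n] by (simp add: B_def T_block)
      ultimately have "indep_vars (\<lambda>_. borel) (\<lambda>j \<omega>. B k n j \<omega>) {..<k}" by (simp only:)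
      then show "indep_vars (\<lambda>_. borel) (B k n) {..<k}" .
    next
      have "w.indep_vars (\<lambda>_. borel) (\<lambda>j \<omega>. W (real (Suc j) / real k) \<omega> - W (real j / real k) \<omega>) {..<k}"
      proof (rule w.W_indep[where t = "\<lambda>j. real j / real k"])
        show "strict_mono_on {..k} (\<lambda>j. real j / real k)"
          by (rule strict_mono_onI) (use k in \<open>simp add: divide_strict_right_mono\<close>)
      qed simp
      then show "w.indep_vars (\<lambda>_. borel) (G k) {..<k}"
        unfolding G_def[abs_def] by (rule w.indep_vars_compose2) simp
    next
      fix y :: "nat \<Rightarrow> nat \<Rightarrow> real" and y' assume lim: "\<And>j. j < k \<Longrightarrow> (\<lambda>n. y n j) \<longlonglongrightarrow> y' j"
      show "(\<lambda>n. H k (u k n) (y n)) \<longlonglongrightarrow> H k (\<lambda>_. 1 / real k) y'"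
        unfolding H_def u_def
        by (intro tendsto_add tendsto_mult tendsto_const tendsto_diff tendsto_power tendsto_sum grid_step_ratio_tendsto k lim) auto
    qed (auto intro: Hm)
    then show ?thesis by (simp only: H_cong)
  qed
  show ?thesis
  proof (rule converges_in_law_approx[OF w.prob_space_axioms])
    show "\<forall>\<^sub>F k in sequentially. converges_in_law M (\<lambda>n \<omega>. H k (u k n) (\<lambda>j. B k n j \<omega>)) N (\<lambda>\<omega>. H k (\<lambda>_. 1 / real k) (\<lambda>j. G k j \<omega>))"
      using eventually_gt_at_top[of 0] by eventually_elim (rule block)
    show "AE \<omega> in N. (\<lambda>k. H k (\<lambda>_. 1 / real k) (\<lambda>j. G k j \<omega>)) \<longlonglongrightarrow> \<sigma>2 * (p * ((W 1 \<omega>)\<^sup>2 - 1) + q * w.square_integral \<omega>)"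
      using w.W_start AE_space
    proof eventually_elim
      case (elim \<omega>)
      have "(\<lambda>k. \<sigma>2 * (p * ((W 1 \<omega>)\<^sup>2 - 1) + q * ((\<Sum>j<k. (W (real j / real k) \<omega>)\<^sup>2) / real k))) \<longlonglongrightarrow>
          \<sigma>2 * (p * ((W 1 \<omega>)\<^sup>2 - 1) + q * w.square_integral \<omega>)"
        by (intro tendsto_intros w.Riemann_square_integral elim)
      moreover have "\<forall>\<^sub>F k in sequentially. \<sigma>2 * (p * ((W 1 \<omega>)\<^sup>2 - 1) + q * ((\<Sum>j<k. (W (real j / real k) \<omega>)\<^sup>2) / real k)) =
          H k (\<lambda>_. 1 / real k) (\<lambda>j. G k j \<omega>)"
        using eventually_gt_at_top[of 0]
      proof eventually_elim
        case (elim k)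
        have "H k (\<lambda>_. 1 / real k) (\<lambda>j. G k j \<omega>) =
            p * ((sqrt \<sigma>2 * W 1 \<omega>)\<^sup>2 - \<sigma>2) + q * (\<Sum>j<k. 1 / real k * (sqrt \<sigma>2 * W (real j / real k) \<omega>)\<^sup>2)"
          unfolding H_def G_sum using elim \<open>W 0 \<omega> = 0\<close> by simp
        also have "(\<Sum>j<k. 1 / real k * (sqrt \<sigma>2 * W (real j / real k) \<omega>)\<^sup>2) = \<sigma>2 * ((\<Sum>j<k. (W (real j / real k) \<omega>)\<^sup>2) / real k)"
          using \<sigma>2_nonneg by (simp add: power_mult_distrib sum_distrib_left sum_divide_distrib)
        finally show ?case using \<sigma>2_nonneg by (simp add: power_mult_distrib algebra_simps)
      qed
      ultimately show ?case by (rule Lim_transform_eventually)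
    qed
    fix \<delta> \<eta> :: real assume pos: "0 < \<delta>" "0 < \<eta>"
    define c where "c = \<bar>q\<bar> * (2 * \<sigma>2)"
    have "(\<lambda>k. c * sqrt (2 / real k) / \<delta>) \<longlonglongrightarrow> c * sqrt 0 / \<delta>"
      by (intro tendsto_intros real_tendsto_divide_at_top[OF tendsto_const] filterlim_real_sequentially) (use pos in auto)
    then have "\<forall>\<^sub>F k in sequentially. c * sqrt (2 / real k) / \<delta> < \<eta>"
      using pos by (intro order_tendstoD(2)) auto
    with eventually_gt_at_top[of 0]
    show "\<forall>\<^sub>F k in sequentially. \<forall>\<^sub>F n in sequentially. prob {\<omega>\<in>space M. \<delta> <
        \<bar>(p * ((T n \<omega>)\<^sup>2 / real n - \<sigma>2) + q * ((\<Sum>i<n. (T i \<omega>)\<^sup>2) / (real n)\<^sup>2)) - H k (u k n) (\<lambda>j. B k n j \<omega>)\<bar>} \<le> \<eta>"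
    proof eventually_elim
      case (elim k)
      show ?case
        using eventually_ge_at_top[of k]
      proof eventually_elim
        case (elim n)
        with \<open>0 < k\<close> have n: "0 < n" by simp
        let ?err = "\<lambda>\<omega>. (\<Sum>i<n. (T i \<omega>)\<^sup>2) / (real n)\<^sup>2 - (\<Sum>j<k. u k n j * (T (grid k n j) \<omega> / sqrt (real n))\<^sup>2)"
        note err = T_grid_error[OF \<open>0 < k\<close> n, folded u_def]
        have diff: "(p * ((T n \<omega>)\<^sup>2 / real n - \<sigma>2) + q * ((\<Sum>i<n. (T i \<omega>)\<^sup>2) / (real n)\<^sup>2)) - H k (u k n) (\<lambda>j. B k n j \<omega>) = q * ?err \<omega>" for \<omega>
          unfolding H_def B_sum grid_last[OF \<open>0 < k\<close>] by (simp add: power_divide algebra_simps)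
        have "prob {\<omega>\<in>space M. \<delta> < \<bar>q * ?err \<omega>\<bar>} \<le> expectation (\<lambda>\<omega>. \<bar>q * ?err \<omega>\<bar>) / \<delta>"
          by (rule prob_gt_le_expectation[OF integrable_mult_right[OF err(1)] pos(1)])
        also have "expectation (\<lambda>\<omega>. \<bar>q * ?err \<omega>\<bar>) = \<bar>q\<bar> * expectation (\<lambda>\<omega>. \<bar>?err \<omega>\<bar>)" by (simp add: abs_mult)
        also have "\<bar>q\<bar> * expectation (\<lambda>\<omega>. \<bar>?err \<omega>\<bar>) / \<delta> \<le> \<bar>q\<bar> * (2 * \<sigma>2 * sqrt (2 / real k)) / \<delta>"
        proof (intro divide_right_mono mult_left_mono order_trans[OF err(2)])
          have "1 / real n \<le> 1 / real k" using \<open>0 < k\<close> elim by (intro divide_left_mono) auto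
          then show "sqrt (1 / real k + 1 / real n) \<le> sqrt (2 / real k)" by simp
        qed (use \<sigma>2_nonneg pos in auto)
        also have "\<dots> = c * sqrt (2 / real k) / \<delta>" by (simp add: c_def)
        finally show ?case using \<open>c * sqrt (2 / real k) / \<delta> < \<eta>\<close> by (simp only: diff)
      qed
    qed
  next
    show "(\<lambda>\<omega>. H k (u k n) (\<lambda>j. B k n j \<omega>)) \<in> borel_measurable M" for k n
      unfolding H_def by measurable
    show "(\<lambda>\<omega>. H k (\<lambda>_. 1 / real k) (\<lambda>j. G k j \<omega>)) \<in> borel_measurable N" for k
      unfolding H_def by measurable
    show "(\<lambda>\<omega>. \<sigma>2 * (p * ((W 1 \<omega>)\<^sup>2 - 1) + q * w.square_integral \<omega>)) \<in> borel_measurable N"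
      by measurable
  qed measurable
qed

end

section \<open>The least squares estimator\<close>

lemma least_squares_orthogonality:
  fixes r y :: "'i \<Rightarrow> real"
  assumes "finite I" and min: "\<And>t. (\<Sum>i\<in>I. (r i)\<^sup>2) \<le> (\<Sum>i\<in>I. (r i - t * y i)\<^sup>2)"
  shows "(\<Sum>i\<in>I. r i * y i) = 0"
proof -
  define P Y where "P = (\<Sum>i\<in>I. r i * y i)" and "Y = (\<Sum>i\<in>I. (y i)\<^sup>2)"
  have *: "0 \<le> t\<^sup>2 * Y - 2 * t * P" for t
  proof -
    have "(\<Sum>i\<in>I. (r i - t * y i)\<^sup>2) = (\<Sum>i\<in>I. (r i)\<^sup>2) + (t\<^sup>2 * Y - 2 * t * P)"
      unfolding P_def Y_def sum_distrib_left sum_subtractf[symmetric] sum.distrib[symmetric]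
      by (intro sum.cong) (auto simp: power2_eq_square algebra_simps)
    then show ?thesis using min[of t] by simp
  qed
  have Y: "0 \<le> Y" unfolding Y_def by (intro sum_nonneg) simp
  define s where "s = 1 / (Y + 1)"
  have s: "0 < s" "s * Y \<le> 1" using Y by (simp_all add: s_def)
  \<comment> \<open>A step proportional to \<open>P\<close> and short enough for the linear term to dominate.\<close>
  have "s * (s * Y) \<le> s * 1" using s by (intro mult_left_mono) auto
  then have neg: "s\<^sup>2 * Y - 2 * s < 0" using s by (simp add: power2_eq_square mult.assoc)
  have "0 \<le> (s * P)\<^sup>2 * Y - 2 * (s * P) * P" by (rule *)
  also have "\<dots> = P\<^sup>2 * (s\<^sup>2 * Y - 2 * s)" by (simp add: power2_eq_square algebra_simps)
  finally have "P\<^sup>2 \<le> 0" using neg by (simp add: zero_le_mult_iff)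
  then show ?thesis by (simp add: P_def)
qed

context innovations
begin

text \<open>
  Here \<open>a\<close> and \<open>c\<close> are the coefficients of \<open>v\<close> and \<open>z\<close> in the regression of \<open>m\<close>. After normalisation with
  the powers of \<open>n\<close> that belong to the five sums, Cramer's rule gives \<open>n * a = num / det\<close> and
  \<open>n * c = numc / (sqrt n * det)\<close>. Since the normalised \<open>\<Sum> z * v\<close> vanishes and the normalised \<open>\<Sum> z\<^sup>2\<close> tends
  to \<open>\<kappa>\<close>, numerator and determinant are asymptotically \<open>\<kappa>\<close> times functionals of the walk \<open>T\<close>.
\<close>

lemma estimator_limit:
  fixes a c :: "nat \<Rightarrow> 'a \<Rightarrow> real"
  assumes WN: "wiener N W" and \<mu>: "\<mu> \<noteq> 0" and \<sigma>2: "0 < \<sigma>2"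
    and [measurable]: "\<And>n. a n \<in> borel_measurable M" "\<And>n. c n \<in> borel_measurable M"
    and normal_v: "\<And>n. AE \<omega> in M. a n \<omega> * (\<Sum>i<n. (v i \<omega>)\<^sup>2) + c n \<omega> * (\<Sum>i<n. z i \<omega> * v i \<omega>) = (\<Sum>i<n. v i \<omega> * m i \<omega>)"
    and normal_z: "\<And>n. AE \<omega> in M. a n \<omega> * (\<Sum>i<n. z i \<omega> * v i \<omega>) + c n \<omega> * (\<Sum>i<n. (z i \<omega>)\<^sup>2) = (\<Sum>i<n. z i \<omega> * m i \<omega>)"
  shows "converges_in_law M (\<lambda>n \<omega>. real n * a n \<omega>) N (\<lambda>\<omega>. - (((W 1 \<omega>)\<^sup>2 - 1) / 2) / wiener.square_integral W \<omega>)"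
    and "vanishes_in_prob M (\<lambda>n \<omega>. real n * c n \<omega>)"
proof -
  interpret w: wiener N W by fact
  define \<kappa> where "\<kappa> = \<mu>\<^sup>2 / 12"
  have \<kappa>: "0 < \<kappa>" using \<mu> by (simp add: \<kappa>_def)
  define A where "A n \<omega> = (\<Sum>i<n. (z i \<omega>)\<^sup>2) / real n ^ 3" for n \<omega>
  define Q where "Q n \<omega> = (\<Sum>i<n. (v i \<omega>)\<^sup>2) / (real n)\<^sup>2" for n \<omega>
  define D where "D n \<omega> = (\<Sum>i<n. v i \<omega> * m i \<omega>) / real n" for n \<omega>
  define C where "C n \<omega> = (\<Sum>i<n. z i \<omega> * v i \<omega>) / ((real n)\<^sup>2 * sqrt (real n))" for n \<omega>
  define E where "E n \<omega> = (\<Sum>i<n. z i \<omega> * m i \<omega>) / (real n * sqrt (real n))" for n \<omega>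
  define num where "num n \<omega> = A n \<omega> * D n \<omega> - C n \<omega> * E n \<omega>" for n \<omega>
  define numc where "numc n \<omega> = Q n \<omega> * E n \<omega> - C n \<omega> * D n \<omega>" for n \<omega>
  define det where "det n \<omega> = A n \<omega> * Q n \<omega> - C n \<omega> * C n \<omega>" for n \<omega>
  have Am [measurable]: "A n \<in> borel_measurable M" and Qm [measurable]: "Q n \<in> borel_measurable M"
    and Dm [measurable]: "D n \<in> borel_measurable M" and Cm [measurable]: "C n \<in> borel_measurable M"
    and Em [measurable]: "E n \<in> borel_measurable M" for n
    unfolding A_def[abs_def] Q_def[abs_def] D_def[abs_def] C_def[abs_def] E_def[abs_def] by measurable
  have [measurable]: "num n \<in> borel_measurable M" "numc n \<in> borel_measurable M" "det n \<in> borel_measurable M" for n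
    unfolding num_def[abs_def] numc_def[abs_def] det_def[abs_def] by measurable
  have cramer: "real n * a n \<omega> * det n \<omega> = num n \<omega> \<and> real n * c n \<omega> * det n \<omega> = numc n \<omega> * (1 / sqrt (real n))"
    if v: "a n \<omega> * (\<Sum>i<n. (v i \<omega>)\<^sup>2) + c n \<omega> * (\<Sum>i<n. z i \<omega> * v i \<omega>) = (\<Sum>i<n. v i \<omega> * m i \<omega>)"
      and z: "a n \<omega> * (\<Sum>i<n. z i \<omega> * v i \<omega>) + c n \<omega> * (\<Sum>i<n. (z i \<omega>)\<^sup>2) = (\<Sum>i<n. z i \<omega> * m i \<omega>)" for n \<omega>
  proof (cases "n = 0")
    case True
    then show ?thesis by (simp add: det_def num_def numc_def A_def Q_def D_def C_def E_def)
  next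
    case False
    define s where "s = sqrt (real n)"
    have s: "s \<noteq> 0" "real n = s * s" using False by (simp_all add: s_def)
    define Szz Svv Szv where "Szz = (\<Sum>i<n. (z i \<omega>)\<^sup>2)" "Svv = (\<Sum>i<n. (v i \<omega>)\<^sup>2)" "Szv = (\<Sum>i<n. z i \<omega> * v i \<omega>)"
    note S = Szz_Svv_Szv_def
    show ?thesis
      unfolding det_def num_def numc_def A_def Q_def D_def C_def E_def v[symmetric] z[symmetric] S[symmetric] s_def[symmetric]
      unfolding s(2) using s(1) by (simp add: field_simps power2_eq_square power3_eq_cube)
  qed
  have vanA: "vanishes_in_prob M (\<lambda>n \<omega>. A n \<omega> - \<kappa>)"
    unfolding A_def \<kappa>_def by (rule sum_z_square_limit)
  have vanQ: "vanishes_in_prob M (\<lambda>n \<omega>. Q n \<omega> - (\<Sum>i<n. (T i \<omega>)\<^sup>2) / (real n)\<^sup>2)"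
    unfolding Q_def by (rule sum_v_square_limit)
  have vanD: "vanishes_in_prob M (\<lambda>n \<omega>. D n \<omega> + ((T n \<omega>)\<^sup>2 / real n - \<sigma>2) / 2)"
    unfolding D_def by (rule sum_v_m_limit)
  have vanC: "vanishes_in_prob M C" unfolding C_def[abs_def] by (rule sum_z_v_vanishes)
  have bE: "bounded_in_prob M E" unfolding E_def[abs_def] by (rule sum_z_m_bounded)
  have bQ: "bounded_in_prob M Q" unfolding Q_def[abs_def] by (rule sum_v_square_bounded)
  have bD: "bounded_in_prob M D" unfolding D_def[abs_def] by (rule sum_v_m_bounded)
  have lin: "converges_in_law M (\<lambda>n \<omega>. p * num n \<omega> + q * det n \<omega>) N
      (\<lambda>\<omega>. \<sigma>2 * (- \<kappa> * p / 2 * ((W 1 \<omega>)\<^sup>2 - 1) + \<kappa> * q * w.square_integral \<omega>))" for p q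
  proof (rule converges_in_law_Slutsky[OF w.prob_space_axioms _ _ _ walk_functional_limit[OF WN]])
    let ?F = "\<lambda>n \<omega>. - \<kappa> * p / 2 * ((T n \<omega>)\<^sup>2 / real n - \<sigma>2) + \<kappa> * q * ((\<Sum>i<n. (T i \<omega>)\<^sup>2) / (real n)\<^sup>2)"
    have 1: "vanishes_in_prob M (\<lambda>n \<omega>. (A n \<omega> - \<kappa>) * D n \<omega>)"
      and 2: "vanishes_in_prob M (\<lambda>n \<omega>. (A n \<omega> - \<kappa>) * Q n \<omega>)"
      by (rule vanishes_in_prob_mult[OF _ _ vanA bD] vanishes_in_prob_mult[OF _ _ vanA bQ]; simp)+
    have 3: "vanishes_in_prob M (\<lambda>n \<omega>. C n \<omega> * E n \<omega>)"
      by (rule vanishes_in_prob_mult[OF Cm Em vanC bE])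
    have 4: "vanishes_in_prob M (\<lambda>n \<omega>. C n \<omega> * C n \<omega>)"
      by (rule vanishes_in_prob_mult[OF Cm Cm vanC vanishes_imp_bounded_in_prob[OF vanC]])
    have "vanishes_in_prob M (\<lambda>n \<omega>. (A n \<omega> - \<kappa>) * D n \<omega> * p + ((A n \<omega> - \<kappa>) * Q n \<omega> * q +
        ((D n \<omega> + ((T n \<omega>)\<^sup>2 / real n - \<sigma>2) / 2) * (p * \<kappa>) + ((Q n \<omega> - (\<Sum>i<n. (T i \<omega>)\<^sup>2) / (real n)\<^sup>2) * (q * \<kappa>) +
        (C n \<omega> * E n \<omega> * (- p) + C n \<omega> * C n \<omega> * (- q))))))"
      by (rule vanishes_in_prob_add vanishes_in_prob_cmult[OF _ 1] vanishes_in_prob_cmult[OF _ 2]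
          vanishes_in_prob_cmult[OF _ 3] vanishes_in_prob_cmult[OF _ 4] vanishes_in_prob_cmult[OF _ vanD]
          vanishes_in_prob_cmult[OF _ vanQ] | simp)+
    moreover have "(A n \<omega> - \<kappa>) * D n \<omega> * p + ((A n \<omega> - \<kappa>) * Q n \<omega> * q +
        ((D n \<omega> + ((T n \<omega>)\<^sup>2 / real n - \<sigma>2) / 2) * (p * \<kappa>) + ((Q n \<omega> - (\<Sum>i<n. (T i \<omega>)\<^sup>2) / (real n)\<^sup>2) * (q * \<kappa>) +
        (C n \<omega> * E n \<omega> * (- p) + C n \<omega> * C n \<omega> * (- q))))) = p * num n \<omega> + q * det n \<omega> - ?F n \<omega>" for n \<omega>
    proof -
      have "(A' - k) * D' * p + ((A' - k) * Q' * q + ((D' + (t - s) / 2) * (p * k) + ((Q' - S) * (q * k) +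
          (C' * E' * (- p) + C' * C' * (- q))))) =
          p * (A' * D' - C' * E') + q * (A' * Q' - C' * C') - (- k * p / 2 * (t - s) + k * q * S)"
        for A' C' D' E' Q' S k s t :: real
        by (simp add: field_simps)
      then show ?thesis unfolding num_def det_def .
    qed
    ultimately show "vanishes_in_prob M (\<lambda>n \<omega>. p * num n \<omega> + q * det n \<omega> - ?F n \<omega>)" by (simp only:)
  qed measurable
  have den: "converges_in_law M det N (\<lambda>\<omega>. \<sigma>2 * \<kappa> * w.square_integral \<omega>)"
    using lin[of 0 1] by (simp add: mult.assoc)
  have den_pos: "AE \<omega> in N. 0 < \<sigma>2 * \<kappa> * w.square_integral \<omega>"
    using w.square_integral_pos by eventually_elim (simp add: \<sigma>2 \<kappa>)
  have W1 [measurable]: "W 1 \<in> borel_measurable N" by simp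
  have "converges_in_law M (\<lambda>n \<omega>. real n * a n \<omega>) N (\<lambda>\<omega>. (- \<sigma>2 * \<kappa> / 2 * ((W 1 \<omega>)\<^sup>2 - 1)) / (\<sigma>2 * \<kappa> * w.square_integral \<omega>))"
  proof (rule converges_in_law_ratio[OF w.prob_space_axioms _ _ _ _ _ _ _ den den_pos])
    show "AE \<omega> in M. 0 < det n \<omega> \<longrightarrow> real n * a n \<omega> = num n \<omega> / det n \<omega>" for n
      using normal_v[of n] normal_z[of n]
    proof eventually_elim
      case (elim \<omega>)
      then show ?case using cramer[of n \<omega>] by (auto simp: eq_divide_eq)
    qed
    show "converges_in_law M (\<lambda>n \<omega>. num n \<omega> - x * det n \<omega>) N (\<lambda>\<omega>. - \<sigma>2 * \<kappa> / 2 * ((W 1 \<omega>)\<^sup>2 - 1) - x * (\<sigma>2 * \<kappa> * w.square_integral \<omega>))" for x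
    proof -
      have 1: "1 * num n \<omega> + (- x) * det n \<omega> = num n \<omega> - x * det n \<omega>" for n \<omega> by simp
      have 2: "\<sigma>2 * (- \<kappa> * 1 / 2 * ((W 1 \<omega>)\<^sup>2 - 1) + \<kappa> * (- x) * w.square_integral \<omega>) =
          - \<sigma>2 * \<kappa> / 2 * ((W 1 \<omega>)\<^sup>2 - 1) - x * (\<sigma>2 * \<kappa> * w.square_integral \<omega>)" for \<omega>
        by (simp add: algebra_simps)
      show ?thesis using lin[of 1 "- x"] unfolding 1 2 .
    qed
  qed measurable
  moreover have "(- \<sigma>2 * \<kappa> / 2 * ((W 1 \<omega>)\<^sup>2 - 1)) / (\<sigma>2 * \<kappa> * w.square_integral \<omega>) = - (((W 1 \<omega>)\<^sup>2 - 1) / 2) / w.square_integral \<omega>" for \<omega>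
  proof -
    have "(- \<sigma>2 * \<kappa> / 2 * x) / (\<sigma>2 * \<kappa> * y) = ((\<sigma>2 * \<kappa>) * (- (x / 2))) / ((\<sigma>2 * \<kappa>) * y)" for x y by simp
    also have "\<dots> x y = - (x / 2) / y" for x y using \<sigma>2 \<kappa> by (intro mult_divide_mult_cancel_left) simp
    finally show ?thesis .
  qed
  ultimately show "converges_in_law M (\<lambda>n \<omega>. real n * a n \<omega>) N (\<lambda>\<omega>. - (((W 1 \<omega>)\<^sup>2 - 1) / 2) / w.square_integral \<omega>)"
    by (simp only:)
  have b_sqrt: "vanishes_in_prob M (\<lambda>n \<omega>. 1 / sqrt (real n))"
    by (rule vanishes_in_probI_rate[where K = 1]) (simp_all add: prob_space)
  have "vanishes_in_prob M (\<lambda>n \<omega>. 1 / sqrt (real n) * (Q n \<omega>) * E n \<omega> + C n \<omega> * D n \<omega> * (1 / sqrt (real n)) * (- 1))"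
  proof -
    have 1: "vanishes_in_prob M (\<lambda>n \<omega>. 1 / sqrt (real n) * Q n \<omega>)"
      by (rule vanishes_in_prob_mult[OF _ Qm b_sqrt bQ]) simp
    have 2: "vanishes_in_prob M (\<lambda>n \<omega>. 1 / sqrt (real n) * Q n \<omega> * E n \<omega>)"
      by (rule vanishes_in_prob_mult[OF _ Em 1 bE]) simp
    have 3: "vanishes_in_prob M (\<lambda>n \<omega>. C n \<omega> * D n \<omega>)"
      by (rule vanishes_in_prob_mult[OF Cm Dm vanC bD])
    have 4: "vanishes_in_prob M (\<lambda>n \<omega>. C n \<omega> * D n \<omega> * (1 / sqrt (real n)))"
      by (rule vanishes_in_prob_mult[OF _ _ 3 vanishes_imp_bounded_in_prob[OF b_sqrt]]) simp_all
    show ?thesis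
      by (rule vanishes_in_prob_add[OF _ _ 2 vanishes_in_prob_cmult[OF _ 4]]) simp_all
  qed
  moreover have "1 / sqrt (real n) * (Q n \<omega>) * E n \<omega> + C n \<omega> * D n \<omega> * (1 / sqrt (real n)) * (- 1) = numc n \<omega> * (1 / sqrt (real n))" for n \<omega>
    by (simp add: numc_def diff_divide_distrib mult.commute mult.left_commute)
  ultimately have numc: "vanishes_in_prob M (\<lambda>n \<omega>. numc n \<omega> * (1 / sqrt (real n)))" by (simp only:)
  have dm: "(\<lambda>\<omega>. \<sigma>2 * \<kappa> * w.square_integral \<omega>) \<in> borel_measurable N" by measurable
  have inv: "bounded_in_prob M (\<lambda>n \<omega>. 1 / det n \<omega>)"
    by (rule bounded_in_prob_inverse(2)[OF w.prob_space_axioms _ dm den den_pos]) simp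
  have ratio: "vanishes_in_prob M (\<lambda>n \<omega>. numc n \<omega> * (1 / sqrt (real n)) * (1 / det n \<omega>))"
    by (rule vanishes_in_prob_mult[OF _ _ numc inv]) simp_all
  show "vanishes_in_prob M (\<lambda>n \<omega>. real n * c n \<omega>)"
    unfolding vanishes_in_prob_def
  proof (intro allI impI)
    fix \<delta> \<eta> :: real assume pos: "0 < \<delta>" "0 < \<eta>"
    obtain d where d: "0 < d" "\<forall>\<^sub>F n in sequentially. prob {\<omega>\<in>space M. det n \<omega> < d} \<le> \<eta> / 2"
      using bounded_in_prob_inverse(1)[OF w.prob_space_axioms _ dm den den_pos half_gt_zero[OF pos(2)]] by auto
    have "\<forall>\<^sub>F n in sequentially. prob {\<omega>\<in>space M. \<delta> < \<bar>numc n \<omega> * (1 / sqrt (real n)) * (1 / det n \<omega>)\<bar>} \<le> \<eta> / 2"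
      by (rule vanishes_in_probD[OF ratio pos(1) half_gt_zero[OF pos(2)]])
    with d(2) show "\<forall>\<^sub>F n in sequentially. prob {\<omega>\<in>space M. \<delta> < \<bar>real n * c n \<omega>\<bar>} \<le> \<eta>"
    proof eventually_elim
      case (elim n)
      let ?B = "{\<omega>\<in>space M. det n \<omega> < d}" and ?V = "{\<omega>\<in>space M. \<delta> < \<bar>numc n \<omega> * (1 / sqrt (real n)) * (1 / det n \<omega>)\<bar>}"
      have "prob {\<omega>\<in>space M. \<delta> < \<bar>real n * c n \<omega>\<bar>} \<le> prob (?B \<union> ?V)"
      proof (rule finite_measure_mono_AE)
        show "AE \<omega> in M. \<omega> \<in> {\<omega>\<in>space M. \<delta> < \<bar>real n * c n \<omega>\<bar>} \<longrightarrow> \<omega> \<in> ?B \<union> ?V"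
          using normal_v[of n] normal_z[of n]
        proof eventually_elim
          case (elim \<omega>)
          have "real n * c n \<omega> = numc n \<omega> * (1 / sqrt (real n)) * (1 / det n \<omega>)" if "d \<le> det n \<omega>"
          proof -
            have "det n \<omega> \<noteq> 0" using that d(1) by simp
            then have "real n * c n \<omega> = real n * c n \<omega> * det n \<omega> * (1 / det n \<omega>)" by simp
            also have "real n * c n \<omega> * det n \<omega> = numc n \<omega> * (1 / sqrt (real n))" using cramer[of n \<omega>] elim by blast
            finally show ?thesis .
          qed
          then show ?case by (cases "det n \<omega> < d") auto
        qed
      qed measurable
      also have "\<dots> \<le> prob ?B + prob ?V" by (intro measure_Un_le) measurable
      finally show ?case using elim by simp
    qed
  qed
qed

end

section \<open>The nonprimitive unstable process\<close>

lemma (in prob_space) bernoulli_rv_degenerate: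
  assumes Y: "Y \<in> M \<rightarrow>\<^sub>M count_space UNIV" and b: "bernoulli_rv M (of_bool b) Y"
  shows "AE \<omega> in M. Y \<omega> = of_bool b"
proof -
  have "bernoulli_pmf (of_bool b) = return_pmf b"
  proof (rule pmf_eqI)
    show "pmf (bernoulli_pmf (of_bool b)) i = pmf (return_pmf b) i" for i
      by (cases b; cases i) (simp_all add: indicator_def)
  qed
  then have "distr M (count_space UNIV) Y = measure_pmf (return_pmf (of_bool b))"
    using b by (simp add: bernoulli_rv_def)
  moreover have "AE y in measure_pmf (return_pmf (of_bool b :: nat)). y = of_bool b"
    by (simp add: AE_measure_pmf_iff)
  ultimately have "AE y in distr M (count_space UNIV) Y. y = of_bool b" by (simp only:)
  then show ?thesis using Y by (subst (asm) AE_distr_iff) auto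
qed

lemma inar2_nonprimitive_recursion:
  assumes X: "inar2_process M 0 1 \<epsilon> X"
  shows "AE \<omega> in M. \<forall>k\<ge>1. X (int k) \<omega> = X (int k - 2) \<omega> + \<epsilon> k \<omega>"
proof -
  interpret prob_space M using X by (simp add: inar2_process_def)
  obtain \<xi> \<eta> where ind: "indep_vars (\<lambda>_. count_space UNIV) (noise \<epsilon> \<xi> \<eta>) noise_indices"
    and bern: "\<And>k j. 1 \<le> k \<Longrightarrow> 1 \<le> j \<Longrightarrow> bernoulli_rv M 0 (\<xi> k j) \<and> bernoulli_rv M 1 (\<eta> k j)"
    and rec: "\<And>k. 1 \<le> k \<Longrightarrow> AE \<omega> in M. X (int k) \<omega> =
        (\<Sum>j = 1..X (int k - 1) \<omega>. \<xi> k j \<omega>) + (\<Sum>j = 1..X (int k - 2) \<omega>. \<eta> k j \<omega>) + \<epsilon> k \<omega>"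
    using X unfolding inar2_process_def by blast
  have meas: "noise \<epsilon> \<xi> \<eta> i \<in> M \<rightarrow>\<^sub>M count_space UNIV" if "i \<in> noise_indices" for i
    using ind that by (auto simp: indep_vars_def)
  have xi: "AE \<omega> in M. \<xi> k j \<omega> = 0" and eta: "AE \<omega> in M. \<eta> k j \<omega> = 1" if "1 \<le> k" "1 \<le> j" for k j
    using bernoulli_rv_degenerate[of "\<xi> k j" False] bernoulli_rv_degenerate[of "\<eta> k j" True]
      bern[OF that] meas[of "Xi k j"] meas[of "Eta k j"] that by (auto simp: noise_indices_def)
  have "AE \<omega> in M. \<forall>k. 1 \<le> k \<longrightarrow> X (int k) \<omega> = X (int k - 2) \<omega> + \<epsilon> k \<omega>"
    unfolding AE_all_countable
  proof
    fix k :: nat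
    show "AE \<omega> in M. 1 \<le> k \<longrightarrow> X (int k) \<omega> = X (int k - 2) \<omega> + \<epsilon> k \<omega>"
    proof (cases "1 \<le> k")
      case True
      have "AE \<omega> in M. \<forall>j. 1 \<le> j \<longrightarrow> \<xi> k j \<omega> = 0 \<and> \<eta> k j \<omega> = 1"
        unfolding AE_all_countable
      proof
        fix j :: nat
        show "AE \<omega> in M. 1 \<le> j \<longrightarrow> \<xi> k j \<omega> = 0 \<and> \<eta> k j \<omega> = 1"
          using xi[OF True, of j] eta[OF True, of j] by (cases "1 \<le> j") auto
      qed
      with rec[OF True] show ?thesis
      proof eventually_elim
        case (elim \<omega>)
        have "(\<Sum>j = 1..X (int k - 1) \<omega>. \<xi> k j \<omega>) = 0" using elim(2) by (intro sum.neutral) auto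
        moreover have "(\<Sum>j = 1..X (int k - 2) \<omega>. \<eta> k j \<omega>) = (\<Sum>j = 1..X (int k - 2) \<omega>. 1)"
          using elim(2) by (intro sum.cong) auto
        ultimately show ?case using elim(1) by simp
      qed
    qed simp
  qed
  then show ?thesis by simp
qed

lemma inar2_innovations:
  assumes X: "inar2_process M \<alpha> \<beta> \<epsilon> X" and sq: "integrable M (\<lambda>\<omega>. (real (\<epsilon> 1 \<omega>))\<^sup>2)"
  shows "innovations M (\<lambda>i \<omega>. real (\<epsilon> (Suc i) \<omega>)) (prob_space.expectation M (\<lambda>\<omega>. real (\<epsilon> 1 \<omega>)))
    (prob_space.variance M (\<lambda>\<omega>. real (\<epsilon> 1 \<omega>)))"
proof -
  interpret prob_space M using X by (simp add: inar2_process_def)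
  obtain \<xi> \<eta> where ind: "indep_vars (\<lambda>_. count_space UNIV) (noise \<epsilon> \<xi> \<eta>) noise_indices"
    and law: "\<And>k. 1 \<le> k \<Longrightarrow> distr M (count_space UNIV) (\<epsilon> k) = distr M (count_space UNIV) (\<epsilon> 1)"
    using X unfolding inar2_process_def by blast
  have meas: "\<epsilon> (Suc i) \<in> M \<rightarrow>\<^sub>M count_space UNIV" for i
    using ind by (auto simp: indep_vars_def noise_indices_def dest!: bspec[where x = "Innov (Suc i)"])
  show ?thesis
  proof unfold_locales
    have "indep_vars (\<lambda>i. PiM {Innov (Suc i)} (\<lambda>_. count_space UNIV))
        (\<lambda>i \<omega>. \<lambda>k\<in>{Innov (Suc i)}. noise \<epsilon> \<xi> \<eta> k \<omega>) UNIV"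
      by (rule indep_vars_restrict[OF ind]) (auto simp: noise_indices_def disjoint_family_on_def)
    then have "indep_vars (\<lambda>_. borel) (\<lambda>i \<omega>. real ((\<lambda>k\<in>{Innov (Suc i)}. noise \<epsilon> \<xi> \<eta> k \<omega>) (Innov (Suc i)))) UNIV"
    proof (rule indep_vars_compose2)
      fix i
      have "(\<lambda>x. x (Innov (Suc i))) \<in> PiM {Innov (Suc i)} (\<lambda>_. count_space UNIV) \<rightarrow>\<^sub>M (count_space UNIV :: nat measure)"
        by (rule measurable_component_singleton) simp
      then show "(\<lambda>x. real (x (Innov (Suc i)))) \<in> borel_measurable (PiM {Innov (Suc i)} (\<lambda>_. count_space UNIV))"
        by (rule measurable_compose) simp
    qed
    then show "indep_vars (\<lambda>_. borel) (\<lambda>i \<omega>. real (\<epsilon> (Suc i) \<omega>)) UNIV" by simp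
    show "distr M borel (\<lambda>\<omega>. real (\<epsilon> (Suc i) \<omega>)) = distr M borel (\<lambda>\<omega>. real (\<epsilon> (Suc 0) \<omega>))" for i
    proof -
      have "distr M borel (\<lambda>\<omega>. real (\<epsilon> (Suc i) \<omega>)) = distr (distr M (count_space UNIV) (\<epsilon> (Suc i))) borel real" for i
        using meas by (subst distr_distr) (auto simp: comp_def)
      then show ?thesis using law[of "Suc i"] by simp
    qed
  qed (use sq in simp_all)
qed

lemma cls_objective_eq:
  fixes zs :: "nat \<Rightarrow> real"
  assumes x: "\<And>i. i \<in> {1..n} \<Longrightarrow> x i = zs (Suc i)" and z0: "zs 0 = 0" "zs (Suc 0) = 0"
  shows "cls_objective \<mu> n x (a, b) = (\<Sum>i<n. (zs (Suc (Suc i)) - a * zs (Suc i) - b * zs i - \<mu>)\<^sup>2)"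
proof -
  have "cls_objective \<mu> n x (a, b) = (\<Sum>i<n. (x (Suc i) - a * padded x (int (Suc i) - 1) - b * padded x (int (Suc i) - 2) - \<mu>)\<^sup>2)"
    unfolding cls_objective_def by (simp only: case_prod_conv One_nat_def sum.atLeast1_atMost_eq)
  also have "\<dots> = (\<Sum>i<n. (zs (Suc (Suc i)) - a * zs (Suc i) - b * zs i - \<mu>)\<^sup>2)"
  proof (rule sum.cong[OF refl])
    fix i assume i: "i \<in> {..<n}"
    have "x (Suc i) = zs (Suc (Suc i))" using i by (intro x) auto
    moreover have "padded x (int (Suc i) - 1) = zs (Suc i)"
    proof -
      have "int (Suc i) - 1 = int i" by simp
      then show ?thesis using x[of i] i z0 by (cases "i = 0") (simp_all add: padded_def)
    qed
    moreover have "padded x (int (Suc i) - 2) = zs i"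
    proof (cases "i = 0")
      case False
      then obtain j where j: "i = Suc j" by (cases i) auto
      then have "int (Suc i) - 2 = int j" by simp
      then show ?thesis using x[of j] i z0 j by (cases "j = 0") (simp_all add: padded_def)
    qed (simp add: padded_def z0)
    ultimately show "(x (Suc i) - a * padded x (int (Suc i) - 1) - b * padded x (int (Suc i) - 2) - \<mu>)\<^sup>2 =
        (zs (Suc (Suc i)) - a * zs (Suc i) - b * zs i - \<mu>)\<^sup>2" by simp
  qed
  finally show ?thesis .
qed

text \<open>
  At a minimum the residuals are orthogonal to both regressors, whether or not the minimiser is
  unique.
\<close>

lemma cls_normal_equations:
  fixes zs :: "nat \<Rightarrow> real"
  assumes est: "cls_estimator \<mu> n f" and xs: "x \<in> space (sample_space n)" and fx: "f x = (a, b)"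
    and x: "\<And>i. i \<in> {1..n} \<Longrightarrow> x i = zs (Suc i)" and z0: "zs 0 = 0" "zs (Suc 0) = 0"
  defines "r \<equiv> \<lambda>i. zs (Suc (Suc i)) - a * zs (Suc i) - b * zs i - \<mu>"
  shows "(\<Sum>i<n. r i * zs (Suc i)) = 0" and "(\<Sum>i<n. r i * zs i) = 0"
proof -
  have obj: "cls_objective \<mu> n x (a, b) = (\<Sum>i<n. (zs (Suc (Suc i)) - a * zs (Suc i) - b * zs i - \<mu>)\<^sup>2)" for a b
    by (rule cls_objective_eq[where zs = zs]) (use x z0 in auto)
  have bdd: "bdd_below (range (cls_objective \<mu> n x))"
    by (rule bdd_belowI[of _ 0]) (auto simp: cls_objective_def intro!: sum_nonneg)
  have min: "(\<Sum>i<n. (r i)\<^sup>2) \<le> cls_objective \<mu> n x p" for p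
  proof -
    have "(\<Sum>i<n. (r i)\<^sup>2) = cls_objective \<mu> n x (f x)" by (simp add: fx obj r_def)
    also have "\<dots> = (INF p. cls_objective \<mu> n x p)" using est xs by (simp add: cls_estimator_def)
    also have "\<dots> \<le> cls_objective \<mu> n x p" by (rule cINF_lower[OF bdd]) simp
    finally show ?thesis .
  qed
  have "(\<Sum>i<n. (r i)\<^sup>2) \<le> (\<Sum>i<n. (r i - t * zs (Suc i))\<^sup>2)" for t
    using min[of "(a + t, b)"] by (simp add: obj r_def algebra_simps)
  then show "(\<Sum>i<n. r i * zs (Suc i)) = 0" by (intro least_squares_orthogonality) auto
  have "(\<Sum>i<n. (r i)\<^sup>2) \<le> (\<Sum>i<n. (r i - t * zs i)\<^sup>2)" for t
    using min[of "(a, b + t)"] by (simp add: obj r_def algebra_simps)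
  then show "(\<Sum>i<n. r i * zs i) = 0" by (intro least_squares_orthogonality) auto
qed

theorem theorem1p2:
  fixes M :: "'a measure" and \<epsilon> :: "nat \<Rightarrow> 'a \<Rightarrow> nat" and X :: "int \<Rightarrow> 'a \<Rightarrow> nat"
    and est :: "nat \<Rightarrow> (nat \<Rightarrow> real) \<Rightarrow> real \<times> real" and \<mu> :: real
    and N :: "'b measure" and W :: "real \<Rightarrow> 'b \<Rightarrow> real"
  assumes "inar2_process M 0 1 \<epsilon> X"
    and "AE \<omega> in M. X 0 \<omega> = 0 \<and> X (-1) \<omega> = 0"
    and "integrable M (\<lambda>\<omega>. (real (\<epsilon> 1 \<omega>))\<^sup>2)"
    and "\<mu> = prob_space.expectation M (\<lambda>\<omega>. real (\<epsilon> 1 \<omega>))" and "\<mu> > 0"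
    and nondegenerate: "prob_space.variance M (\<lambda>\<omega>. real (\<epsilon> 1 \<omega>)) > 0"
    and "\<And>n. n \<ge> 1 \<Longrightarrow> cls_estimator \<mu> n (est n)"
    and "wiener_process N W"
  shows "converges_in_distribution M
           (\<lambda>n \<omega>. let (a, b) = est n (\<lambda>i\<in>{1..n}. real (X (int i) \<omega>))
                  in (real n * a, real n * (b - 1)))
           N
           (\<lambda>\<omega>. (ito_integral N W 1 W \<omega> / (LINT t:{0..1}|lborel. (W t \<omega>)\<^sup>2)) *\<^sub>R (-1, 1))"
proof -
  note X = assms(1) and X0 = assms(2) and est = assms(7)
  interpret w: wiener N W using assms(8) by (simp add: wiener_def)
  define e where "e i \<omega> = real (\<epsilon> (Suc i) \<omega>)" for i \<omega>
  define s2 where "s2 = prob_space.variance M (\<lambda>\<omega>. real (\<epsilon> 1 \<omega>))"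
  have s2_pos: "0 < s2" unfolding s2_def by (rule nondegenerate)
  interpret innovations M e \<mu> s2
    using inar2_innovations[OF X assms(3)] unfolding e_def[abs_def] s2_def assms(4) .
  let ?x = "\<lambda>n \<omega>. \<lambda>i\<in>{1..n}. real (X (int i) \<omega>)"
  have z_eq_X: "AE \<omega> in M. \<forall>n. z n \<omega> = real (X (int n - 1) \<omega>)"
    using inar2_nonprimitive_recursion[OF X] X0
  proof eventually_elim
    case (elim \<omega>)
    show ?case
    proof
      fix n
      show "z n \<omega> = real (X (int n - 1) \<omega>)"
      proof (induction n rule: less_induct)
        case (less n)
        consider "n = 0" | "n = Suc 0" | k where "n = Suc (Suc k)" by (metis z.cases prod.inject)
        then show ?case
        proof cases
          case (3 k)
          have "z k \<omega> = real (X (int k - 1) \<omega>)" using 3 by (intro less) simp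
          moreover have "X (int (Suc k)) \<omega> = X (int (Suc k) - 2) \<omega> + \<epsilon> (Suc k) \<omega>"
            using elim(1)[rule_format, of "Suc k"] by simp
          moreover have "int (Suc k) - 2 = int k - 1" "int n - 1 = int (Suc k)" using 3 by simp_all
          moreover have "z (Suc (Suc k)) \<omega> = z k \<omega> + e k \<omega>" by (rule z.simps)
          ultimately show ?thesis using 3 by (simp only: e_def[of k] of_nat_add)
        qed (use elim(2) in simp_all)
      qed
    qed
  qed
  have X_meas: "(\<lambda>\<omega>. real (X (int i) \<omega>)) \<in> borel_measurable M" for i
  proof -
    have "X (int i) \<in> M \<rightarrow>\<^sub>M count_space UNIV" using X by (simp add: inar2_process_def)
    then show ?thesis by (rule measurable_compose) simp
  qed
  have x_meas: "?x n \<in> M \<rightarrow>\<^sub>M sample_space n" for n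
    by (intro measurable_restrict X_meas)
  have x_space: "?x n \<omega> \<in> space (sample_space n)" for n \<omega>
    by (auto simp: space_PiM)
  \<comment> \<open>Nothing is known about the function \<open>est 0\<close>, so its value is replaced by the true parameter.\<close>
  define a where "a n \<omega> = (if n = 0 then 0 else fst (est n (?x n \<omega>)))" for n \<omega>
  define b where "b n \<omega> = (if n = 0 then 1 else snd (est n (?x n \<omega>)))" for n \<omega>
  have est_meas: "(\<lambda>\<omega>. est n (?x n \<omega>)) \<in> borel_measurable M" if "n \<noteq> 0" for n
  proof (rule measurable_compose[OF x_meas])
    show "est n \<in> borel_measurable (sample_space n)" using est[of n] that by (simp add: cls_estimator_def)
  qed
  have fst_meas: "fst \<in> borel_measurable (borel :: (real \<times> real) measure)"
    and snd_meas: "snd \<in> borel_measurable (borel :: (real \<times> real) measure)"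
    by (auto intro!: borel_measurable_continuous_onI continuous_intros)
  have a_meas [measurable]: "a n \<in> borel_measurable M" for n
    using measurable_compose[OF est_meas fst_meas, of n] unfolding a_def[abs_def] by (cases "n = 0") simp_all
  have b_meas [measurable]: "b n \<in> borel_measurable M" for n
    using measurable_compose[OF est_meas snd_meas, of n] unfolding b_def[abs_def] by (cases "n = 0") simp_all
  define c where "c n \<omega> = a n \<omega> + b n \<omega> - 1" for n \<omega>
  have c_meas [measurable]: "c n \<in> borel_measurable M" for n
    unfolding c_def[abs_def] by measurable
  have orth: "AE \<omega> in M. (\<Sum>i<n. (m i \<omega> - a n \<omega> * v i \<omega> - c n \<omega> * z i \<omega>) * z (Suc i) \<omega>) = 0 \<and>
      (\<Sum>i<n. (m i \<omega> - a n \<omega> * v i \<omega> - c n \<omega> * z i \<omega>) * z i \<omega>) = 0" for n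
  proof (cases "n = 0")
    case False
    show ?thesis
      using z_eq_X
    proof eventually_elim
      case (elim \<omega>)
      have fx: "est n (?x n \<omega>) = (a n \<omega>, b n \<omega>)" using False by (simp add: a_def b_def)
      have x: "?x n \<omega> i = z (Suc i) \<omega>" if "i \<in> {1..n}" for i using that elim by simp
      \<comment> \<open>Passing to the regressors \<open>v\<close> and \<open>z\<close> turns the second coefficient into the sum of both errors.\<close>
      have "z (Suc (Suc i)) \<omega> - a n \<omega> * z (Suc i) \<omega> - b n \<omega> * z i \<omega> - \<mu> = m i \<omega> - a n \<omega> * v i \<omega> - c n \<omega> * z i \<omega>" for i
        by (simp add: m_def v_def c_def algebra_simps)
      then show ?case
        using cls_normal_equations[where zs = "\<lambda>i. z i \<omega>", OF est x_space fx x] False by simp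
    qed
  qed simp
  have normal_z: "AE \<omega> in M. a n \<omega> * (\<Sum>i<n. z i \<omega> * v i \<omega>) + c n \<omega> * (\<Sum>i<n. (z i \<omega>)\<^sup>2) = (\<Sum>i<n. z i \<omega> * m i \<omega>)" for n
    using orth[of n]
  proof eventually_elim
    case (elim \<omega>)
    have "(\<Sum>i<n. (m i \<omega> - a n \<omega> * v i \<omega> - c n \<omega> * z i \<omega>) * z i \<omega>) =
        (\<Sum>i<n. z i \<omega> * m i \<omega>) - (a n \<omega> * (\<Sum>i<n. z i \<omega> * v i \<omega>) + c n \<omega> * (\<Sum>i<n. (z i \<omega>)\<^sup>2))"
      unfolding sum_distrib_left sum.distrib[symmetric] sum_subtractf[symmetric]
      by (intro sum.cong) (auto simp: power2_eq_square algebra_simps)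
    then show ?case using elim by simp
  qed
  have normal_v: "AE \<omega> in M. a n \<omega> * (\<Sum>i<n. (v i \<omega>)\<^sup>2) + c n \<omega> * (\<Sum>i<n. z i \<omega> * v i \<omega>) = (\<Sum>i<n. v i \<omega> * m i \<omega>)" for n
    using orth[of n]
  proof eventually_elim
    case (elim \<omega>)
    let ?r = "\<lambda>i. m i \<omega> - a n \<omega> * v i \<omega> - c n \<omega> * z i \<omega>"
    have "(\<Sum>i<n. ?r i * z (Suc i) \<omega>) - (\<Sum>i<n. ?r i * z i \<omega>) =
        (\<Sum>i<n. v i \<omega> * m i \<omega>) - (a n \<omega> * (\<Sum>i<n. (v i \<omega>)\<^sup>2) + c n \<omega> * (\<Sum>i<n. z i \<omega> * v i \<omega>))"
      unfolding sum_distrib_left sum.distrib[symmetric] sum_subtractf[symmetric] right_diff_distrib[symmetric] v_def[symmetric]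
      by (intro sum.cong) (auto simp: power2_eq_square algebra_simps)
    then show ?case using elim by simp
  qed
  define \<rho> where "\<rho> \<omega> = - (((W 1 \<omega>)\<^sup>2 - 1) / 2) / w.square_integral \<omega>" for \<omega>
  have W1: "W 1 \<in> borel_measurable N" by simp
  have \<rho>_meas: "\<rho> \<in> borel_measurable N" unfolding \<rho>_def[abs_def] using W1 by measurable
  have \<mu>0: "\<mu> \<noteq> 0" using assms(5) by simp
  note lim = estimator_limit[OF w.wiener_axioms \<mu>0 s2_pos a_meas c_meas normal_v normal_z, folded \<rho>_def]
  let ?Y = "\<lambda>n \<omega>. let (a, b) = est n (?x n \<omega>) in (real n * a, real n * (b - 1))"
  let ?Z = "\<lambda>\<omega>. (ito_integral N W 1 W \<omega> / (LINT t:{0..1}|lborel. (W t \<omega>)\<^sup>2)) *\<^sub>R (-1 :: real, 1 :: real)"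
  have Y_eq: "?Y n \<omega> = (real n * a n \<omega>, real n * c n \<omega> - real n * a n \<omega>)" for n \<omega>
    by (cases "n = 0") (simp_all add: a_def b_def c_def case_prod_beta algebra_simps)
  have Z_meas: "?Z \<in> borel_measurable N"
  proof -
    have "(\<lambda>\<omega>. LINT t:{0..1}|lborel. (W t \<omega>)\<^sup>2) \<in> borel_measurable N"
      using w.measurable_square_integral by (rule measurable_cong[THEN iffD2, rotated]) (rule w.square_integral_eq_set_integral)
    then have "(\<lambda>\<omega>. ito_integral N W 1 W \<omega> / (LINT t:{0..1}|lborel. (W t \<omega>)\<^sup>2)) \<in> borel_measurable N"
      by (rule borel_measurable_divide[OF w.ito_integral_W_measurable])
    then show ?thesis by (rule borel_measurable_scaleR) simp
  qed
  have Z_eq: "AE \<omega> in N. ?Z \<omega> = (\<rho> \<omega>, - \<rho> \<omega>)"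
    using w.ito_integral_W AE_space
  proof eventually_elim
    case (elim \<omega>)
    show ?case
      unfolding elim(1) w.square_integral_eq_set_integral[OF elim(2)] by (simp add: \<rho>_def)
  qed
  show ?thesis
    unfolding converges_in_distribution_def
  proof (intro conjI allI impI)
    show "?Y n \<in> borel_measurable M" for n
      unfolding Y_eq by (intro borel_measurable_Pair) measurable
    show "?Z \<in> borel_measurable N" by (rule Z_meas)
    fix f :: "real \<times> real \<Rightarrow> real" assume f: "continuous_on UNIV f \<and> bounded (range f)"
    then obtain B where B: "\<And>p. \<bar>f p\<bar> \<le> B" by (auto simp: bounded_iff)
    have [measurable]: "f \<in> borel_measurable borel" using f by (intro borel_measurable_continuous_onI) simp
    have "(\<integral>\<omega>. f (?Z \<omega>) \<partial>N) = (\<integral>\<omega>. f (\<rho> \<omega>, - \<rho> \<omega>) \<partial>N)"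
    proof (rule integral_cong_AE)
      show "(\<lambda>\<omega>. f (?Z \<omega>)) \<in> borel_measurable N" by (rule measurable_compose[OF Z_meas]) simp
      have "(\<lambda>\<omega>. (\<rho> \<omega>, - \<rho> \<omega>)) \<in> borel_measurable N"
        using \<rho>_meas by (intro borel_measurable_Pair borel_measurable_uminus)
      then show "(\<lambda>\<omega>. f (\<rho> \<omega>, - \<rho> \<omega>)) \<in> borel_measurable N" by (rule measurable_compose) simp
      show "AE \<omega> in N. f (?Z \<omega>) = f (\<rho> \<omega>, - \<rho> \<omega>)" using Z_eq by eventually_elim simp
    qed
    moreover have "(\<lambda>n. expectation (\<lambda>\<omega>. f (real n * a n \<omega>, real n * c n \<omega> - real n * a n \<omega>))) \<longlonglongrightarrow> (\<integral>\<omega>. f (\<rho> \<omega>, - \<rho> \<omega>) \<partial>N)"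
      using f B by (intro converges_in_law_imp_plane[OF w.prob_space_axioms _ _ \<rho>_meas lim]) auto
    ultimately show "(\<lambda>n. \<integral>\<omega>. f (?Y n \<omega>) \<partial>M) \<longlonglongrightarrow> (\<integral>\<omega>. f (?Z \<omega>) \<partial>N)"
      unfolding Y_eq by simp
  qed
qed

end
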